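(* Fix a constant $c>0$ and a sequence of finite $d$-regular graphs $(G_d)_{d\in\mathbb{N}}$. Let $p=p(d)=c/d$, and let $(G_d)_p$ denote the random spanning subgraph of $G_d$ obtained by retaining each edge of $G_d$ independently with probability $p$. Let $y=y(c)$ be the smallest solution in $(0,1)$ of $y=\exp(-c\exp(-cy))$, and set $$F(c)=1-\frac{y+\exp(-cy)+cy\exp(-cy)}{2}.$$ Then $$\frac{\nu\big((G_d)_p\big)}{|V(G_d)|}\xrightarrow[d\to\infty]{} F(c)\quad\text{in probability.}$$
   Context: For a graph $H$, a matching is a set of pairwise non-adjacent edges, and $\nu(H)$ (the matching number) is the maximum size of a matching in $H$. *)

theory Defs
  imports "HOL-Probability.Probability"
begin

definition simple_graph :: "'a set \<Rightarrow> 'a set set \<Rightarrow> bool" where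
  "simple_graph V E \<longleftrightarrow> finite V \<and> (\<forall>e\<in>E. e \<subseteq> V \<and> card e = 2)"

definition degree :: "'a set set \<Rightarrow> 'a \<Rightarrow> nat" where
  "degree E v = card {e\<in>E. v \<in> e}"

definition regular_graph :: "nat \<Rightarrow> 'a set \<Rightarrow> 'a set set \<Rightarrow> bool" where
  "regular_graph d V E \<longleftrightarrow> simple_graph V E \<and> (\<forall>v\<in>V. degree E v = d)"

definition matching :: "'a set set \<Rightarrow> 'a set set \<Rightarrow> bool" where
  "matching E M \<longleftrightarrow> M \<subseteq> E \<and> (\<forall>e1\<in>M. \<forall>e2\<in>M. e1 \<noteq> e2 \<longrightarrow> e1 \<inter> e2 = {})"

text \<open>Matching number (for a finite edge set).\<close>
definition matching_number :: "'a set set \<Rightarrow> nat" where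
  "matching_number E = Max (card ` {M. matching E M})"

definition random_subgraph :: "'a set set \<Rightarrow> real \<Rightarrow> 'a set set pmf" where
  "random_subgraph E p =
     map_pmf (\<lambda>f. {e\<in>E. f e}) (Pi_pmf E False (\<lambda>_. bernoulli_pmf p))"

definition y_c :: "real \<Rightarrow> real" where
  "y_c c = Inf {y. 0 < y \<and> y < 1 \<and> y = exp (- c * exp (- c * y))}"

definition F_c :: "real \<Rightarrow> real" where
  "F_c c = 1 - (y_c c + exp (- c * y_c c) + c * y_c c * exp (- c * y_c c)) / 2"

end

(*
  For a parameter l > 0 weight a matching M of the percolated graph H by l ^ |M|. As l grows, the mean
  number of uncovered vertices tends to |V| - 2 nu(H), with an error controlled by the number of edges.
  The probability that v is uncovered satisfies r(v) = 1 / (1 + l * sum of r(u) over the neighbours u of v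
  in H - v), so iterating this recursion from the constant 1 gives alternately upper and lower bounds.
  Each iterate is a local function of H; by induction on its depth, using Laplace transforms and a second
  moment argument, its law converges to that of the same iterate on a Galton-Watson tree with Poisson(c)
  offspring. On the tree, Mecke's formula for Poisson point processes expresses the expectation of an
  iterate through the probability t that it is not negligible, as (up to errors) the value at t of
  the function ks_potential. The lower iterates yield t = y, and y maximises ks_potential, so the upper
  iterates cannot do better. Finally, nu(H) is 1-Lipschitz in every edge and hence concentrated.
*)
theory Submission
  imports Defs "HOL-Real_Asymp.Real_Asymp"
begin

section \<open>The Karp--Sipser fixed point\<close>

text \<open>At \<open>l\<close> = infinity the lower and upper tree iterates are nonzero with
  probabilities \<open>(ks_map c ^^ k) 0\<close> and \<open>(ks_map c ^^ k) 1\<close>, which tend to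
  the smallest and the largest fixed point of \<open>ks_map c\<close>. For c > e these differ, so
  the gap cannot be closed by uniqueness for the limiting recursion. Only means are compared, and
  the potential takes the same value at the two fixed points. The upper bound is therefore run at
  finite \<open>l\<close>, where the recursion is Lipschitz and consecutive even iterates become
  close in mean as the depth grows. No value is exactly zero there, so smallness is measured against
  thresholds. The graphs may have many short cycles. The recursion carries the set \<open>W\<close>
  of deleted vertices, and deleting one more vertex changes a message by O(1/d) in mean; hence
  messages of distinct neighbours decorrelate although neighbourhoods need not look like trees. For
  the upper iterates the order of choices is: error, \<open>l\<close>, depth, and finally
  \<open>d\<close>.\<close>

definition ks_map :: "real \<Rightarrow> real \<Rightarrow> real" where
  "ks_map c x = exp (- c * exp (- c * x))"

text \<open>The first two summands form the probability that a Poisson variable of mean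
  \<open>c * x\<close> is at most 1. So the potential is the probability that a root is nonzero when
  its grandchildren are nonzero with probability \<open>x\<close>, minus the probability of at least
  two nonzero children when each child is nonzero with probability \<open>x\<close>.\<close>

definition ks_potential :: "real \<Rightarrow> real \<Rightarrow> real" where
  "ks_potential c x = c * x * exp (- c * x) + exp (- c * x) + ks_map c x - 1"

lemma ks_map_mono: "c > 0 \<Longrightarrow> x \<le> y \<Longrightarrow> ks_map c x \<le> ks_map c y"
  by (simp add: ks_map_def)

lemma ks_map_pos: "0 < ks_map c x"
  by (simp add: ks_map_def)

lemma ks_map_less_1: "c > 0 \<Longrightarrow> ks_map c x < 1"
  by (simp add: ks_map_def)

lemma continuous_ks_map: "continuous_on A (ks_map c)"
  unfolding ks_map_def by (intro continuous_intros)

lemma ks_iterates_incseq: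
  assumes "c > 0"
  shows "incseq (\<lambda>k. (ks_map c ^^ k) 0)"
proof (rule incseq_SucI)
  fix k show "(ks_map c ^^ k) 0 \<le> (ks_map c ^^ Suc k) 0"
  proof (induction k)
    case 0 then show ?case using ks_map_pos[of c 0] by simp
  next
    case (Suc k) then show ?case using ks_map_mono[OF assms] by simp
  qed
qed

text \<open>The iterates of 0 increase and stay below every fixed point, so their limit is the least
  one. All values of \<open>ks_map c\<close> lie strictly between 0 and 1, which identifies this
  limit with the infimum in \<open>y_c\<close> and shows that the infimum is attained.\<close>

lemma ks_iterates_tendsto:
  assumes "c > 0"
  shows "(\<lambda>k. (ks_map c ^^ k) 0) \<longlonglongrightarrow> y_c c"
    and "\<And>k. (ks_map c ^^ k) 0 \<le> y_c c"
    and "ks_map c (y_c c) = y_c c"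
    and "0 < y_c c" and "y_c c < 1"
    and "\<And>x. ks_map c x = x \<Longrightarrow> y_c c \<le> x"
proof -
  let ?t = "\<lambda>k. (ks_map c ^^ k) 0"
  have le1: "?t k \<le> 1" for k
    by (cases k) (use ks_map_less_1[OF assms] in \<open>auto intro: less_imp_le\<close>)
  obtain L where L: "?t \<longlonglongrightarrow> L" and Lge: "\<And>k. ?t k \<le> L"
    using incseq_convergent[OF ks_iterates_incseq[OF assms], of 1] le1 by auto
  have "(\<lambda>k. ks_map c (?t k)) \<longlonglongrightarrow> ks_map c L"
    by (rule continuous_on_tendsto_compose[OF continuous_ks_map[of UNIV] L]) auto
  moreover have "(\<lambda>k. ks_map c (?t k)) \<longlonglongrightarrow> L"
    using LIMSEQ_Suc[OF L] by simp
  ultimately have fix_L: "ks_map c L = L" using LIMSEQ_unique by blast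
  have below: "?t k \<le> x" if "ks_map c x = x" for x k
  proof (induction k)
    case 0 then show ?case using ks_map_pos[of c x] that by simp
  next
    case (Suc k) then show ?case using ks_map_mono[OF assms Suc] that by simp
  qed
  have least: "L \<le> x" if "ks_map c x = x" for x
    using LIMSEQ_le_const2[OF L] below[OF that] by blast
  have L01: "0 < L" "L < 1" using ks_map_pos[of c L] ks_map_less_1[OF assms, of L] fix_L by auto
  have "y_c c = L"
    unfolding y_c_def
  proof (rule cInf_eq_minimum)
    show "L \<in> {y. 0 < y \<and> y < 1 \<and> y = exp (- c * exp (- c * y))}"
      using L01 fix_L by (simp add: ks_map_def)
    show "L \<le> x" if "x \<in> {y. 0 < y \<and> y < 1 \<and> y = exp (- c * exp (- c * y))}" for x
      using that least[of x] unfolding ks_map_def by auto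
  qed
  then show "?t \<longlonglongrightarrow> y_c c" "\<And>k. ?t k \<le> y_c c" "ks_map c (y_c c) = y_c c"
    "0 < y_c c" "y_c c < 1" "\<And>x. ks_map c x = x \<Longrightarrow> y_c c \<le> x"
    using L Lge fix_L L01 least by auto
qed

text \<open>\<open>1 - 2 * F_c c\<close>, the limiting fraction of vertices missed by a maximum
  matching, is the potential at \<open>y_c c\<close>; the fixed point equation trades
  \<open>ks_map c y\<close> for \<open>y\<close>.\<close>

lemma F_c_eq_potential: "c > 0 \<Longrightarrow> F_c c = (1 - ks_potential c (y_c c)) / 2"
  using ks_iterates_tendsto(3)[of c] by (simp add: F_c_def ks_potential_def field_simps)

text \<open>This is why the potential is useful: its stationary points are exactly the fixed points
  of \<open>ks_map c\<close>, and it increases where the map lies above the diagonal.\<close>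

lemma ks_potential_deriv:
  "(ks_potential c has_real_derivative c\<^sup>2 * exp (- c * x) * (ks_map c x - x)) (at x)"
  unfolding ks_potential_def ks_map_def
  by (auto intro!: derivative_eq_intros simp: algebra_simps power2_eq_square)

lemma ks_potential_mono_on:
  assumes "a \<le> b" "\<And>x. a \<le> x \<Longrightarrow> x \<le> b \<Longrightarrow> x \<le> ks_map c x"
  shows "ks_potential c a \<le> ks_potential c b"
  by (rule DERIV_nonneg_imp_nondecreasing[OF assms(1)])
     (use ks_potential_deriv assms(2) in \<open>fastforce intro!: mult_nonneg_nonneg\<close>)

lemma ks_potential_antimono_on:
  assumes "a \<le> b" "\<And>x. a \<le> x \<Longrightarrow> x \<le> b \<Longrightarrow> ks_map c x \<le> x"
  shows "ks_potential c b \<le> ks_potential c a"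
  by (rule DERIV_nonpos_imp_nonincreasing[OF assms(1)])
     (use ks_potential_deriv assms(2) in \<open>fastforce intro!: mult_nonneg_nonpos\<close>)

text \<open>The function rises up to \<open>1 / c\<close> and falls afterwards, so its superlevel
  sets are intervals. In \<open>ks_potential_le\<close> this excludes that the derivative of
  \<open>ln x + c * exp (- c * x)\<close> is negative, then positive, then negative again.\<close>

lemma mult_exp_quasiconcave:
  fixes c :: real
  assumes "c > 0" "0 < p" "p < q" "q < r"
    and "K \<le> p * exp (- c * p)" "K \<le> r * exp (- c * r)"
  shows "K \<le> q * exp (- c * q)"
proof -
  let ?h = "\<lambda>x. x * exp (- c * x)"
  have deriv: "(?h has_real_derivative exp (- c * x) * (1 - c * x)) (at x)" for x
    by (auto intro!: derivative_eq_intros simp: algebra_simps)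
  show ?thesis
  proof (cases "q \<le> 1 / c")
    case True
    have "?h p \<le> ?h q"
    proof (rule DERIV_nonneg_imp_nondecreasing[where f = ?h])
      show "p \<le> q" using assms by simp
      fix x assume "p \<le> x" "x \<le> q"
      then have "c * x \<le> 1" using True \<open>c > 0\<close> by (simp add: field_simps) (smt (verit) mult.commute mult_left_mono)
      then show "\<exists>y. (?h has_real_derivative y) (at x) \<and> 0 \<le> y"
        using deriv by (intro exI[of _ "exp (- c * x) * (1 - c * x)"]) auto
    qed
    then show ?thesis using assms by simp
  next
    case False
    have "?h r \<le> ?h q"
    proof (rule DERIV_nonpos_imp_nonincreasing[where f = ?h])
      show "q \<le> r" using assms by simp
      fix x assume "q \<le> x" "x \<le> r"
      then have "1 / c \<le> x" using False by simp
      then have "1 \<le> c * x" using \<open>c > 0\<close> by (simp add: field_simps)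
      then show "\<exists>y. (?h has_real_derivative y) (at x) \<and> y \<le> 0"
        using deriv by (intro exI[of _ "exp (- c * x) * (1 - c * x)"]) (auto intro!: mult_nonneg_nonpos)
    qed
    then show ?thesis using assms by simp
  qed
qed

text \<open>Taking logarithms replaces the doubly exponential comparison by the sign of a function
  whose derivative is easy to control.\<close>

lemma ks_map_sign:
  assumes "x > 0"
  shows "ks_map c x \<le> x \<longleftrightarrow> 0 \<le> ln x + c * exp (- c * x)"
    and "x \<le> ks_map c x \<longleftrightarrow> ln x + c * exp (- c * x) \<le> 0"
proof -
  have "ks_map c x \<le> x \<longleftrightarrow> ln (ks_map c x) \<le> ln x"
    using ks_map_pos assms by (subst ln_le_cancel_iff) auto
  then show "ks_map c x \<le> x \<longleftrightarrow> 0 \<le> ln x + c * exp (- c * x)" by (auto simp: ks_map_def)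
  have "x \<le> ks_map c x \<longleftrightarrow> ln x \<le> ln (ks_map c x)"
    using ks_map_pos assms by (subst ln_le_cancel_iff) auto
  then show "x \<le> ks_map c x \<longleftrightarrow> ln x + c * exp (- c * x) \<le> 0" by (auto simp: ks_map_def)
qed

text \<open>The map \<open>x \<mapsto> exp (- c * x)\<close> exchanges the least fixed point
  \<open>y\<close> with the greatest one \<open>z\<close> and has a fixed point \<open>w\<close>
  between them. On the intervals cut out by \<open>y\<close>, \<open>w\<close>, \<open>z\<close> the
  potential rises, falls, rises and falls, and its two peaks \<open>y\<close> and \<open>z\<close>
  have equal height.\<close>

lemma ks_potential_le:
  assumes c: "c > 0" and x: "0 \<le> x" "x \<le> 1"
  shows "ks_potential c x \<le> ks_potential c (y_c c)"
proof -
  define y where "y = y_c c"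
  define z where "z = exp (- c * y)"
  define g where "g = (\<lambda>x. ln x + c * exp (- c * x))"
  note y_facts = ks_iterates_tendsto(3-6)[OF c, folded y_def]
  have y_pos: "y > 0" and fy: "exp (- c * z) = y"
    using y_facts by (auto simp: z_def ks_map_def)
  have fz: "ks_map c z = z" using fy by (simp add: ks_map_def z_def)
  have z_pos: "z > 0" and z1: "z < 1" using c y_pos by (auto simp: z_def)
  have yz: "y \<le> z" using y_facts(4)[OF fz] .
  \<comment> \<open>With \<open>exp (- c * y) = z\<close> and \<open>exp (- c * z) = y\<close> both
    values equal \<open>c * y * z + y + z - 1\<close>.\<close>
  have pot_z: "ks_potential c z = ks_potential c y"
    using fy fz y_facts(1) by (simp add: ks_potential_def z_def algebra_simps)
  \<comment> \<open>The map \<open>x \<mapsto> exp (- c * x)\<close> sends fixed points of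
    \<open>ks_map c\<close> to fixed points and reverses order, so it takes the least to the
    greatest.\<close>
  have z_greatest: "v \<le> z" if "ks_map c v = v" for v
  proof -
    have "ks_map c (exp (- c * v)) = exp (- c * v)" using that by (simp add: ks_map_def)
    then have "y \<le> exp (- c * v)" by (rule y_facts(4))
    then have "exp (- c * exp (- c * v)) \<le> exp (- c * y)" using c by simp
    then show ?thesis using that unfolding ks_map_def z_def by argo
  qed
  have left: "v \<le> ks_map c v" if "0 \<le> v" "v \<le> y" for v
  proof (rule ccontr)
    assume neg: "\<not> ?thesis"
    then have "\<exists>u\<ge>0. u \<le> v \<and> u - ks_map c u = 0"
      using that ks_map_pos[of c 0] by (intro IVT') (auto intro!: continuous_intros continuous_ks_map)
    then obtain u where "u \<le> v" "ks_map c u = u" by auto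
    then have "y = v" using y_facts(4)[of u] that by auto
    then show False using neg y_facts by simp
  qed
  have right: "ks_map c v \<le> v" if "z \<le> v" "v \<le> 1" for v
  proof (rule ccontr)
    assume neg: "\<not> ?thesis"
    then have "\<exists>u\<ge>v. u \<le> 1 \<and> u - ks_map c u = 0"
      using that ks_map_less_1[OF c, of 1] by (intro IVT') (auto intro!: continuous_intros continuous_ks_map)
    then obtain u where "v \<le> u" "ks_map c u = u" by auto
    then have "z = v" using z_greatest[of u] that by auto
    then show False using neg fz by simp
  qed
  have "\<exists>w\<ge>y. w \<le> z \<and> w - exp (- c * w) = 0"
    using yz fy by (intro IVT') (auto intro!: continuous_intros simp: z_def)
  then obtain w where w: "y \<le> w" "w \<le> z" "exp (- c * w) = w" by auto
  have fw: "ks_map c w = w" using w(3) by (simp add: ks_map_def)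
  have w_pos: "w > 0" using w y_pos by simp
  have g0: "g v = 0" if "v > 0" "ks_map c v = v" for v
    using ks_map_sign[OF that(1), of c] that by (simp add: g_def)
  have g_y: "g y = 0" and g_w: "g w = 0" and g_z: "g z = 0"
    using g0 y_pos z_pos w_pos fw fz y_facts by auto
  have g_deriv: "(g has_real_derivative (1 - c\<^sup>2 * (v * exp (- c * v))) / v) (at v)" if "v > 0" for v
    unfolding g_def using that
    by (auto intro!: derivative_eq_intros simp: field_simps power2_eq_square)
  have mvt: "\<exists>v. a < v \<and> v < b \<and> g b - g a = (b - a) * ((1 - c\<^sup>2 * (v * exp (- c * v))) / v)"
    if "0 < a" "a < b" for a b
  proof -
    have "(g has_real_derivative (1 - c\<^sup>2 * (v * exp (- c * v))) / v) (at v)" if "a \<le> v" "v \<le> b" for v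
      using g_deriv[of v] that \<open>0 < a\<close> by linarith
    from MVT2[OF \<open>a < b\<close> this] show ?thesis by blast
  qed
  have incr: "\<exists>v. a < v \<and> v < b \<and> v * exp (- c * v) < 1 / c\<^sup>2" if ab: "0 < a" "a < b" "g a < g b" for a b
  proof -
    obtain v where v: "a < v" "v < b" "g b - g a = (b - a) * ((1 - c\<^sup>2 * (v * exp (- c * v))) / v)"
      using mvt[OF ab(1,2)] by auto
    then have "0 < (b - a) * ((1 - c\<^sup>2 * (v * exp (- c * v))) / v)" using ab by simp
    then have "0 < 1 - c\<^sup>2 * (v * exp (- c * v))" using v ab by (simp add: zero_less_mult_iff zero_less_divide_iff)
    then show ?thesis using v c by (intro exI[of _ v]) (simp add: field_simps)
  qed
  have decr: "\<exists>v. a < v \<and> v < b \<and> 1 / c\<^sup>2 \<le> v * exp (- c * v)" if ab: "0 < a" "a < b" "g b \<le> g a" for a b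
  proof -
    obtain v where v: "a < v" "v < b" "g b - g a = (b - a) * ((1 - c\<^sup>2 * (v * exp (- c * v))) / v)"
      using mvt[OF ab(1,2)] by auto
    then have "(b - a) * ((1 - c\<^sup>2 * (v * exp (- c * v))) / v) \<le> 0" using ab by simp
    then have "1 - c\<^sup>2 * (v * exp (- c * v)) \<le> 0" using v ab by (simp add: mult_le_0_iff divide_le_0_iff)
    then show ?thesis using v c by (intro exI[of _ v]) (simp add: field_simps)
  qed
  \<comment> \<open>A negative value of \<open>g\<close> at \<open>v\<close> would make
    \<open>g\<close> fall before \<open>v\<close> and rise between \<open>v\<close> and
    \<open>w\<close>, while it cannot rise throughout from \<open>w\<close> to \<open>z\<close>
    because it vanishes at both. The three mean value points contradict
    \<open>mult_exp_quasiconcave\<close>.\<close>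
  have mid1: "0 \<le> g v" if v: "y \<le> v" "v \<le> w" for v
  proof (rule ccontr)
    assume neg: "\<not> ?thesis"
    then have "v \<noteq> y" "v \<noteq> w" using g_y g_w by auto
    then have strict: "y < v" "v < w" using v by auto
    have "w \<noteq> z"
    proof
      assume "w = z"
      then have "y = w" using w(3) fy by simp
      then show False using strict by simp
    qed
    obtain p where p: "y < p" "p < v" "1 / c\<^sup>2 \<le> p * exp (- c * p)" using decr[of y v] neg g_y y_pos strict by auto
    obtain q where q: "v < q" "q < w" "q * exp (- c * q) < 1 / c\<^sup>2" using incr[of v w] neg g_w y_pos strict by auto
    obtain r where r: "w < r" "r < z" "1 / c\<^sup>2 \<le> r * exp (- c * r)" using decr[of w z] g_w g_z w_pos w \<open>w \<noteq> z\<close> by auto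
    show False using mult_exp_quasiconcave[OF c, of p q r "1 / c\<^sup>2"] p q r y_pos by auto
  qed
  \<comment> \<open>Mirror image of \<open>mid1\<close>: the first weak descent is now found between
    \<open>y\<close> and \<open>w\<close>.\<close>
  have mid2: "g v \<le> 0" if v: "w \<le> v" "v \<le> z" for v
  proof (rule ccontr)
    assume neg: "\<not> ?thesis"
    then have "v \<noteq> w" "v \<noteq> z" using g_z g_w by auto
    then have strict: "w < v" "v < z" using v by auto
    have "w \<noteq> y"
    proof
      assume "w = y"
      then have "z = w" using w(3) by (simp add: z_def)
      then show False using strict by simp
    qed
    obtain p where p: "y < p" "p < w" "1 / c\<^sup>2 \<le> p * exp (- c * p)" using decr[of y w] g_w g_y y_pos w \<open>w \<noteq> y\<close> by auto
    obtain q where q: "w < q" "q < v" "q * exp (- c * q) < 1 / c\<^sup>2" using incr[of w v] neg g_w w_pos strict by auto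
    obtain r where r: "v < r" "r < z" "1 / c\<^sup>2 \<le> r * exp (- c * r)" using decr[of v z] neg g_z w_pos strict by auto
    show False using mult_exp_quasiconcave[OF c, of p q r "1 / c\<^sup>2"] p q r y_pos by auto
  qed
  consider "x \<le> y" | "y \<le> x" "x \<le> w" | "w \<le> x" "x \<le> z" | "z \<le> x" by linarith
  then have "ks_potential c x \<le> ks_potential c y"
  proof cases
    case 1 then show ?thesis using x left by (intro ks_potential_mono_on) auto
  next
    case 2 then show ?thesis
      using mid1 ks_map_sign(1)[of _ c] y_pos by (intro ks_potential_antimono_on) (auto simp: g_def)
  next
    case 3
    then have "ks_potential c x \<le> ks_potential c z"
      using mid2 ks_map_sign(2)[of _ c] w_pos by (intro ks_potential_mono_on) (auto simp: g_def)
    then show ?thesis using pot_z by simp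
  next
    case 4 then have "ks_potential c x \<le> ks_potential c z" using x right by (intro ks_potential_antimono_on) auto
    then show ?thesis using pot_z by simp
  qed
  then show ?thesis by (simp add: y_def)
qed

section \<open>The monomer-dimer model\<close>

definition two_uniform :: "'a set set \<Rightarrow> bool" where
  "two_uniform H \<longleftrightarrow> finite H \<and> (\<forall>e\<in>H. card e = 2)"

text \<open>Vertex deletion is encoded by a forbidden set: these are the matchings of
  \<open>H - W\<close>, while \<open>H\<close> itself stays fixed along the recursion.\<close>

definition avoiding_matchings :: "'a set set \<Rightarrow> 'a set \<Rightarrow> 'a set set set" where
  "avoiding_matchings H W = {M. matching H M \<and> (\<forall>e\<in>M. e \<inter> W = {})}"

definition partition_function :: "real \<Rightarrow> 'a set set \<Rightarrow> 'a set \<Rightarrow> real" where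
  "partition_function l H W = (\<Sum>M\<in>avoiding_matchings H W. l ^ card M)"

text \<open>For \<open>v\<close> outside \<open>W\<close> the numerator collects the weights of the
  matchings of \<open>H - W\<close> that miss \<open>v\<close>, so this is the monomer probability
  of \<open>v\<close> in \<open>H - W\<close>.\<close>

definition uncovered_prob :: "real \<Rightarrow> 'a set set \<Rightarrow> 'a set \<Rightarrow> 'a \<Rightarrow> real" where
  "uncovered_prob l H W v = partition_function l H (insert v W) / partition_function l H W"

definition free_nbrs :: "'a set set \<Rightarrow> 'a set \<Rightarrow> 'a \<Rightarrow> 'a set" where
  "free_nbrs H W v = {u. {v, u} \<in> H \<and> u \<notin> W}"

text \<open>The recursion runs along self-avoiding walks from \<open>v\<close>: each step deletes
  the vertex just left. Its computation tree is Godsil's path tree, cut at depth \<open>k\<close>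
  with boundary value 1.\<close>

fun uncovered_approx :: "real \<Rightarrow> 'a set set \<Rightarrow> nat \<Rightarrow> 'a set \<Rightarrow> 'a \<Rightarrow> real" where
  "uncovered_approx l H 0 W v = 1"
| "uncovered_approx l H (Suc k) W v =
     1 / (1 + l * (\<Sum>u\<in>free_nbrs H W v. uncovered_approx l H k (insert v W) u))"

lemma finite_free_nbrs:
  assumes "finite H"
  shows "finite (free_nbrs H W v)"
proof -
  have "inj_on (\<lambda>u. {v, u}) (free_nbrs H W v)"
    by (auto simp: inj_on_def doubleton_eq_iff)
  moreover have "(\<lambda>u. {v, u}) ` free_nbrs H W v \<subseteq> H" by (auto simp: free_nbrs_def)
  ultimately show ?thesis using assms finite_imageD finite_subset by metis
qed

lemma two_uniform_not_loop: "two_uniform H \<Longrightarrow> {v, u} \<in> H \<Longrightarrow> u \<noteq> v"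
  by (auto simp: two_uniform_def)

lemma two_uniform_edge: 
  assumes "two_uniform H" "e \<in> H" "v \<in> e"
  obtains u where "e = {v, u}" "u \<noteq> v"
proof -
  have "card e = 2" using assms by (auto simp: two_uniform_def)
  then show ?thesis using assms(3) that by (auto simp: card_2_iff)
qed

lemma finite_avoiding_matchings: "finite H \<Longrightarrow> finite (avoiding_matchings H W)"
  by (rule finite_subset[of _ "Pow H"]) (auto simp: avoiding_matchings_def matching_def)

lemma finite_avoiding_matching: "finite H \<Longrightarrow> M \<in> avoiding_matchings H W \<Longrightarrow> finite M"
  by (auto simp: avoiding_matchings_def matching_def intro: finite_subset)

lemma empty_avoiding: "{} \<in> avoiding_matchings H W"
  by (auto simp: avoiding_matchings_def matching_def)

lemma partition_function_pos:
  assumes "finite H" "l > 0"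
  shows "partition_function l H W > 0"
  unfolding partition_function_def
  using assms empty_avoiding finite_avoiding_matchings by (intro sum_pos) fastforce+

text \<open>A matching of \<open>H - W\<close> either misses \<open>v\<close> or contains exactly
  one edge \<open>{v, u}\<close>; removing that edge leaves a matching that avoids both ends and
  costs one factor \<open>l\<close>.\<close>

lemma partition_function_rec:
  assumes H: "two_uniform H" and v: "v \<notin> W"
  shows "partition_function l H W = partition_function l H (insert v W)
     + l * (\<Sum>u\<in>free_nbrs H W v. partition_function l H (insert u (insert v W)))"
proof -
  let ?A = "avoiding_matchings H"
  have finH: "finite H" using H by (simp add: two_uniform_def)
  define C where "C u = insert {v, u} ` ?A (insert u (insert v W))" for u
  have v_notin: "{v, u} \<notin> M" if "M \<in> ?A (insert u (insert v W))" for u M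
    using that by (auto simp: avoiding_matchings_def)
  have split: "?A W = ?A (insert v W) \<union> (\<Union>u\<in>free_nbrs H W v. C u)"
  proof (intro equalityI subsetI)
    fix M assume M: "M \<in> ?A W"
    show "M \<in> ?A (insert v W) \<union> (\<Union>u\<in>free_nbrs H W v. C u)"
    proof (cases "\<exists>e\<in>M. v \<in> e")
      case True
      then obtain e where e: "e \<in> M" "v \<in> e" by auto
      have "e \<in> H" using M e by (auto simp: avoiding_matchings_def matching_def)
      then obtain u where u: "e = {v, u}" "u \<noteq> v" using two_uniform_edge[OF H _ e(2)] by blast
      have "u \<in> free_nbrs H W v" using M e u \<open>e \<in> H\<close> by (auto simp: free_nbrs_def avoiding_matchings_def)
      moreover have "M - {e} \<in> ?A (insert u (insert v W))"
      proof -
        have "e' \<inter> insert u (insert v W) = {}" if "e' \<in> M - {e}" for e'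
        proof -
          have "e' \<inter> e = {}" using M e that unfolding avoiding_matchings_def matching_def by blast
          moreover have "e' \<inter> W = {}" using M that unfolding avoiding_matchings_def by blast
          ultimately show ?thesis by (auto simp: u)
        qed
        moreover have "matching H (M - {e})" using M unfolding avoiding_matchings_def matching_def by blast
        ultimately show ?thesis unfolding avoiding_matchings_def by blast
      qed
      moreover have "M = insert {v, u} (M - {e})" using e u by auto
      ultimately show ?thesis unfolding C_def by blast
    next
      case False
      then show ?thesis using M by (auto simp: avoiding_matchings_def)
    qed
  next
    fix M assume "M \<in> ?A (insert v W) \<union> (\<Union>u\<in>free_nbrs H W v. C u)"
    then show "M \<in> ?A W"
    proof
      assume "M \<in> ?A (insert v W)" then show ?thesis by (auto simp: avoiding_matchings_def)
    next
      assume "M \<in> (\<Union>u\<in>free_nbrs H W v. C u)"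
      then obtain u M' where u: "u \<in> free_nbrs H W v" "M' \<in> ?A (insert u (insert v W))" "M = insert {v, u} M'"
        by (auto simp: C_def)
      then show ?thesis using v by (auto simp: avoiding_matchings_def matching_def free_nbrs_def)
    qed
  qed
  have fin: "finite (free_nbrs H W v)" "\<And>u. finite (C u)" "finite (?A (insert v W))"
    by (simp_all add: finite_free_nbrs finite_avoiding_matchings finH C_def)
  have disj1: "?A (insert v W) \<inter> (\<Union>u\<in>free_nbrs H W v. C u) = {}"
    by (auto simp: avoiding_matchings_def C_def)
  have disj2: "C u \<inter> C u' = {}" if "u \<noteq> u'" for u u'
  proof (rule ccontr)
    assume "C u \<inter> C u' \<noteq> {}"
    then obtain M M' where M: "M \<in> ?A (insert u (insert v W))" "M' \<in> ?A (insert u' (insert v W))"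
       "insert {v, u} M = insert {v, u'} M'" by (auto simp: C_def)
    then have "{v, u} \<in> insert {v, u'} M'" by blast
    then have "{v, u} \<in> M'" using that by (auto simp: doubleton_eq_iff)
    then have "{v, u} \<inter> insert u' (insert v W) = {}" using M(2) by (simp only: avoiding_matchings_def mem_Collect_eq)
    then show False by simp
  qed
  have C_sum: "(\<Sum>M\<in>C u. l ^ card M) = l * partition_function l H (insert u (insert v W))" for u
  proof -
    have "inj_on (insert {v, u}) (?A (insert u (insert v W)))"
      by (intro inj_onI) (metis insert_ident v_notin)
    then have "(\<Sum>M\<in>C u. l ^ card M) = (\<Sum>M\<in>?A (insert u (insert v W)). l ^ card (insert {v, u} M))"
      unfolding C_def by (subst sum.reindex) auto
    also have "\<dots> = (\<Sum>M\<in>?A (insert u (insert v W)). l * l ^ card M)"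
      using v_notin finite_avoiding_matching[OF finH] by (intro sum.cong) auto
    finally show ?thesis by (simp add: partition_function_def sum_distrib_left)
  qed
  have "partition_function l H W = partition_function l H (insert v W) + (\<Sum>u\<in>free_nbrs H W v. \<Sum>M\<in>C u. l ^ card M)"
    unfolding partition_function_def split
    using fin disj1 disj2 by (subst sum.union_disjoint) (auto simp: sum.UNION_disjoint)
  then show ?thesis by (simp add: C_sum sum_distrib_left)
qed

lemma uncovered_prob_bounds:
  assumes "two_uniform H" "l > 0" "v \<notin> W"
  shows "0 < uncovered_prob l H W v" "uncovered_prob l H W v \<le> 1"
proof -
  have f: "finite H" using assms by (simp add: two_uniform_def)
  have "partition_function l H (insert v W) \<le> partition_function l H W"
    unfolding partition_function_rec[OF assms(1,3)]
    using assms(2) less_imp_le[OF partition_function_pos[OF f assms(2)]] by (auto intro!: mult_nonneg_nonneg sum_nonneg)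
  then show "0 < uncovered_prob l H W v" "uncovered_prob l H W v \<le> 1"
    using partition_function_pos[OF f assms(2)] by (auto simp: uncovered_prob_def)
qed

text \<open>Obtained from \<open>partition_function_rec\<close> on dividing by
  \<open>partition_function l H (insert v W)\<close>.\<close>

lemma uncovered_prob_rec:
  assumes "two_uniform H" "l > 0" "v \<notin> W"
  shows "uncovered_prob l H W v = 1 / (1 + l * (\<Sum>u\<in>free_nbrs H W v. uncovered_prob l H (insert v W) u))"
proof -
  have f: "finite H" using assms by (simp add: two_uniform_def)
  note pos = partition_function_pos[OF f assms(2)]
  have "partition_function l H W = partition_function l H (insert v W) * (1 + l * (\<Sum>u\<in>free_nbrs H W v. uncovered_prob l H (insert v W) u))"
    unfolding partition_function_rec[OF assms(1,3)] uncovered_prob_def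
    using pos[of "insert v W"] by (simp add: sum_divide_distrib[symmetric] field_simps)
  then show ?thesis using pos[of W] pos[of "insert v W"] unfolding uncovered_prob_def
    by (metis divide_divide_eq_left divide_self_if less_irrefl)
qed

lemma uncovered_approx_bounds:
  assumes "l > 0"
  shows "0 < uncovered_approx l H k W v \<and> uncovered_approx l H k W v \<le> 1"
proof (induction k arbitrary: W v)
  case (Suc k)
  have "0 \<le> l * (\<Sum>u\<in>free_nbrs H W v. uncovered_approx l H k (insert v W) u)"
    using assms Suc by (intro mult_nonneg_nonneg sum_nonneg) (auto simp: less_imp_le)
  then show ?case by simp
qed simp

text \<open>One step of the recursion is decreasing in its inputs, so every level exchanges upper
  and lower bounds, starting from the trivial upper bound 1.\<close>

lemma uncovered_approx_sandwich:
  assumes "two_uniform H" "l > 0" "v \<notin> W"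
  shows "(even k \<longrightarrow> uncovered_prob l H W v \<le> uncovered_approx l H k W v) \<and>
         (odd k \<longrightarrow> uncovered_approx l H k W v \<le> uncovered_prob l H W v)"
  using assms(3)
proof (induction k arbitrary: W v)
  case 0
  then show ?case using uncovered_prob_bounds[OF assms(1,2)] by simp
next
  case (Suc k)
  let ?N = "free_nbrs H W v"
  have notin: "u \<notin> insert v W" if "u \<in> ?N" for u
    using that two_uniform_not_loop[OF assms(1)] by (auto simp: free_nbrs_def)
  have pos: "0 \<le> l * (\<Sum>u\<in>?N. uncovered_approx l H k (insert v W) u)"
    using assms(2) uncovered_approx_bounds[OF assms(2), THEN conjunct1, THEN less_imp_le] by (intro mult_nonneg_nonneg sum_nonneg) auto
  have pos': "0 \<le> l * (\<Sum>u\<in>?N. uncovered_prob l H (insert v W) u)"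
    using assms(2) uncovered_prob_bounds[OF assms(1,2)] notin by (intro mult_nonneg_nonneg sum_nonneg) (auto simp: less_imp_le)
  show ?case
  proof (cases "even k")
    case True
    then have "l * (\<Sum>u\<in>?N. uncovered_prob l H (insert v W) u) \<le> l * (\<Sum>u\<in>?N. uncovered_approx l H k (insert v W) u)"
      using Suc.IH notin assms(2) by (intro mult_left_mono sum_mono) auto
    then show ?thesis using True pos pos' by (auto simp: uncovered_prob_rec[OF assms(1,2) Suc.prems] intro!: divide_left_mono mult_pos_pos)
  next
    case False
    then have "l * (\<Sum>u\<in>?N. uncovered_approx l H k (insert v W) u) \<le> l * (\<Sum>u\<in>?N. uncovered_prob l H (insert v W) u)"
      using Suc.IH notin assms(2) by (intro mult_left_mono sum_mono) auto
    then show ?thesis using False pos pos' by (auto simp: uncovered_prob_rec[OF assms(1,2) Suc.prems] intro!: divide_left_mono mult_pos_pos)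
  qed
qed

section \<open>From the monomer-dimer measure to the matching number\<close>

lemma matching_number_attained:
  assumes "finite H"
  obtains M where "matching H M" "card M = matching_number H"
proof -
  have "finite {M. matching H M}" by (rule finite_subset[of _ "Pow H"]) (use assms in \<open>auto simp: matching_def\<close>)
  moreover have "{} \<in> {M. matching H M}" by (auto simp: matching_def)
  ultimately have "matching_number H \<in> card ` {M. matching H M}"
    unfolding matching_number_def by (intro Max_in) auto
  then show ?thesis using that by auto
qed

lemma card_le_matching_number:
  assumes "finite H" "matching H M"
  shows "card M \<le> matching_number H"
proof -
  have "finite {M. matching H M}" by (rule finite_subset[of _ "Pow H"]) (use assms in \<open>auto simp: matching_def\<close>)
  then show ?thesis unfolding matching_number_def using assms by (intro Max_ge) auto
qed

lemma card_Union_matching: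
  assumes "two_uniform H" "matching H M"
  shows "card (\<Union>M) = 2 * card M"
proof -
  have "M \<subseteq> H" "finite M" using assms by (auto simp: matching_def two_uniform_def intro: finite_subset)
  then have "card (\<Union>M) = sum card M"
    using assms by (intro card_Union_disjoint)
      (auto simp: matching_def two_uniform_def pairwise_def disjnt_def subset_iff intro!: card_ge_0_finite)
  also have "\<dots> = (\<Sum>e\<in>M. 2)" using assms \<open>M \<subseteq> H\<close> by (intro sum.cong) (auto simp: two_uniform_def)
  finally show ?thesis by simp
qed

text \<open>Double counting: the mean number of uncovered vertices is summed over matchings instead
  of vertices, and each matching misses \<open>card V - 2 * card M\<close> of them.\<close>

lemma sum_uncovered_prob:
  assumes H: "two_uniform H" and l: "l > 0" and V: "finite V" "\<Union>H \<subseteq> V"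
  shows "(\<Sum>v\<in>V. uncovered_prob l H {} v) =
    (\<Sum>M | matching H M. l ^ card M * (real (card V) - 2 * real (card M))) / (\<Sum>M | matching H M. l ^ card M)"
proof -
  have finH: "finite H" using H by (simp add: two_uniform_def)
  have fin: "finite {M. matching H M}" by (rule finite_subset[of _ "Pow H"]) (use finH in \<open>auto simp: matching_def\<close>)
  have Z: "partition_function l H {} = (\<Sum>M | matching H M. l ^ card M)"
    by (simp add: partition_function_def avoiding_matchings_def)
  have *: "partition_function l H {v} = (\<Sum>M | matching H M. l ^ card M * of_bool (v \<notin> \<Union>M))" for v
    unfolding partition_function_def by (rule sum.mono_neutral_cong_left[OF fin]) (auto simp: avoiding_matchings_def)
  have "(\<Sum>v\<in>V. partition_function l H {v}) = (\<Sum>M | matching H M. \<Sum>v\<in>V. l ^ card M * of_bool (v \<notin> \<Union>M))"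
    unfolding * by (rule sum.swap)
  also have "\<dots> = (\<Sum>M | matching H M. l ^ card M * (real (card V) - 2 * real (card M)))"
  proof (rule sum.cong)
    fix M assume M: "M \<in> {M. matching H M}"
    have sub: "\<Union>M \<subseteq> V" using M V by (auto simp: matching_def)
    have "(\<Sum>v\<in>V. of_bool (v \<notin> \<Union>M) :: real) = (\<Sum>v\<in>V - \<Union>M. 1)"
      by (rule sum.mono_neutral_cong_right) (use V in auto)
    then have "(\<Sum>v\<in>V. of_bool (v \<notin> \<Union>M) :: real) = real (card (V - \<Union>M))" by simp
    also have "\<dots> = real (card V) - 2 * real (card M)"
      using card_Diff_subset[of "\<Union>M" V] card_mono[of V "\<Union>M"] card_Union_matching[OF H, of M] M sub V
      by (simp add: finite_subset of_nat_diff)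
    finally show "(\<Sum>v\<in>V. l ^ card M * of_bool (v \<notin> \<Union>M)) = l ^ card M * (real (card V) - 2 * real (card M))"
      by (simp add: sum_distrib_left[symmetric])
  qed simp
  finally show ?thesis by (simp add: uncovered_prob_def sum_divide_distrib[symmetric] Z)
qed

text \<open>The error term is the entropy of the monomer-dimer measure, at most the logarithm of the number of matchings.\<close>

lemma matching_number_uncovered:
  assumes H: "two_uniform H" and l: "l > 1" and V: "finite V" "\<Union>H \<subseteq> V"
  shows "real (card V) - 2 * real (matching_number H) \<le> (\<Sum>v\<in>V. uncovered_prob l H {} v)"
    and "(\<Sum>v\<in>V. uncovered_prob l H {} v) \<le> real (card V) - 2 * real (matching_number H) + 2 * real (card H) * ln 2 / ln l"
proof -
  have finH: "finite H" using H by (simp add: two_uniform_def)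
  define \<M> where "\<M> = {M. matching H M}"
  have fin: "finite \<M>" unfolding \<M>_def by (rule finite_subset[of _ "Pow H"]) (use finH in \<open>auto simp: matching_def\<close>)
  have ne: "{} \<in> \<M>" by (auto simp: \<M>_def matching_def)
  define \<nu> where "\<nu> = matching_number H"
  define w where "w M = l ^ card M" for M :: "'a set set"
  define Z where "Z = sum w \<M>"
  have wpos: "w M > 0" for M using l by (simp add: w_def)
  have Zpos: "Z > 0" unfolding Z_def using fin ne wpos by (intro sum_pos) auto
  have eq: "(\<Sum>v\<in>V. uncovered_prob l H {} v) = real (card V) - 2 * ((\<Sum>M\<in>\<M>. w M * real (card M)) / Z)"
  proof -
    have "(\<Sum>M\<in>\<M>. w M * (real (card V) - 2 * real (card M))) = real (card V) * Z - 2 * (\<Sum>M\<in>\<M>. w M * real (card M))"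
      by (simp add: Z_def sum_distrib_left sum_distrib_right right_diff_distrib sum_subtractf mult.commute mult.left_commute)
    moreover have "(\<Sum>v\<in>V. uncovered_prob l H {} v) = (\<Sum>M\<in>\<M>. w M * (real (card V) - 2 * real (card M))) / Z"
      using sum_uncovered_prob[OF H _ V, of l] l by (simp add: \<M>_def w_def Z_def)
    ultimately show ?thesis using Zpos by (simp add: diff_divide_distrib)
  qed
  have le: "real (card M) \<le> real \<nu>" if "M \<in> \<M>" for M
    using that card_le_matching_number[OF finH] by (auto simp: \<M>_def \<nu>_def)
  have "(\<Sum>M\<in>\<M>. w M * real (card M)) \<le> (\<Sum>M\<in>\<M>. w M * real \<nu>)"
    using wpos le by (intro sum_mono mult_left_mono) (auto intro: less_imp_le)
  then have "(\<Sum>M\<in>\<M>. w M * real (card M)) / Z \<le> real \<nu>"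
    using Zpos by (simp add: Z_def sum_distrib_left divide_le_eq mult.commute)
  then show "real (card V) - 2 * real (matching_number H) \<le> (\<Sum>v\<in>V. uncovered_prob l H {} v)"
    unfolding eq \<nu>_def by simp
  define K where "K = real (card \<M>)"
  have Kpos: "K > 0" unfolding K_def using ne fin by (auto simp: card_gt_0_iff)
  \<comment> \<open>This crude count of matchings is the source of the error term with
    \<open>card H * ln 2\<close>.\<close>
  have "card \<M> \<le> card (Pow H)" using finH by (intro card_mono) (auto simp: \<M>_def matching_def)
  then have K_le: "K \<le> 2 ^ card H" unfolding K_def using finH by (simp add: card_Pow)
  then have lnK: "ln K \<le> real (card H) * ln 2" using Kpos by (metis ln_mono ln_realpow zero_less_numeral)
  obtain M0 where M0: "M0 \<in> \<M>" "card M0 = \<nu>" using matching_number_attained[OF finH] by (auto simp: \<M>_def \<nu>_def)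
  \<comment> \<open>A single maximum matching already contributes \<open>l ^ \<nu>\<close> to
    \<open>Z\<close>.\<close>
  have "w M0 \<le> Z" unfolding Z_def using wpos M0 fin by (intro member_le_sum) (auto intro: less_imp_le)
  then have lnZ: "real \<nu> * ln l \<le> ln Z"
    using M0 wpos[of M0] l by (metis ln_mono ln_realpow w_def less_trans zero_less_one)
  \<comment> \<open>Gibbs' inequality: the entropy of the probabilities \<open>w M / Z\<close> is at
    most the logarithm \<open>ln K\<close> of the number of matchings. It follows from
    \<open>ln x \<le> x - 1\<close> at \<open>x = Z / (w M * K)\<close>.\<close>
  have "(\<Sum>M\<in>\<M>. w M / Z * (ln (Z / w M) - ln K)) \<le> (\<Sum>M\<in>\<M>. 1 / K - w M / Z)"
  proof (rule sum_mono)
    fix M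
    have "ln (Z / w M) - ln K = ln (Z / (w M * K))"
      using Zpos Kpos wpos[of M] by (simp add: ln_div ln_mult)
    also have "\<dots> \<le> Z / (w M * K) - 1"
      using Zpos Kpos wpos[of M] by (intro ln_le_minus_one) simp
    finally have "w M / Z * (ln (Z / w M) - ln K) \<le> w M / Z * (Z / (w M * K) - 1)"
      using Zpos wpos[of M] by (intro mult_left_mono) (auto intro: less_imp_le)
    also have "\<dots> = 1 / K - w M / Z" using Zpos Kpos wpos[of M] by (simp add: field_simps)
    finally show "w M / Z * (ln (Z / w M) - ln K) \<le> 1 / K - w M / Z" .
  qed
  also have "\<dots> = 0" using Zpos Kpos by (simp add: sum_subtractf sum_divide_distrib[symmetric] Z_def K_def)
  finally have "(\<Sum>M\<in>\<M>. w M / Z * (ln (Z / w M) - ln K)) \<le> 0" .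
  \<comment> \<open>Since \<open>ln (w M) = card M * ln l\<close>, the entropy bound becomes a lower
    bound for the mean size of a matching.\<close>
  moreover have "w M / Z * (ln (Z / w M) - ln K) = w M / Z * (ln Z - ln K) - w M * real (card M) * (ln l / Z)" for M
    using Zpos wpos[of M] l by (simp add: ln_div w_def ln_realpow algebra_simps diff_divide_distrib)
  ultimately have "(\<Sum>M\<in>\<M>. w M / Z * (ln Z - ln K)) - (\<Sum>M\<in>\<M>. w M * real (card M) * (ln l / Z)) \<le> 0"
    by (simp add: sum_subtractf)
  moreover have "(\<Sum>M\<in>\<M>. w M / Z * (ln Z - ln K)) = ln Z - ln K"
    using Zpos by (simp add: sum_distrib_right[symmetric] sum_divide_distrib[symmetric] Z_def)
  ultimately have "ln Z - ln K \<le> (\<Sum>M\<in>\<M>. w M * real (card M)) / Z * ln l"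
    by (simp add: sum_distrib_right sum_divide_distrib)
  then have "real \<nu> * ln l - real (card H) * ln 2 \<le> (\<Sum>M\<in>\<M>. w M * real (card M)) / Z * ln l"
    using lnK lnZ by linarith
  then have "real \<nu> - real (card H) * ln 2 / ln l \<le> (\<Sum>M\<in>\<M>. w M * real (card M)) / Z"
    using l by (simp add: field_simps)
  then have "2 * real \<nu> - 2 * (real (card H) * ln 2 / ln l) \<le> 2 * ((\<Sum>M\<in>\<M>. w M * real (card M)) / Z)" by linarith
  moreover have "2 * (real (card H) * ln 2 / ln l) = 2 * real (card H) * ln 2 / ln l" by simp
  ultimately show "(\<Sum>v\<in>V. uncovered_prob l H {} v) \<le> real (card V) - 2 * real (matching_number H) + 2 * real (card H) * ln 2 / ln l"
    unfolding eq \<nu>_def by linarith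
qed

section \<open>Independent edges\<close>

abbreviation edge_pmf :: "'e set \<Rightarrow> real \<Rightarrow> ('e \<Rightarrow> bool) pmf" where
  "edge_pmf E p \<equiv> Pi_pmf E False (\<lambda>_. bernoulli_pmf p)"

lemma finite_set_edge_pmf: "finite E \<Longrightarrow> finite (set_pmf (edge_pmf E p))"
  by (rule finite_subset[OF set_Pi_pmf_subset' finite_PiE_dflt]) auto

lemma integrable_edge_pmf [simp]:
  fixes f :: "('e \<Rightarrow> bool) \<Rightarrow> real"
  shows "finite E \<Longrightarrow> integrable (measure_pmf (edge_pmf E p)) f"
  by (intro integrable_measure_pmf_finite finite_set_edge_pmf)

lemma expectation_edge_pmf_insert:
  fixes f :: "('e \<Rightarrow> bool) \<Rightarrow> real"
  assumes "finite A" "e \<notin> A" "0 \<le> p" "p \<le> 1"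
  shows "measure_pmf.expectation (edge_pmf (insert e A) p) f =
    p * measure_pmf.expectation (edge_pmf A p) (\<lambda>g. f (g(e := True))) +
    (1 - p) * measure_pmf.expectation (edge_pmf A p) (\<lambda>g. f (g(e := False)))"
proof -
  have "edge_pmf (insert e A) p = bernoulli_pmf p \<bind> (\<lambda>b. map_pmf (\<lambda>g. g(e := b)) (edge_pmf A p))"
    using assms by (simp add: Pi_pmf_insert' map_pmf_def)
  then have "measure_pmf.expectation (edge_pmf (insert e A) p) f =
     (\<Sum>b\<in>UNIV. pmf (bernoulli_pmf p) b *\<^sub>R measure_pmf.expectation (map_pmf (\<lambda>g. g(e := b)) (edge_pmf A p)) f)"
    using finite_set_edge_pmf[OF assms(1)] by (simp only:) (subst pmf_expectation_bind[of UNIV], auto)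
  then show ?thesis using assms by (simp add: UNIV_bool)
qed

text \<open>After \<open>e\<close> is overwritten the integrands ignore that coordinate, so they may
  be averaged under the full law again. In this form edges can be conditioned on one after another
  without changing the measure.\<close>

lemma expectation_edge_pmf_resample:
  fixes f :: "('e \<Rightarrow> bool) \<Rightarrow> real"
  assumes "finite E" "e \<in> E" "0 \<le> p" "p \<le> 1"
  shows "measure_pmf.expectation (edge_pmf E p) f =
    p * measure_pmf.expectation (edge_pmf E p) (\<lambda>g. f (g(e := True))) +
    (1 - p) * measure_pmf.expectation (edge_pmf E p) (\<lambda>g. f (g(e := False)))"
proof -
  have E: "E = insert e (E - {e})" using assms by auto
  note ins = expectation_edge_pmf_insert[of "E - {e}" e p, folded E]
  have *: "measure_pmf.expectation (edge_pmf E p) (\<lambda>g. f (g(e := b))) =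
     measure_pmf.expectation (edge_pmf (E - {e}) p) (\<lambda>g. f (g(e := b)))" for b
    using assms by (subst ins) (auto simp: algebra_simps)
  show ?thesis unfolding * using assms by (intro ins) auto
qed

lemma expectation_edge_indicator:
  fixes X :: "('e \<Rightarrow> bool) \<Rightarrow> real"
  assumes "finite E" "e \<in> E" "0 \<le> p" "p \<le> 1" "\<And>g b. X (g(e := b)) = X g"
  shows "measure_pmf.expectation (edge_pmf E p) (\<lambda>g. of_bool (g e) * X g) = p * measure_pmf.expectation (edge_pmf E p) X"
  using assms by (subst expectation_edge_pmf_resample[of E e]) auto

text \<open>Law of total variance, one edge at a time: a new edge shifts the conditional mean by at
  most 1 and adds at most \<open>p * (1 - p)\<close>. The factor \<open>p\<close> per edge matters,
  because with \<open>p = c / d\<close> and at most \<open>n * d\<close> edges the total is linear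
  in the number \<open>n\<close> of vertices.\<close>

lemma variance_edge_pmf_le:
  fixes f :: "('e \<Rightarrow> bool) \<Rightarrow> real"
  assumes "finite A" "0 \<le> p" "p \<le> 1"
    and "\<And>g e. e \<in> A \<Longrightarrow> \<bar>f (g(e := True)) - f (g(e := False))\<bar> \<le> 1"
  shows "measure_pmf.expectation (edge_pmf A p) (\<lambda>g. (f g)\<^sup>2) - (measure_pmf.expectation (edge_pmf A p) f)\<^sup>2 \<le> real (card A) * p"
  using assms(1,4)
proof (induction A arbitrary: f rule: finite_induct)
  case empty
  then show ?case by simp
next
  case (insert e A)
  let ?E = "measure_pmf.expectation (edge_pmf A p)"
  define f1 where "f1 = (\<lambda>g. f (g(e := True)))"
  define f0 where "f0 = (\<lambda>g. f (g(e := False)))"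
  have up: "(g(e' := b))(e := b') = (g(e := b'))(e' := b)" if "e' \<in> A" for g :: "'e \<Rightarrow> bool" and e' b b'
    using that insert.hyps by (intro fun_upd_twist) auto
  have "?E (\<lambda>g. (f1 g)\<^sup>2) - (?E f1)\<^sup>2 \<le> real (card A) * p"
  proof (rule insert.IH)
    fix g e' assume "e' \<in> A"
    then show "\<bar>f1 (g(e' := True)) - f1 (g(e' := False))\<bar> \<le> 1"
      using insert.prems[of e' "g(e := True)"] unfolding f1_def by (simp only: up insertI2)
  qed
  moreover have "?E (\<lambda>g. (f0 g)\<^sup>2) - (?E f0)\<^sup>2 \<le> real (card A) * p"
  proof (rule insert.IH)
    fix g e' assume "e' \<in> A"
    then show "\<bar>f0 (g(e' := True)) - f0 (g(e' := False))\<bar> \<le> 1"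
      using insert.prems[of e' "g(e := False)"] unfolding f0_def by (simp only: up insertI2)
  qed
  ultimately have *: "p * ?E (\<lambda>g. (f1 g)\<^sup>2) + (1 - p) * ?E (\<lambda>g. (f0 g)\<^sup>2)
     \<le> p * ((?E f1)\<^sup>2 + real (card A) * p) + (1 - p) * ((?E f0)\<^sup>2 + real (card A) * p)"
    using assms by (intro add_mono mult_left_mono) auto
  have le1: "\<bar>f1 g - f0 g\<bar> \<le> 1" for g
    using insert.prems[of e g] unfolding f1_def f0_def by blast
  have "\<bar>?E f1 - ?E f0\<bar> = \<bar>?E (\<lambda>g. f1 g - f0 g)\<bar>" using insert.hyps by simp
  also have "\<dots> \<le> ?E (\<lambda>g. \<bar>f1 g - f0 g\<bar>)" by (rule integral_abs_bound)
  also have "\<dots> \<le> ?E (\<lambda>g. 1)"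
    by (intro integral_mono) (simp_all add: le1 insert.hyps)
  finally have "\<bar>?E f1 - ?E f0\<bar> \<le> 1" by simp
  then have "(?E f1 - ?E f0)\<^sup>2 \<le> 1" by (simp add: abs_square_le_1)
  then have "p * (1 - p) * (?E f1 - ?E f0)\<^sup>2 \<le> p * 1 * 1"
    using assms by (intro mult_mono) auto
  \<comment> \<open>The variance between the two states of the new edge.\<close>
  moreover have "p * (?E f1)\<^sup>2 + (1 - p) * (?E f0)\<^sup>2 - (p * ?E f1 + (1 - p) * ?E f0)\<^sup>2 = p * (1 - p) * (?E f1 - ?E f0)\<^sup>2"
    by algebra
  ultimately have "p * ?E (\<lambda>g. (f1 g)\<^sup>2) + (1 - p) * ?E (\<lambda>g. (f0 g)\<^sup>2) - (p * ?E f1 + (1 - p) * ?E f0)\<^sup>2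
    \<le> real (card A) * p + p" using * by (simp add: algebra_simps)
  then show ?case
    using insert.hyps assms by (simp add: expectation_edge_pmf_insert f1_def f0_def algebra_simps)
qed

section \<open>Concentration of the matching number\<close>

lemma matching_mono: "matching H M \<Longrightarrow> H \<subseteq> H' \<Longrightarrow> matching H' M"
  by (auto simp: matching_def)

lemma matching_number_insert:
  assumes "finite H"
  shows "matching_number H \<le> matching_number (insert e H)"
    and "matching_number (insert e H) \<le> matching_number H + 1"
proof -
  obtain M where M: "matching H M" "card M = matching_number H" using matching_number_attained[OF assms] .
  then show "matching_number H \<le> matching_number (insert e H)"
    using card_le_matching_number[of "insert e H" M] matching_mono[of H M "insert e H"] assms by auto
  obtain M' where M': "matching (insert e H) M'" "card M' = matching_number (insert e H)"
    using matching_number_attained[of "insert e H"] assms by auto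
  have "matching H (M' - {e})" using M'(1) by (auto simp: matching_def)
  then have "card (M' - {e}) \<le> matching_number H" by (rule card_le_matching_number[OF assms])
  moreover have "card M' \<le> card (M' - {e}) + 1" by (simp add: card_Diff_singleton_if) linarith
  ultimately show "matching_number (insert e H) \<le> matching_number H + 1" using M' by simp
qed

lemma matching_number_concentration:
  fixes E :: "'a set set"
  assumes "finite E" "0 \<le> p" "p \<le> 1" "a > 0"
  defines "\<nu> \<equiv> \<lambda>f. real (matching_number {e \<in> E. f e})"
  shows "measure_pmf.prob (edge_pmf E p) {f. a \<le> \<bar>\<nu> f - measure_pmf.expectation (edge_pmf E p) \<nu>\<bar>} \<le> real (card E) * p / a\<^sup>2"
proof -
  have lip: "\<bar>\<nu> (g(e := True)) - \<nu> (g(e := False))\<bar> \<le> 1" if "e \<in> E" for g e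
  proof -
    have "{x \<in> E. (g(e := True)) x} = insert e {x \<in> E. (g(e := False)) x}" using that by auto
    then show ?thesis
      using matching_number_insert[of "{x \<in> E. (g(e := False)) x}" e] assms(1) unfolding \<nu>_def by (simp only:) auto
  qed
  have "measure_pmf.prob (edge_pmf E p) {f \<in> space (measure_pmf (edge_pmf E p)). a \<le> \<bar>\<nu> f - measure_pmf.expectation (edge_pmf E p) \<nu>\<bar>}
     \<le> measure_pmf.variance (edge_pmf E p) \<nu> / a\<^sup>2"
    using assms by (intro measure_pmf.Chebyshev_inequality) auto
  also have "measure_pmf.variance (edge_pmf E p) \<nu> = measure_pmf.expectation (edge_pmf E p) (\<lambda>g. (\<nu> g)\<^sup>2) - (measure_pmf.expectation (edge_pmf E p) \<nu>)\<^sup>2"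
    using assms by (intro measure_pmf.variance_eq) auto
  also have "\<dots> / a\<^sup>2 \<le> real (card E) * p / a\<^sup>2"
    using assms lip by (intro divide_right_mono variance_edge_pmf_le) auto
  finally show ?thesis by simp
qed

text \<open>The weights \<open>a g e\<close> may depend on each other, but not on the edges in
  \<open>A\<close>. Each indicator in \<open>A\<close> can therefore be averaged separately, which
  turns its factor into \<open>1 - p * (1 - exp (- a g e))\<close>.\<close>

lemma laplace_edge_pmf:
  fixes a :: "('e \<Rightarrow> bool) \<Rightarrow> 'e \<Rightarrow> real"
  assumes "finite E" "A \<subseteq> E" "0 \<le> p" "p \<le> 1"
    and a: "\<And>g e e' b. e \<in> A \<Longrightarrow> e' \<in> A \<Longrightarrow> a (g(e := b)) e' = a g e'"
  shows "measure_pmf.expectation (edge_pmf E p) (\<lambda>g. \<Prod>e\<in>A. exp (- (of_bool (g e) * a g e))) =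
    measure_pmf.expectation (edge_pmf E p) (\<lambda>g. \<Prod>e\<in>A. 1 - p * (1 - exp (- a g e)))"
proof -
  let ?E = "measure_pmf.expectation (edge_pmf E p)"
  let ?\<phi> = "\<lambda>g e. exp (- (of_bool (g e) * a g e)) :: real" and ?\<psi> = "\<lambda>g e. 1 - p * (1 - exp (- a g e))"
  have finA: "finite A" using assms finite_subset by blast
  \<comment> \<open>\<open>B\<close> is the set of edges already averaged; \<open>A\<close> stays
    fixed, so the independence hypothesis is available at every stage.\<close>
  have "?E (\<lambda>g. \<Prod>e\<in>A. ?\<phi> g e) = ?E (\<lambda>g. (\<Prod>e\<in>B. ?\<psi> g e) * (\<Prod>e\<in>A - B. ?\<phi> g e))" if "finite B" "B \<subseteq> A" for B
    using that
  proof (induction B rule: finite_induct)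
    case empty
    then show ?case by simp
  next
    case (insert e B)
    define R where "R = (\<lambda>g. (\<Prod>e\<in>B. ?\<psi> g e) * (\<Prod>e\<in>A - insert e B. ?\<phi> g e))"
    have R: "R (g(e := b)) = R g" for g b
      unfolding R_def using insert.prems a by (intro arg_cong2[of _ _ _ _ "(*)"] prod.cong) auto
    have e: "e \<in> A" "A - B = insert e (A - insert e B)" "e \<in> E" using insert assms by auto
    have "?E (\<lambda>g. \<Prod>e\<in>A. ?\<phi> g e) = ?E (\<lambda>g. (\<Prod>e\<in>B. ?\<psi> g e) * (\<Prod>e\<in>A - B. ?\<phi> g e))" using insert by simp
    also have "\<dots> = ?E (\<lambda>g. ?\<phi> g e * R g)"
      unfolding e(2) using finA by (simp add: R_def mult_ac)
    also have "\<dots> = p * ?E (\<lambda>g. exp (- a g e) * R g) + (1 - p) * ?E R"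
      using assms e by (subst expectation_edge_pmf_resample[of E e]) (auto simp: R)
    also have "\<dots> = ?E (\<lambda>g. ?\<psi> g e * R g)"
      using assms(1) by (simp add: algebra_simps)
    also have "\<dots> = ?E (\<lambda>g. (\<Prod>e\<in>insert e B. ?\<psi> g e) * (\<Prod>e\<in>A - insert e B. ?\<phi> g e))"
      using insert.hyps by (simp add: R_def mult_ac)
    finally show ?case .
  qed
  from this[OF finA] show ?thesis by simp
qed

section \<open>Poisson lists\<close>

text \<open>A Poisson point process with intensity \<open>c * D\<close> in list form; it serves as
  the offspring of a tree vertex.\<close>

definition iid_list :: "real \<Rightarrow> 'a pmf \<Rightarrow> 'a list pmf" where
  "iid_list c D = poisson_pmf c \<bind> (\<lambda>n. replicate_pmf n D)"

section \<open>Expectations of bounded functions, and Mecke's formula for Poisson lists\<close>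

lemma integrable_pmf_bounded:
  fixes f :: "'a \<Rightarrow> real"
  assumes "\<And>x. x \<in> set_pmf M \<Longrightarrow> \<bar>f x\<bar> \<le> B"
  shows "integrable (measure_pmf M) f"
  by (rule measure_pmf.integrable_const_bound[where B = B]) (use assms in \<open>auto simp: AE_measure_pmf_iff\<close>)

lemma expectation_mono_pmf:
  fixes f g :: "'a \<Rightarrow> real"
  assumes "\<And>x. x \<in> set_pmf M \<Longrightarrow> f x \<le> g x" "integrable (measure_pmf M) f" "integrable (measure_pmf M) g"
  shows "measure_pmf.expectation M f \<le> measure_pmf.expectation M g"
  by (rule integral_mono_AE) (use assms in \<open>auto simp: AE_measure_pmf_iff\<close>)

lemma expectation_bounds_pmf:
  fixes f :: "'a \<Rightarrow> real"
  assumes "\<And>x. x \<in> set_pmf M \<Longrightarrow> a \<le> f x" "\<And>x. x \<in> set_pmf M \<Longrightarrow> f x \<le> b"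
  shows "a \<le> measure_pmf.expectation M f" "measure_pmf.expectation M f \<le> b"
proof -
  have i: "integrable (measure_pmf M) f" by (rule integrable_pmf_bounded[of _ _ "max \<bar>a\<bar> \<bar>b\<bar>"]) (use assms in force)
  show "a \<le> measure_pmf.expectation M f" 
    using expectation_mono_pmf[of M "\<lambda>_. a" f] assms(1) i by simp
  show "measure_pmf.expectation M f \<le> b"
    using expectation_mono_pmf[of M f "\<lambda>_. b"] assms(2) i by simp
qed

lemma ennreal_expectation_pmf:
  fixes f :: "'a \<Rightarrow> real"
  assumes "\<And>x. 0 \<le> f x" "\<And>x. f x \<le> B"
  shows "(\<integral>\<^sup>+x. ennreal (f x) \<partial>measure_pmf M) = ennreal (measure_pmf.expectation M f)"
  using assms by (intro nn_integral_eq_integral integrable_pmf_bounded[of _ _ B]) auto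

lemma nn_integral_swap_pmf:
  fixes G :: "'a \<Rightarrow> 'b \<Rightarrow> ennreal"
  shows "(\<integral>\<^sup>+x. \<integral>\<^sup>+y. G x y \<partial>measure_pmf N \<partial>measure_pmf M) = (\<integral>\<^sup>+y. \<integral>\<^sup>+x. G x y \<partial>measure_pmf M \<partial>measure_pmf N)"
proof -
  have "(\<integral>\<^sup>+x. \<integral>\<^sup>+y. G x y \<partial>measure_pmf N \<partial>measure_pmf M) = (\<integral>\<^sup>+z. G (fst z) (snd z) \<partial>measure_pmf (pair_pmf M N))"
    by (simp add: nn_integral_pair_pmf')
  also have "pair_pmf M N = map_pmf (\<lambda>(x, y). (y, x)) (pair_pmf N M)" by (rule pair_commute_pmf)
  finally show ?thesis by (simp add: nn_integral_pair_pmf' case_prod_beta)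
qed

lemma nn_integral_replicate_Suc:
  "(\<integral>\<^sup>+ys. g ys \<partial>measure_pmf (replicate_pmf (Suc n) D)) = (\<integral>\<^sup>+x. \<integral>\<^sup>+ys. g (x # ys) \<partial>measure_pmf (replicate_pmf n D) \<partial>measure_pmf D)"
  by simp

text \<open>By exchangeability each entry of the list relates to the others as a fresh sample
  relates to a list shorter by one. The other entries are seen only through their sum of
  \<open>f\<close>, recovered by subtraction. The offset \<open>r\<close> absorbs the head in the
  induction.\<close>

lemma mecke_replicate:
  fixes G :: "'a \<Rightarrow> 'b :: ab_group_add \<Rightarrow> ennreal"
  shows "(\<integral>\<^sup>+ys. (\<Sum>y\<leftarrow>ys. G y (r + (\<Sum>y\<leftarrow>ys. f y) - f y)) \<partial>measure_pmf (replicate_pmf (Suc n) D)) =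
    of_nat (Suc n) * (\<integral>\<^sup>+y. \<integral>\<^sup>+ys. G y (r + (\<Sum>y\<leftarrow>ys. f y)) \<partial>measure_pmf (replicate_pmf n D) \<partial>measure_pmf D)"
proof (induction n arbitrary: r)
  case 0
  show ?case by simp
next
  case (Suc n)
  let ?R = "\<lambda>n. measure_pmf (replicate_pmf n D)"
  have "(\<integral>\<^sup>+ys. (\<Sum>y\<leftarrow>ys. G y (r + (\<Sum>y\<leftarrow>ys. f y) - f y)) \<partial>?R (Suc (Suc n))) =
    (\<integral>\<^sup>+x. \<integral>\<^sup>+ys. (G x (r + (\<Sum>y\<leftarrow>ys. f y)) + (\<Sum>y\<leftarrow>ys. G y ((r + f x) + (\<Sum>y\<leftarrow>ys. f y) - f y))) \<partial>?R (Suc n) \<partial>D)"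
    by (subst nn_integral_replicate_Suc) (simp add: algebra_simps del: replicate_pmf.simps)
  also have "\<dots> = (\<integral>\<^sup>+x. (\<integral>\<^sup>+ys. G x (r + (\<Sum>y\<leftarrow>ys. f y)) \<partial>?R (Suc n)) \<partial>D) +
     (\<integral>\<^sup>+x. (\<integral>\<^sup>+ys. (\<Sum>y\<leftarrow>ys. G y ((r + f x) + (\<Sum>y\<leftarrow>ys. f y) - f y)) \<partial>?R (Suc n)) \<partial>D)"
    by (simp add: nn_integral_add del: replicate_pmf.simps)
  also have "(\<integral>\<^sup>+x. (\<integral>\<^sup>+ys. (\<Sum>y\<leftarrow>ys. G y ((r + f x) + (\<Sum>y\<leftarrow>ys. f y) - f y)) \<partial>?R (Suc n)) \<partial>D) =
     of_nat (Suc n) * (\<integral>\<^sup>+x. \<integral>\<^sup>+y. \<integral>\<^sup>+ys. G y (r + f x + (\<Sum>y\<leftarrow>ys. f y)) \<partial>?R n \<partial>D \<partial>D)"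
    unfolding Suc.IH by (simp add: nn_integral_cmult)
  also have "(\<integral>\<^sup>+x. \<integral>\<^sup>+y. \<integral>\<^sup>+ys. G y (r + f x + (\<Sum>y\<leftarrow>ys. f y)) \<partial>?R n \<partial>D \<partial>D) =
     (\<integral>\<^sup>+y. \<integral>\<^sup>+x. \<integral>\<^sup>+ys. G y (r + f x + (\<Sum>y\<leftarrow>ys. f y)) \<partial>?R n \<partial>D \<partial>D)"
    by (rule nn_integral_swap_pmf)
  also have "\<dots> = (\<integral>\<^sup>+y. \<integral>\<^sup>+ys. G y (r + (\<Sum>y\<leftarrow>ys. f y)) \<partial>?R (Suc n) \<partial>D)"
    by (simp add: algebra_simps)
  finally show ?case by (simp add: distrib_right del: replicate_pmf.simps)
qed

text \<open>Size biasing of the Poisson law: \<open>n + 1\<close> times its mass at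
  \<open>n + 1\<close> is \<open>c\<close> times its mass at \<open>n\<close>.\<close>

lemma nn_integral_poisson_Suc:
  fixes h :: "nat \<Rightarrow> ennreal"
  assumes c: "c > 0" and "g 0 = 0" "\<And>n. g (Suc n) = of_nat (Suc n) * h n"
  shows "(\<integral>\<^sup>+n. g n \<partial>measure_pmf (poisson_pmf c)) = ennreal c * (\<integral>\<^sup>+n. h n \<partial>measure_pmf (poisson_pmf c))"
proof -
  have *: "ennreal (pmf (poisson_pmf c) (Suc n)) * of_nat (Suc n) = ennreal c * ennreal (pmf (poisson_pmf c) n)" for n
  proof -
    have "pmf (poisson_pmf c) (Suc n) * real (Suc n) = c * pmf (poisson_pmf c) n"
      using c by (simp add: pmf_poisson divide_simps del: of_nat_Suc)
    then show ?thesis using c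
      by (metis ennreal_mult ennreal_of_nat_eq_real_of_nat less_imp_le of_nat_0_le_iff pmf_nonneg)
  qed
  have "(\<integral>\<^sup>+n. g n \<partial>measure_pmf (poisson_pmf c)) = (\<Sum>n. ennreal (pmf (poisson_pmf c) n) * g n)"
    by (simp add: nn_integral_measure_pmf nn_integral_count_space_nat)
  also have "\<dots> = (\<Sum>n. ennreal (pmf (poisson_pmf c) (Suc n)) * g (Suc n))"
    using suminf_offset[of "\<lambda>n. ennreal (pmf (poisson_pmf c) n) * g n" 1] assms(2) by (simp add: summableI)
  also have "\<dots> = (\<Sum>n. ennreal c * (ennreal (pmf (poisson_pmf c) n) * h n))"
    unfolding assms(3) mult.assoc[symmetric] * ..
  also have "\<dots> = ennreal c * (\<integral>\<^sup>+n. h n \<partial>measure_pmf (poisson_pmf c))"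
    by (simp add: nn_integral_measure_pmf nn_integral_count_space_nat)
  finally show ?thesis .
qed

text \<open>Averaging \<open>mecke_replicate\<close> over a Poisson length restores the full list on
  the right. The values of \<open>f\<close> lie in an arbitrary abelian group, so that several
  statistics of the remaining entries can be tracked at once.\<close>

lemma mecke_nn_integral:
  fixes G :: "'a \<Rightarrow> 'b :: ab_group_add \<Rightarrow> ennreal"
  assumes c: "c > 0"
  shows "(\<integral>\<^sup>+ys. (\<Sum>y\<leftarrow>ys. G y ((\<Sum>y\<leftarrow>ys. f y) - f y)) \<partial>measure_pmf (iid_list c D)) =
    ennreal c * (\<integral>\<^sup>+y. \<integral>\<^sup>+ys. G y (\<Sum>y\<leftarrow>ys. f y) \<partial>measure_pmf (iid_list c D) \<partial>measure_pmf D)"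
proof -
  have "(\<integral>\<^sup>+ys. (\<Sum>y\<leftarrow>ys. G y ((\<Sum>y\<leftarrow>ys. f y) - f y)) \<partial>measure_pmf (iid_list c D)) =
    (\<integral>\<^sup>+n. \<integral>\<^sup>+ys. (\<Sum>y\<leftarrow>ys. G y ((\<Sum>y\<leftarrow>ys. f y) - f y)) \<partial>measure_pmf (replicate_pmf n D) \<partial>measure_pmf (poisson_pmf c))"
    by (simp add: iid_list_def)
  also have "\<dots> = ennreal c * (\<integral>\<^sup>+n. \<integral>\<^sup>+y. \<integral>\<^sup>+ys. G y (\<Sum>y\<leftarrow>ys. f y) \<partial>measure_pmf (replicate_pmf n D) \<partial>measure_pmf D \<partial>measure_pmf (poisson_pmf c))"
    by (rule nn_integral_poisson_Suc[OF c]) (use mecke_replicate[where G = G and r = 0 and f = f and D = D] in \<open>simp_all del: replicate_pmf.simps(2)\<close>)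
  also have "\<dots> = ennreal c * (\<integral>\<^sup>+y. \<integral>\<^sup>+ys. G y (\<Sum>y\<leftarrow>ys. f y) \<partial>measure_pmf (iid_list c D) \<partial>measure_pmf D)"
    by (simp add: iid_list_def nn_integral_swap_pmf[of _ D])
  finally show ?thesis .
qed

text \<open>Integrability is part of the conclusion, since the sum over a list of random length is
  unbounded even for bounded \<open>G\<close>.\<close>

lemma mecke:
  fixes G :: "'a \<Rightarrow> 'b :: ab_group_add \<Rightarrow> real"
  assumes c: "c > 0" and G: "\<And>y s. 0 \<le> G y s" "\<And>y s. G y s \<le> B"
  shows "measure_pmf.expectation (iid_list c D) (\<lambda>ys. \<Sum>y\<leftarrow>ys. G y ((\<Sum>y\<leftarrow>ys. f y) - f y)) =
      c * measure_pmf.expectation D (\<lambda>y. measure_pmf.expectation (iid_list c D) (\<lambda>ys. G y (\<Sum>y\<leftarrow>ys. f y)))"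
    and "integrable (measure_pmf (iid_list c D)) (\<lambda>ys. \<Sum>y\<leftarrow>ys. G y ((\<Sum>y\<leftarrow>ys. f y) - f y))"
proof -
  let ?L = "\<lambda>ys. \<Sum>y\<leftarrow>ys. G y ((\<Sum>y\<leftarrow>ys. f y) - f y)"
  let ?R = "measure_pmf.expectation D (\<lambda>y. measure_pmf.expectation (iid_list c D) (\<lambda>ys. G y (\<Sum>y\<leftarrow>ys. f y)))"
  have L0: "0 \<le> ?L ys" for ys using G(1) by (intro sum_list_nonneg) auto
  have E0: "0 \<le> measure_pmf.expectation (iid_list c D) (\<lambda>ys. G y (\<Sum>y\<leftarrow>ys. f y))"
    "measure_pmf.expectation (iid_list c D) (\<lambda>ys. G y (\<Sum>y\<leftarrow>ys. f y)) \<le> B" for y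
    using expectation_bounds_pmf[of "iid_list c D" 0 "\<lambda>ys. G y (\<Sum>y\<leftarrow>ys. f y)" B] G by auto
  have R0: "0 \<le> ?R" using E0 by simp
  have "(\<Sum>y\<leftarrow>ys. ennreal (G y ((\<Sum>y\<leftarrow>ys. f y) - f y))) = ennreal (?L ys)" for ys
  proof -
    have nonneg: "0 \<le> (\<Sum>y\<leftarrow>zs. G y (s - f y))" for zs s
      by (induction zs) (use G(1) in auto)
    have "(\<Sum>y\<leftarrow>zs. ennreal (G y (s - f y))) = ennreal (\<Sum>y\<leftarrow>zs. G y (s - f y))" for zs s
      by (induction zs) (simp_all add: G(1) nonneg)
    then show ?thesis .
  qed
  then have "(\<integral>\<^sup>+ys. ennreal (?L ys) \<partial>measure_pmf (iid_list c D)) = ennreal c * (\<integral>\<^sup>+y. \<integral>\<^sup>+ys. ennreal (G y (\<Sum>y\<leftarrow>ys. f y)) \<partial>measure_pmf (iid_list c D) \<partial>measure_pmf D)"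
    using mecke_nn_integral[OF c, where G = "\<lambda>y s. ennreal (G y s)" and f = f and D = D] by simp
  also have "\<dots> = ennreal c * ennreal ?R"
    using G E0 by (simp add: ennreal_expectation_pmf[where B = B])
  finally have *: "(\<integral>\<^sup>+ys. ennreal (?L ys) \<partial>measure_pmf (iid_list c D)) = ennreal (c * ?R)"
    using c R0 by (simp add: ennreal_mult)
  show "measure_pmf.expectation (iid_list c D) ?L = c * ?R"
    using * L0 c R0 by (subst integral_eq_nn_integral) auto
  show "integrable (measure_pmf (iid_list c D)) ?L"
    using * L0 by (intro integrableI_bounded) auto
qed

lemma expectation_bind_pmf_bounded:
  fixes f :: "'b \<Rightarrow> real"
  assumes "\<And>x. 0 \<le> f x" "\<And>x. f x \<le> B"
  shows "measure_pmf.expectation (M \<bind> N) f = measure_pmf.expectation M (\<lambda>x. measure_pmf.expectation (N x) f)"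
proof -
  have E: "0 \<le> measure_pmf.expectation (N x) f" "measure_pmf.expectation (N x) f \<le> B" for x
    using expectation_bounds_pmf[of "N x" 0 f B] assms by auto
  have "ennreal (measure_pmf.expectation (M \<bind> N) f) = ennreal (measure_pmf.expectation M (\<lambda>x. measure_pmf.expectation (N x) f))"
    using E assms by (simp flip: ennreal_expectation_pmf[where B = B])
  then show ?thesis using assms E by (subst (asm) ennreal_inj) auto
qed

text \<open>By independence this is the Poisson generating function at the mean of \<open>h\<close>:
  the Laplace functional of the process.\<close>

lemma expectation_prod_iid_list:
  assumes c: "c > 0" and h: "\<And>y. 0 \<le> h y" "\<And>y. h y \<le> 1"
  shows "measure_pmf.expectation (iid_list c D) (\<lambda>ys. prod_list (map h ys)) = exp (- c * (1 - measure_pmf.expectation D h))"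
proof -
  have bd: "0 \<le> prod_list (map h ys) \<and> prod_list (map h ys) \<le> 1" for ys
    by (induction ys) (use h in \<open>auto intro: mult_le_one\<close>)
  have rep: "measure_pmf.expectation (replicate_pmf n D) (\<lambda>ys. prod_list (map h ys)) = measure_pmf.expectation D h ^ n" for n
  proof (induction n)
    case (Suc n)
    have "measure_pmf.expectation (replicate_pmf (Suc n) D) (\<lambda>ys. prod_list (map h ys)) =
      measure_pmf.expectation D (\<lambda>x. measure_pmf.expectation (replicate_pmf n D) (\<lambda>ys. h x * prod_list (map h ys)))"
      using bd by (simp add: expectation_bind_pmf_bounded[where B = 1])
    then show ?case by (simp add: Suc)
  qed simp
  let ?m = "measure_pmf.expectation D h"
  have m: "0 \<le> ?m" "?m \<le> 1" using expectation_bounds_pmf[of D 0 h 1] h by auto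
  have "measure_pmf.expectation (iid_list c D) (\<lambda>ys. prod_list (map h ys)) = measure_pmf.expectation (poisson_pmf c) (\<lambda>n. ?m ^ n)"
    unfolding iid_list_def using bd by (simp add: expectation_bind_pmf_bounded[where B = 1] rep)
  also have "\<dots> = exp (- c) * exp (c * ?m)"
  proof -
    have "(\<lambda>n. exp (- c) * ((c * ?m) ^ n /\<^sub>R fact n)) sums (exp (- c) * exp (c * ?m))"
      by (intro sums_mult exp_converges)
    moreover have "exp (- c) * ((c * ?m) ^ n /\<^sub>R fact n) = pmf (poisson_pmf c) n * ?m ^ n" for n
      using c by (simp add: field_simps power_mult_distrib)
    ultimately have "(\<lambda>n. pmf (poisson_pmf c) n * ?m ^ n) sums (exp (- c) * exp (c * ?m))" by simp
    then have "(\<Sum>n. ennreal (pmf (poisson_pmf c) n * ?m ^ n)) = ennreal (exp (- c) * exp (c * ?m))"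
      using m by (intro suminf_ennreal_eq) auto
    moreover have "(\<integral>\<^sup>+n. ennreal (?m ^ n) \<partial>measure_pmf (poisson_pmf c)) = (\<Sum>n. ennreal (pmf (poisson_pmf c) n * ?m ^ n))"
      using m by (simp add: nn_integral_measure_pmf nn_integral_count_space_nat ennreal_mult del: pmf_poisson)
    ultimately have "ennreal (measure_pmf.expectation (poisson_pmf c) (\<lambda>n. ?m ^ n)) = ennreal (exp (- c) * exp (c * ?m))"
      using m ennreal_expectation_pmf[of "\<lambda>n. ?m ^ n" 1 "poisson_pmf c"] by (simp add: power_le_one)
    then show ?thesis using m by (subst (asm) ennreal_inj) auto
  qed
  also have "\<dots> = exp (- c * (1 - ?m))" by (simp add: exp_add[symmetric] algebra_simps)
  finally show ?thesis .
qed


lemma expectation_pair_pmf_bounded: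
  fixes f :: "'a \<times> 'b \<Rightarrow> real"
  assumes "\<And>x. 0 \<le> f x" "\<And>x. f x \<le> B"
  shows "measure_pmf.expectation (pair_pmf M N) f = measure_pmf.expectation M (\<lambda>x. measure_pmf.expectation N (\<lambda>y. f (x, y)))"
  unfolding pair_pmf_def using assms by (simp add: expectation_bind_pmf_bounded[where B = B])

lemma mecke_pair:
  fixes G :: "'a \<Rightarrow> 'b :: ab_group_add \<Rightarrow> real"
  assumes "c > 0" "\<And>y s. 0 \<le> G y s" "\<And>y s. G y s \<le> B"
  shows "measure_pmf.expectation (iid_list c D) (\<lambda>ys. \<Sum>y\<leftarrow>ys. G y ((\<Sum>y\<leftarrow>ys. f y) - f y)) =
      c * measure_pmf.expectation (pair_pmf D (iid_list c D)) (\<lambda>(y, ys). G y (\<Sum>y\<leftarrow>ys. f y))"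
  using assms mecke(1)[OF assms, where D = D and f = f]
  by (subst expectation_pair_pmf_bounded[where B = B]) (auto simp: case_prod_beta)

section \<open>Poisson counts of marked entries\<close>

lemma expectation_of_bool: "measure_pmf.expectation M (\<lambda>x. of_bool (P x)) = measure_pmf.prob M {x. P x}"
proof -
  have "(\<lambda>x. of_bool (P x) :: real) = indicator {x. P x}" by (auto simp: indicator_def)
  then show ?thesis by simp
qed

lemma prob_not: "measure_pmf.prob M {x. \<not> P x} = 1 - measure_pmf.prob M {x. P x}"
  using measure_pmf.prob_compl[of "{x. P x}" M] by (simp add: Compl_eq_Diff_UNIV[symmetric] Collect_neg_eq)

lemma prob_iid_list_all:
  assumes "c > 0"
  shows "measure_pmf.prob (iid_list c D) {ys. \<forall>y\<in>set ys. Q y} = exp (- c * measure_pmf.prob D {y. \<not> Q y})"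
proof -
  have "prod_list (map (\<lambda>y. of_bool (Q y)) ys) = (of_bool (\<forall>y\<in>set ys. Q y) :: real)" for ys
    by (induction ys) auto
  then show ?thesis
    using expectation_prod_iid_list[OF assms, of "\<lambda>y. of_bool (Q y)" D] by (simp add: expectation_of_bool prob_not)
qed

lemma expectation_sum_iid_list:
  assumes "c > 0" "\<And>y. 0 \<le> f y" "\<And>y. f y \<le> (B::real)"
  shows "measure_pmf.expectation (iid_list c D) (\<lambda>ys. \<Sum>y\<leftarrow>ys. f y) = c * measure_pmf.expectation D f"
    and "integrable (measure_pmf (iid_list c D)) (\<lambda>ys. \<Sum>y\<leftarrow>ys. f y)"
  using mecke[OF assms(1), where G = "\<lambda>y _. f y" and B = B and f = "\<lambda>_. 0::real" and D = D] assms by auto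

lemma prob_length_iid_list:
  assumes "c > 0" "K > 0"
  shows "measure_pmf.prob (iid_list c D) {ys. K \<le> real (length ys)} \<le> c / K"
proof -
  have *: "(\<Sum>y\<leftarrow>ys. 1) = real (length ys)" for ys :: "'a list" by (induction ys) auto
  note e = expectation_sum_iid_list[OF assms(1), where f = "\<lambda>_. 1" and B = 1 and D = D, unfolded *]
  have "measure_pmf.expectation (iid_list c D) (\<lambda>ys. of_bool (K \<le> real (length ys))) \<le>
     measure_pmf.expectation (iid_list c D) (\<lambda>ys. real (length ys) / K)"
  proof (rule expectation_mono_pmf)
    show "integrable (measure_pmf (iid_list c D)) (\<lambda>ys. of_bool (K \<le> real (length ys)) :: real)"
      by (rule integrable_pmf_bounded[of _ _ 1]) auto
  qed (use e(2) assms in auto)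
  then show ?thesis using e(1) by (simp add: expectation_of_bool)
qed

text \<open>Mecke's formula applied to the event that an entry is marked and no other entry is; the
  void probability then supplies the exponential.\<close>

lemma prob_iid_list_one:
  assumes "c > 0"
  shows "measure_pmf.prob (iid_list c D) {ys. (\<Sum>y\<leftarrow>ys. of_bool (Q y)) = (1::real)} =
    c * measure_pmf.prob D {y. Q y} * exp (- c * measure_pmf.prob D {y. Q y})"
proof -
  let ?f = "\<lambda>y. of_bool (Q y) :: real"
  let ?G = "\<lambda>y s. of_bool (Q y \<and> s = 0) :: real"
  \<comment> \<open>Stated for a free total \<open>s\<close> so that the induction on the list goes
    through. At the true total the right side is the indicator of exactly one marked entry.\<close>
  have "(\<Sum>y\<leftarrow>zs. ?G y (s - ?f y)) = of_bool (s = 1) * (\<Sum>y\<leftarrow>zs. ?f y)" for zs :: "'a list" and s :: real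
    by (induction zs) auto
  then have L: "(\<Sum>y\<leftarrow>ys. ?G y ((\<Sum>y\<leftarrow>ys. ?f y) - ?f y)) = of_bool ((\<Sum>y\<leftarrow>ys. ?f y) = 1)" for ys
    by auto
  have nn: "0 \<le> (\<Sum>y\<leftarrow>ys. ?f y)" for ys by (induction ys) auto
  have R: "(\<Sum>y\<leftarrow>ys. ?f y) = 0 \<longleftrightarrow> (\<forall>y\<in>set ys. \<not> Q y)" for ys
  proof (induction ys)
    case (Cons a ys) then show ?case using nn[of ys] by (cases "Q a") auto
  qed simp
  have "measure_pmf.prob (iid_list c D) {ys. (\<Sum>y\<leftarrow>ys. ?f y) = 1} =
    c * measure_pmf.expectation D (\<lambda>y. measure_pmf.expectation (iid_list c D) (\<lambda>ys. ?G y (\<Sum>y\<leftarrow>ys. ?f y)))"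
    using mecke(1)[OF assms, where G = ?G and B = 1 and f = ?f and D = D] unfolding L by (simp add: expectation_of_bool)
  also have "(\<lambda>y. measure_pmf.expectation (iid_list c D) (\<lambda>ys. ?G y (\<Sum>y\<leftarrow>ys. ?f y))) =
     (\<lambda>y. of_bool (Q y) * exp (- c * measure_pmf.prob D {y. Q y}))"
  proof
    fix y show "measure_pmf.expectation (iid_list c D) (\<lambda>ys. ?G y (\<Sum>y\<leftarrow>ys. ?f y)) = of_bool (Q y) * exp (- c * measure_pmf.prob D {y. Q y})"
      using prob_iid_list_all[OF assms, of D "\<lambda>y. \<not> Q y"] by (cases "Q y") (simp_all only: R expectation_of_bool, simp_all)
  qed
  finally show ?thesis by (simp add: expectation_of_bool)
qed

lemma prob_iid_list_two:
  fixes D :: "'a pmf" and Q :: "'a \<Rightarrow> bool"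
  assumes "c > 0"
  defines "q \<equiv> measure_pmf.prob D {y. Q y}"
  shows "measure_pmf.prob (iid_list c D) {ys. (\<Sum>y\<leftarrow>ys. of_bool (Q y)) \<ge> (2::real)} = 1 - exp (- c * q) - c * q * exp (- c * q)"
proof -
  let ?f = "\<lambda>y. of_bool (Q y) :: real" and ?M = "iid_list c D"
  have cnt: "\<exists>n. (\<Sum>y\<leftarrow>ys. ?f y) = real n" for ys
  proof (induction ys)
    case (Cons a ys)
    then obtain n where "(\<Sum>y\<leftarrow>ys. ?f y) = real n" by auto
    then show ?case by (intro exI[of _ "if Q a then Suc n else n"]) simp
  qed (auto intro: exI[of _ 0])
  have nn: "0 \<le> (\<Sum>y\<leftarrow>ys. ?f y)" for ys by (induction ys) auto
  have R: "(\<Sum>y\<leftarrow>ys. ?f y) = 0 \<longleftrightarrow> (\<forall>y\<in>set ys. \<not> Q y)" for ys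
  proof (induction ys)
    case (Cons a ys) then show ?case using nn[of ys] by (cases "Q a") auto
  qed simp
  have "of_bool ((\<Sum>y\<leftarrow>ys. ?f y) \<ge> 2) = 1 - (of_bool (\<forall>y\<in>set ys. \<not> Q y) :: real) - of_bool ((\<Sum>y\<leftarrow>ys. ?f y) = 1)" for ys
  proof -
    obtain n where n: "(\<Sum>y\<leftarrow>ys. ?f y) = real n" using cnt by blast
    consider "n = 0" | "n = 1" | "n \<ge> 2" by linarith
    then show ?thesis unfolding R[symmetric] n by cases auto
  qed
  then have "measure_pmf.expectation ?M (\<lambda>ys. of_bool ((\<Sum>y\<leftarrow>ys. ?f y) \<ge> 2)) =
     measure_pmf.expectation ?M (\<lambda>ys. 1 - (of_bool (\<forall>y\<in>set ys. \<not> Q y) :: real) - of_bool ((\<Sum>y\<leftarrow>ys. ?f y) = 1))"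
    by simp
  also have "\<dots> = 1 - measure_pmf.prob ?M {ys. \<forall>y\<in>set ys. \<not> Q y} - measure_pmf.prob ?M {ys. (\<Sum>y\<leftarrow>ys. ?f y) = 1}"
    by (simp add: integrable_pmf_bounded[of _ _ 1] expectation_of_bool)
  finally show ?thesis
    using prob_iid_list_one[OF assms(1), of D Q] prob_iid_list_all[OF assms(1), of D "\<lambda>y. \<not> Q y"]
    by (simp add: expectation_of_bool q_def)
qed

section \<open>Galton--Watson trees\<close>

datatype rtree = RNode (branches: "rtree list")

definition child_sum :: "(rtree \<Rightarrow> real) \<Rightarrow> rtree \<Rightarrow> real" where
  "child_sum f t = (\<Sum>s\<leftarrow>branches t. f s)"

text \<open>Generated down to depth \<open>k\<close> only, which keeps the law discrete; vertices at
  depth \<open>k\<close> have no branches.\<close>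

primrec gw_tree :: "real \<Rightarrow> nat \<Rightarrow> rtree pmf" where
  "gw_tree c 0 = return_pmf (RNode [])"
| "gw_tree c (Suc k) = map_pmf RNode (iid_list c (gw_tree c k))"

primrec tree_x :: "real \<Rightarrow> nat \<Rightarrow> rtree \<Rightarrow> real" where
  "tree_x l 0 = (\<lambda>t. 1)"
| "tree_x l (Suc k) = (\<lambda>t. 1 / (1 + l * child_sum (tree_x l k) t))"

text \<open>The limit of the odd iterates \<open>tree_x l (2 * k - 1)\<close> as \<open>l\<close> tends to infinity; a vanishing child sum
  stands for an infinite message, which forces the value 0.\<close>

primrec tree_b :: "nat \<Rightarrow> rtree \<Rightarrow> real" where
  "tree_b 0 = (\<lambda>t. 0)"
| "tree_b (Suc k) = (\<lambda>t. if \<exists>s\<in>set (branches t). child_sum (tree_b k) s = 0 then 0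
     else 1 / (1 + child_sum (\<lambda>s. 1 / child_sum (tree_b k) s) t))"

primrec trunc :: "nat \<Rightarrow> rtree \<Rightarrow> rtree" where
  "trunc 0 = (\<lambda>t. RNode [])"
| "trunc (Suc k) = (\<lambda>t. RNode (map (trunc k) (branches t)))"

section \<open>Truncation: local functions do not see the sampled depth\<close>

lemma child_sum_nonneg: "(\<And>s. 0 \<le> f s) \<Longrightarrow> 0 \<le> child_sum f t"
  unfolding child_sum_def by (intro sum_list_nonneg) auto

lemma child_sum_mono: "(\<And>s. s \<in> set (branches t) \<Longrightarrow> f s \<le> g s) \<Longrightarrow> child_sum f t \<le> child_sum g t"
  unfolding child_sum_def by (rule sum_list_mono) auto

lemma child_sum_eq_0_iff:
  assumes "\<And>s. 0 \<le> f s"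
  shows "child_sum f t = 0 \<longleftrightarrow> (\<forall>s\<in>set (branches t). f s = 0)"
  unfolding child_sum_def using assms by (subst sum_list_nonneg_eq_0_iff) auto

lemma child_sum_trunc: "child_sum f (trunc (Suc j) t) = child_sum (\<lambda>s. f (trunc j s)) t"
  by (simp add: child_sum_def o_def)

lemma map_replicate_pmf: "map_pmf (map f) (replicate_pmf n D) = replicate_pmf n (map_pmf f D)"
proof (induction n)
  case (Suc n)
  then show ?case by (simp add: Suc.IH[symmetric] map_bind_pmf bind_map_pmf)
qed simp

lemma map_iid_list: "map_pmf (map f) (iid_list c D) = iid_list c (map_pmf f D)"
  by (simp add: iid_list_def map_bind_pmf map_replicate_pmf)

text \<open>Truncating a tree truncates its branches independently, so it commutes with drawing the
  Poisson list of branches.\<close>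

lemma map_trunc_gw_tree: "j \<le> K \<Longrightarrow> map_pmf (trunc j) (gw_tree c K) = gw_tree c j"
proof (induction j arbitrary: K)
  case 0 then show ?case by simp
next
  case (Suc j)
  then obtain K' where K': "K = Suc K'" "j \<le> K'" by (cases K) auto
  have "map_pmf (trunc (Suc j)) (gw_tree c K) = map_pmf RNode (map_pmf (map (trunc j)) (iid_list c (gw_tree c K')))"
    by (simp add: K' pmf.map_comp o_def)
  then show ?case using Suc.IH[OF K'(2)] by (simp add: map_iid_list)
qed

text \<open>Makes it possible to compare iterates of different depth on one common tree law.\<close>

lemma expectation_gw_tree_trunc:
  fixes f :: "rtree \<Rightarrow> real"
  assumes "\<And>t. f (trunc j t) = f t" "j \<le> K" "j \<le> K'"
  shows "measure_pmf.expectation (gw_tree c K) f = measure_pmf.expectation (gw_tree c K') f"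
proof -
  have "measure_pmf.expectation (gw_tree c K) f = measure_pmf.expectation (gw_tree c j) f" if "j \<le> K" for K
    by (subst map_trunc_gw_tree[OF that, symmetric]) (simp add: assms(1))
  from this[OF assms(2)] this[OF assms(3)] show ?thesis by simp
qed

lemma prob_gw_tree_trunc:
  assumes "\<And>t. P (trunc j t) = P t" "j \<le> K" "j \<le> K'"
  shows "measure_pmf.prob (gw_tree c K) {t. P t} = measure_pmf.prob (gw_tree c K') {t. P t}"
  using expectation_gw_tree_trunc[of "\<lambda>t. of_bool (P t)" j K K' c] assms by (simp add: expectation_of_bool)

lemma tree_x_trunc: "k \<le> j \<Longrightarrow> tree_x l k (trunc j t) = tree_x l k t"
proof (induction k arbitrary: j t)
  case (Suc k)
  then obtain j' where "j = Suc j'" "k \<le> j'" by (cases j) auto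
  then show ?case using Suc.IH by (simp add: child_sum_trunc del: trunc.simps)
qed simp

text \<open>One step of \<open>tree_b\<close> consumes two generations.\<close>

lemma tree_b_trunc: "2 * k \<le> j \<Longrightarrow> tree_b k (trunc j t) = tree_b k t"
proof (induction k arbitrary: j t)
  case (Suc k)
  define i where "i = j - 2"
  have j: "j = Suc (Suc i)" "2 * k \<le> i" using Suc.prems by (auto simp: i_def)
  have "child_sum (tree_b k) (trunc (Suc i) s) = child_sum (tree_b k) s" for s
    using Suc.IH j by (simp add: child_sum_trunc del: trunc.simps)
  moreover have "child_sum f (trunc j t) = child_sum (\<lambda>s. f (trunc (Suc i) s)) t" for f
    by (simp add: j child_sum_trunc del: trunc.simps)
  moreover have "set (branches (trunc j t)) = trunc (Suc i) ` set (branches t)"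
    by (simp add: j)
  ultimately show ?case by (simp del: trunc.simps)
qed simp

section \<open>Monotonicity of the tree iterates and their supports\<close>

lemma tree_x_bounds:
  assumes "l > 0"
  shows "0 < tree_x l k t" "tree_x l k t \<le> 1"
proof -
  have "0 < tree_x l k t \<and> tree_x l k t \<le> 1"
  proof (induction k arbitrary: t)
    case (Suc k)
    have "0 \<le> l * child_sum (tree_x l k) t"
      using assms Suc by (intro mult_nonneg_nonneg child_sum_nonneg) (auto intro: less_imp_le)
    then show ?case by simp
  qed simp
  then show "0 < tree_x l k t" "tree_x l k t \<le> 1" by auto
qed

text \<open>A single step is antitone, so two steps are monotone; the starting value 1 is the
  largest possible one.\<close>

lemma tree_x_alternating:
  assumes "l > 0"
  shows "(even k \<longrightarrow> tree_x l (k + 2) t \<le> tree_x l k t) \<and> (odd k \<longrightarrow> tree_x l k t \<le> tree_x l (k + 2) t)"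
proof (induction k arbitrary: t)
  case 0
  then show ?case using tree_x_bounds(2)[OF assms, of "0 + 2" t] by (simp del: tree_x.simps(2))
next
  case (Suc k)
  have nn: "0 \<le> child_sum (tree_x l k) t" for k
    using tree_x_bounds(1)[OF assms] by (intro child_sum_nonneg) (simp add: less_imp_le)
  show ?case
  proof (cases "even k")
    case True
    then have "l * child_sum (tree_x l (k + 2)) t \<le> l * child_sum (tree_x l k) t"
      using Suc assms by (intro mult_left_mono child_sum_mono) auto
    then show ?thesis using True nn[of k] nn[of "k + 2"] assms
      by (auto intro!: divide_left_mono mult_pos_pos add_pos_nonneg simp del: tree_x.simps simp: tree_x.simps(2)[of l k] tree_x.simps(2)[of l "Suc (Suc k)"])
  next
    case False
    then have "l * child_sum (tree_x l k) t \<le> l * child_sum (tree_x l (k + 2)) t"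
      using Suc assms by (intro mult_left_mono child_sum_mono) auto
    then show ?thesis using False nn[of k] nn[of "k + 2"] assms
      by (auto intro!: divide_left_mono mult_pos_pos add_pos_nonneg simp del: tree_x.simps simp: tree_x.simps(2)[of l k] tree_x.simps(2)[of l "Suc (Suc k)"])
  qed
qed

text \<open>Over two generations \<open>l\<close> survives only as the regularisation
  \<open>1 / l\<close>. Dropping it gives the recursion of \<open>tree_b\<close>.\<close>

lemma tree_x_step2:
  assumes "l > 0"
  shows "tree_x l (Suc (Suc k)) t = 1 / (1 + child_sum (\<lambda>s. 1 / (1 / l + child_sum (tree_x l k) s)) t)"
proof -
  have nn: "0 \<le> child_sum (tree_x l k) s" for s
    using tree_x_bounds(1)[OF assms] by (intro child_sum_nonneg) (simp add: less_imp_le)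
  have "l * (1 / (1 + l * child_sum (tree_x l k) s)) = 1 / (1 / l + child_sum (tree_x l k) s)" for s
    using assms nn[of s] by (simp add: field_simps)
  then have "l * child_sum (\<lambda>s. 1 / (1 + l * child_sum (tree_x l k) s)) t = child_sum (\<lambda>s. 1 / (1 / l + child_sum (tree_x l k) s)) t"
    by (simp only: child_sum_def sum_list_const_mult[symmetric])
  then show ?thesis by simp
qed

lemma tree_b_bounds: "0 \<le> tree_b k t" "tree_b k t \<le> 1"
proof -
  have "0 \<le> tree_b k t \<and> tree_b k t \<le> 1"
  proof (induction k arbitrary: t)
    case (Suc k)
    have "0 \<le> child_sum (\<lambda>s. 1 / child_sum (tree_b k) s) t"
      using Suc by (intro child_sum_nonneg divide_nonneg_nonneg) auto
    then show ?case by simp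
  qed simp
  then show "0 \<le> tree_b k t" "tree_b k t \<le> 1" by auto
qed

lemma child_sum_tree_b_nonneg: "0 \<le> child_sum (tree_b k) t"
  by (intro child_sum_nonneg tree_b_bounds)

text \<open>Larger child sums mean smaller messages and a larger value at the root. If a message is
  infinite the left side is 0 by the case distinction in \<open>tree_b\<close>; the convention
  \<open>1 / 0 = 0\<close> alone would count such a message as absent.\<close>

lemma tree_b_step_mono:
  assumes "\<And>s. 0 \<le> f s" "\<And>s. child_sum (tree_b k) s \<le> f s"
  shows "tree_b (Suc k) t \<le> 1 / (1 + child_sum (\<lambda>s. 1 / f s) t)"
proof (cases "\<exists>s\<in>set (branches t). child_sum (tree_b k) s = 0")
  case True
  then show ?thesis using assms(1) by (auto intro!: divide_nonneg_nonneg add_nonneg_nonneg child_sum_nonneg)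
next
  case False
  have "child_sum (\<lambda>s. 1 / f s) t \<le> child_sum (\<lambda>s. 1 / child_sum (tree_b k) s) t"
  proof (rule child_sum_mono)
    fix s assume "s \<in> set (branches t)"
    then have "0 < child_sum (tree_b k) s" using False child_sum_tree_b_nonneg[of k s] by force
    then show "1 / f s \<le> 1 / child_sum (tree_b k) s" using assms(2)[of s] by (intro divide_left_mono) auto
  qed
  moreover have "0 \<le> child_sum (\<lambda>s. 1 / f s) t" using assms(1) by (intro child_sum_nonneg) auto
  ultimately show ?thesis using False by (auto intro!: divide_left_mono mult_pos_pos)
qed

lemma tree_b_incr: "tree_b k t \<le> tree_b (Suc k) t"
proof (induction k arbitrary: t)
  case 0
  then show ?case using tree_b_bounds(1)[of 1 t] by simp
next
  case (Suc k)
  have S: "child_sum (tree_b k) s \<le> child_sum (tree_b (Suc k)) s" for s by (intro child_sum_mono Suc)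
  show ?case
  proof (cases "\<exists>s\<in>set (branches t). child_sum (tree_b (Suc k)) s = 0")
    case True
    then obtain s where "s \<in> set (branches t)" "child_sum (tree_b k) s = 0"
      using S child_sum_tree_b_nonneg by (metis antisym)
    then have "tree_b (Suc k) t = 0" by auto
    then show ?thesis using tree_b_bounds(1)[of "Suc (Suc k)" t] by linarith
  next
    case False
    then have "tree_b (Suc (Suc k)) t = 1 / (1 + child_sum (\<lambda>s. 1 / child_sum (tree_b (Suc k)) s) t)"
      by (simp del: tree_b.simps add: tree_b.simps(2)[of "Suc k"])
    then show ?thesis using tree_b_step_mono[OF child_sum_tree_b_nonneg S, of t] by simp
  qed
qed

text \<open>The index shift comes from the base case: \<open>tree_b 1\<close> is the indicator of a
  root without branches, which lies below one step of the finite recursion. Afterwards both sides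
  take double steps, and \<open>1 / l\<close> only raises the right side.\<close>

lemma tree_b_le_tree_x:
  assumes "l > 0"
  shows "tree_b (Suc k) t \<le> tree_x l (2 * k + 1) t"
proof (induction k arbitrary: t)
  case 0
  have "0 \<le> l * child_sum (\<lambda>s. 1) t" using assms by (intro mult_nonneg_nonneg child_sum_nonneg) auto
  then show ?case by (cases "branches t") (auto simp: child_sum_def)
next
  case (Suc k)
  have "tree_b (Suc (Suc k)) t \<le> 1 / (1 + child_sum (\<lambda>s. 1 / (1 / l + child_sum (tree_x l (2 * k + 1)) s)) t)"
  proof (rule tree_b_step_mono)
    fix s
    have "child_sum (tree_b (Suc k)) s \<le> child_sum (tree_x l (2 * k + 1)) s" by (intro child_sum_mono Suc)
    then show "child_sum (tree_b (Suc k)) s \<le> 1 / l + child_sum (tree_x l (2 * k + 1)) s" using assms by (simp add: add_increasing)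
    then show "0 \<le> 1 / l + child_sum (tree_x l (2 * k + 1)) s" using child_sum_tree_b_nonneg[of "Suc k" s] by linarith
  qed
  also have "\<dots> = tree_x l (Suc (Suc (2 * k + 1))) t" by (simp only: tree_x_step2[OF assms])
  finally show ?case by simp
qed

lemma tree_b_pos_iff: "tree_b (Suc k) t \<noteq> 0 \<longleftrightarrow> (\<forall>s\<in>set (branches t). child_sum (tree_b k) s \<noteq> 0)"
proof -
  have "0 \<le> child_sum (\<lambda>s. 1 / child_sum (tree_b k) s) t"
    by (intro child_sum_nonneg divide_nonneg_nonneg tree_b_bounds) auto
  then have "1 + child_sum (\<lambda>s. 1 / child_sum (tree_b k) s) t \<noteq> 0" by linarith
  then show ?thesis by simp
qed

lemma prob_child_sum_zero:
  assumes "c > 0" "\<And>s. 0 \<le> f s"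
  shows "measure_pmf.prob (gw_tree c (Suc K)) {t. child_sum f t = 0} = exp (- c * measure_pmf.prob (gw_tree c K) {t. f t \<noteq> 0})"
proof -
  have "measure_pmf.prob (gw_tree c (Suc K)) {t. child_sum f t = 0} = measure_pmf.prob (iid_list c (gw_tree c K)) {ts. \<forall>t\<in>set ts. f t = 0}"
    by (simp add: measure_map_pmf vimage_def child_sum_eq_0_iff[OF assms(2)])
  then show ?thesis using prob_iid_list_all[OF assms(1), of "gw_tree c K" "\<lambda>t. f t = 0"] by simp
qed

text \<open>A root is nonzero when no child has vanishing child sum, and a child sum vanishes when
  all its summands do. Two nested void probabilities give one application of
  \<open>ks_map\<close>.\<close>

lemma prob_tree_b_pos:
  assumes "c > 0" "2 * k \<le> K"
  shows "measure_pmf.prob (gw_tree c K) {t. tree_b k t \<noteq> 0} = (ks_map c ^^ k) 0"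
  using assms(2)
proof (induction k arbitrary: K)
  case 0
  then show ?case by simp
next
  case (Suc k)
  define j where "j = K - 2"
  have K: "K = Suc (Suc j)" "2 * k \<le> j" using Suc.prems by (auto simp: j_def)
  have "measure_pmf.prob (gw_tree c K) {t. tree_b (Suc k) t \<noteq> 0} =
     measure_pmf.prob (iid_list c (gw_tree c (Suc j))) {ts. \<forall>s\<in>set ts. child_sum (tree_b k) s \<noteq> 0}"
    unfolding tree_b_pos_iff K gw_tree.simps(2)[of c "Suc j"] by (simp add: measure_map_pmf vimage_def del: gw_tree.simps)
  also have "\<dots> = exp (- c * exp (- c * measure_pmf.prob (gw_tree c j) {t. tree_b k t \<noteq> 0}))"
    using prob_child_sum_zero[OF assms(1), of "tree_b k" j] tree_b_bounds(1)
    by (simp add: prob_iid_list_all[OF assms(1)] del: gw_tree.simps)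
  finally show ?case using Suc.IH[OF K(2)] by (simp add: ks_map_def)
qed

section \<open>Lower bound on the tree\<close>

lemma expectation_pair_swap:
  fixes f :: "'a \<times> 'b \<Rightarrow> real"
  shows "measure_pmf.expectation (pair_pmf A B) f = measure_pmf.expectation (pair_pmf B A) (\<lambda>(b, a). f (a, b))"
  by (subst pair_commute_pmf) (simp add: case_prod_beta)

lemma fst_sum_list: "fst (sum_list (map f xs)) = (\<Sum>x\<leftarrow>xs. fst (f x))"
  by (induction xs) auto

lemma snd_sum_list: "snd (sum_list (map f xs)) = (\<Sum>x\<leftarrow>xs. snd (f x))"
  by (induction xs) auto

lemma sum_list_of_bool_eq_0_iff: "(\<Sum>x\<leftarrow>xs. of_bool (P x)) = (0::real) \<longleftrightarrow> (\<forall>x\<in>set xs. \<not> P x)"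
  by (subst sum_list_nonneg_eq_0_iff) auto

lemma member_le_sum_list_map:
  assumes "x \<in> set xs" "\<And>y. (0::real) \<le> f y"
  shows "f x \<le> (\<Sum>y\<leftarrow>xs. f y)"
  using assms(1)
proof (induction xs)
  case (Cons a xs)
  have "0 \<le> (\<Sum>y\<leftarrow>xs. f y)" using assms(2) by (intro sum_list_nonneg) auto
  then show ?case using Cons assms(2)[of a] by auto
qed simp

lemma expectation_pair_RNode:
  fixes h :: "'a \<times> rtree \<Rightarrow> real"
  assumes "\<And>x. 0 \<le> h x" "\<And>x. h x \<le> B"
  shows "measure_pmf.expectation (pair_pmf M (gw_tree c (Suc K))) h =
    measure_pmf.expectation (pair_pmf M (iid_list c (gw_tree c K))) (\<lambda>(s, ts). h (s, RNode ts))"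
  using assms by (simp add: expectation_pair_pmf_bounded[where B = B] case_prod_beta)

lemma expectation_pair_trunc:
  fixes h :: "'a \<times> rtree \<Rightarrow> real"
  assumes "\<And>x. 0 \<le> h x" "\<And>x. h x \<le> B" "\<And>s t. h (s, trunc j t) = h (s, t)" "j \<le> K" "j \<le> K'"
  shows "measure_pmf.expectation (pair_pmf M (gw_tree c K)) h = measure_pmf.expectation (pair_pmf M (gw_tree c K')) h"
  using assms(1,2) expectation_gw_tree_trunc[of "\<lambda>t. h (_, t)", OF assms(3-5)]
  by (simp add: expectation_pair_pmf_bounded[where B = B])

lemma frac_bounds: "0 \<le> (a::real) \<Longrightarrow> 0 \<le> r \<Longrightarrow> 0 \<le> a / (a + r) \<and> a / (a + r) \<le> 1"
  by (auto simp: divide_le_eq)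

text \<open>With messages \<open>1 / S s\<close> of total \<open>Y\<close> the root is
  \<open>1 / (1 + Y)\<close>, that is 1 minus the shares \<open>(1 / S s) / (1 + Y)\<close> of the
  children. Mecke's formula detaches the child \<open>s\<close> from an independent tree
  \<open>t\<close> formed by the others, and its share becomes \<open>b / (b + S s)\<close> with
  \<open>b\<close> the value of \<open>t\<close>.\<close>

lemma tree_b_balance:
  fixes c :: real and k K :: nat
  assumes c: "c > 0"
  defines "S \<equiv> child_sum (tree_b k)"
  shows "measure_pmf.expectation (gw_tree c (Suc (Suc K))) (tree_b (Suc k)) =
    measure_pmf.prob (gw_tree c (Suc (Suc K))) {t. tree_b (Suc k) t \<noteq> 0}
     - c * measure_pmf.expectation (pair_pmf (gw_tree c (Suc K)) (gw_tree c (Suc (Suc K))))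
             (\<lambda>(s, t). of_bool (S s \<noteq> 0) * (tree_b (Suc k) t / (tree_b (Suc k) t + S s)))"
proof -
  define M where "M = gw_tree c (Suc K)"
  define N where "N = iid_list c M"
  \<comment> \<open>Two statistics of the siblings: the sum of the finite messages and the number of
    infinite ones.\<close>
  define f where "f s = (1 / S s, of_bool (S s = 0) :: real)" for s
  \<comment> \<open>The absolute value keeps \<open>G\<close> bounded on all arguments, as Mecke's
    formula requires; the sums actually inserted are nonnegative.\<close>
  define G where "G s z = of_bool (S s \<noteq> 0 \<and> snd z = 0) * ((1 / S s) / (1 + 1 / S s + \<bar>fst z\<bar>))" for s and z :: "real \<times> real"
  have S0: "0 \<le> S s" for s unfolding S_def by (rule child_sum_tree_b_nonneg)
  have frac: "0 \<le> a / (1 + a + \<bar>r\<bar>) \<and> a / (1 + a + \<bar>r\<bar>) \<le> 1" if "0 \<le> a" for a r :: real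
    using that by (auto simp: divide_le_eq)
  have G0: "0 \<le> G s z" and G1: "G s z \<le> 1" for s z
    using S0[of s] frac[of "1 / S s" "fst z"] by (auto simp: G_def)
  have Y0: "0 \<le> (\<Sum>s\<leftarrow>ts. 1 / S s)" for ts using S0 by (intro sum_list_nonneg) auto
  have b'_eq: "tree_b (Suc k) (RNode ts) = (if \<exists>s\<in>set ts. S s = 0 then 0 else 1 / (1 + (\<Sum>s\<leftarrow>ts. 1 / S s)))" for ts
    by (simp add: S_def child_sum_def[of _ "RNode ts"])
  have fs: "fst (\<Sum>s\<leftarrow>ts. f s) = (\<Sum>s\<leftarrow>ts. 1 / S s)" "snd (\<Sum>s\<leftarrow>ts. f s) = (\<Sum>s\<leftarrow>ts. of_bool (S s = 0))" for ts
    by (simp_all add: fst_sum_list snd_sum_list f_def)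
  have point: "tree_b (Suc k) (RNode ts) = of_bool (\<forall>s\<in>set ts. S s \<noteq> 0) - (\<Sum>s\<leftarrow>ts. G s ((\<Sum>s\<leftarrow>ts. f s) - f s))" for ts
  proof (cases "\<exists>s\<in>set ts. S s = 0")
    case True
    then obtain s0 where s0: "s0 \<in> set ts" "S s0 = 0" by auto
    have "G s ((\<Sum>s\<leftarrow>ts. f s) - f s) = 0" for s
    proof (cases "S s = 0")
      case False
      have "1 \<le> (\<Sum>s\<leftarrow>ts. of_bool (S s = 0) :: real)"
        using member_le_sum_list_map[OF s0(1), of "\<lambda>s. of_bool (S s = 0)"] s0(2) by simp
      then show ?thesis using False by (simp add: G_def fs) (simp add: f_def)
    qed (simp add: G_def)
    then have "(\<Sum>s\<leftarrow>ts. G s ((\<Sum>s\<leftarrow>ts. f s) - f s)) = 0" by simp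
    then show ?thesis using True by (simp add: b'_eq del: tree_b.simps)
  next
    case False
    let ?Y = "\<Sum>s\<leftarrow>ts. 1 / S s"
    have "G s ((\<Sum>s\<leftarrow>ts. f s) - f s) = (1 / S s) / (1 + ?Y)" if "s \<in> set ts" for s
    proof -
      have "1 / S s \<le> ?Y" using member_le_sum_list_map[OF that, of "\<lambda>s. 1 / S s"] S0 by simp
      moreover have "(\<Sum>s\<leftarrow>ts. of_bool (S s = 0)) = (0::real)" using False by (simp add: sum_list_of_bool_eq_0_iff)
      ultimately show ?thesis using False that by (simp add: G_def fs) (simp add: f_def)
    qed
    then have "(\<Sum>s\<leftarrow>ts. G s ((\<Sum>s\<leftarrow>ts. f s) - f s)) = (\<Sum>s\<leftarrow>ts. (1 / S s) / (1 + ?Y))"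
      by (intro arg_cong[of _ _ sum_list] map_cong) auto
    also have "\<dots> = ?Y / (1 + ?Y)" by (simp only: divide_inverse[of _ "1 + ?Y"] sum_list_mult_const)
    finally show ?thesis using False Y0[of ts] by (simp add: b'_eq field_simps del: tree_b.simps)
  qed
  have G_eq: "G s (\<Sum>s\<leftarrow>ts. f s) = of_bool (S s \<noteq> 0) * (tree_b (Suc k) (RNode ts) / (tree_b (Suc k) (RNode ts) + S s))" for s ts
  proof (cases "\<exists>s\<in>set ts. S s = 0")
    case True
    then have "(\<Sum>s\<leftarrow>ts. of_bool (S s = 0)) \<noteq> (0::real)" by (simp add: sum_list_of_bool_eq_0_iff)
    then show ?thesis using True by (simp add: G_def fs b'_eq del: tree_b.simps)
  next
    case False
    then have "(\<Sum>s\<leftarrow>ts. of_bool (S s = 0)) = (0::real)" by (simp add: sum_list_of_bool_eq_0_iff)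
    then show ?thesis using False Y0[of ts] S0[of s] by (simp add: G_def fs b'_eq field_simps del: tree_b.simps)
  qed
  have int: "integrable (measure_pmf N) (\<lambda>ts. \<Sum>s\<leftarrow>ts. G s ((\<Sum>s\<leftarrow>ts. f s) - f s))"
    unfolding N_def by (rule mecke(2)[OF c G0 G1])
  have "measure_pmf.expectation (gw_tree c (Suc (Suc K))) (tree_b (Suc k)) = measure_pmf.expectation N (\<lambda>ts. tree_b (Suc k) (RNode ts))"
    by (simp add: N_def M_def del: tree_b.simps)
  also have "\<dots> = measure_pmf.prob N {ts. \<forall>s\<in>set ts. S s \<noteq> 0} - measure_pmf.expectation N (\<lambda>ts. \<Sum>s\<leftarrow>ts. G s ((\<Sum>s\<leftarrow>ts. f s) - f s))"
    unfolding point using int by (subst Bochner_Integration.integral_diff) (auto simp: expectation_of_bool intro!: integrable_pmf_bounded[of _ _ 1])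
  also have "measure_pmf.prob N {ts. \<forall>s\<in>set ts. S s \<noteq> 0} = measure_pmf.prob (gw_tree c (Suc (Suc K))) {t. tree_b (Suc k) t \<noteq> 0}"
    unfolding tree_b_pos_iff by (simp add: N_def M_def measure_map_pmf vimage_def S_def)
  also have "measure_pmf.expectation N (\<lambda>ts. \<Sum>s\<leftarrow>ts. G s ((\<Sum>s\<leftarrow>ts. f s) - f s)) =
    c * measure_pmf.expectation (pair_pmf M N) (\<lambda>(s, ts). of_bool (S s \<noteq> 0) * (tree_b (Suc k) (RNode ts) / (tree_b (Suc k) (RNode ts) + S s)))"
    unfolding N_def using mecke_pair[OF c, where G = G and B = 1 and f = f and D = M, OF G0 G1] unfolding G_eq .
  also have "measure_pmf.expectation (pair_pmf M N) (\<lambda>(s, ts). of_bool (S s \<noteq> 0) * (tree_b (Suc k) (RNode ts) / (tree_b (Suc k) (RNode ts) + S s))) =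
    measure_pmf.expectation (pair_pmf (gw_tree c (Suc K)) (gw_tree c (Suc (Suc K))))
             (\<lambda>(s, t). of_bool (S s \<noteq> 0) * (tree_b (Suc k) t / (tree_b (Suc k) t + S s)))"
  proof (subst expectation_pair_RNode[where B = 1])
    fix x :: "rtree \<times> rtree"
    show "0 \<le> (case x of (s, t) \<Rightarrow> of_bool (S s \<noteq> 0) * (tree_b (Suc k) t / (tree_b (Suc k) t + S s)))"
      "(case x of (s, t) \<Rightarrow> of_bool (S s \<noteq> 0) * (tree_b (Suc k) t / (tree_b (Suc k) t + S s))) \<le> 1"
      using frac_bounds[OF tree_b_bounds(1) S0, of "Suc k" "snd x" "fst x"] by (cases x; simp del: tree_b.simps)+
  qed (simp add: N_def M_def case_prod_beta del: tree_b.simps gw_tree.simps)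
  finally show ?thesis .
qed

text \<open>The same pair read the other way round: \<open>t\<close> is attached to the root of
  \<open>s\<close>, and the fraction is the share of \<open>t\<close> in the enlarged child sum. By
  Mecke's formula the shares are summed over all children. They add up to at most 1, and they vanish
  unless at least two children are nonzero.\<close>

lemma tree_b_two_children:
  fixes c :: real and k K K' :: nat
  assumes c: "c > 0" and K: "2 * k \<le> K" "2 * k \<le> K'"
  defines "S \<equiv> child_sum (tree_b k)" and "\<tau> \<equiv> (ks_map c ^^ k) 0"
  shows "c * measure_pmf.expectation (pair_pmf (gw_tree c (Suc K)) (gw_tree c K'))
             (\<lambda>(s, t). of_bool (S s \<noteq> 0) * (tree_b k t / (tree_b k t + S s))) \<le> 1 - exp (- c * \<tau>) - c * \<tau> * exp (- c * \<tau>)"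
proof -
  define D where "D = gw_tree c K"
  define N where "N = iid_list c D"
  let ?b = "tree_b k"
  have b0: "0 \<le> ?b t" for t by (rule tree_b_bounds)
  have S0: "0 \<le> S s" for s unfolding S_def by (rule child_sum_tree_b_nonneg)
  define G where "G t z = of_bool (z \<noteq> 0) * (?b t / (?b t + \<bar>z\<bar>))" for t z
  have G0: "0 \<le> G t z" and G1: "G t z \<le> 1" for t z
    using b0[of t] by (auto simp: G_def divide_le_eq)
  have sum0: "0 \<le> (\<Sum>t\<leftarrow>ts. ?b t)" for ts using b0 by (intro sum_list_nonneg) auto
  let ?cnt = "\<lambda>ts. \<Sum>t\<leftarrow>ts. of_bool (?b t \<noteq> 0) :: real"
  have point: "(\<Sum>t\<leftarrow>ts. G t ((\<Sum>t\<leftarrow>ts. ?b t) - ?b t)) \<le> of_bool (2 \<le> ?cnt ts)" for ts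
  proof -
    let ?s = "\<Sum>t\<leftarrow>ts. ?b t"
    have le: "?b t \<le> ?s" if "t \<in> set ts" for t using member_le_sum_list_map[OF that, of ?b] b0 by simp
    have Gle: "G t (?s - ?b t) \<le> ?b t / ?s" if "t \<in> set ts" for t
      using le[OF that] b0[of t] by (auto simp: G_def)
    show ?thesis
    proof (cases "2 \<le> ?cnt ts")
      case True
      have "(\<Sum>t\<leftarrow>ts. G t (?s - ?b t)) \<le> (\<Sum>t\<leftarrow>ts. ?b t / ?s)" using Gle by (intro sum_list_mono) auto
      also have "\<dots> = ?s / ?s" by (simp only: divide_inverse sum_list_mult_const)
      also have "\<dots> \<le> 1" by simp
      finally show ?thesis using True by simp
    next
      case False
      \<comment> \<open>A nonzero entry is the only one here, so nothing is left when it is removed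
        and the guard \<open>z \<noteq> 0\<close> in \<open>G\<close> applies.\<close>
      have "G t (?s - ?b t) = 0" if t: "t \<in> set ts" for t
      proof (cases "?b t = 0")
        case b: False
        have "?s = ?b t"
        proof (rule ccontr)
          assume ne: "?s \<noteq> ?b t"
          obtain xs ys where ts: "ts = xs @ t # ys" using t by (meson split_list)
          then have "(\<Sum>t\<leftarrow>xs @ ys. ?b t) \<noteq> 0" using ne by auto
          then obtain u where "u \<in> set (xs @ ys)" "?b u \<noteq> 0"
            using b0 by (subst (asm) sum_list_nonneg_eq_0_iff) auto
          then have "1 \<le> ?cnt (xs @ ys)" using member_le_sum_list_map[of u "xs @ ys" "\<lambda>t. of_bool (?b t \<noteq> 0)"] by simp
          then show False using b ts False by auto
        qed
        then show ?thesis by (simp add: G_def)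
      qed (simp add: G_def)
      then have "(\<Sum>t\<leftarrow>ts. G t (?s - ?b t)) = (\<Sum>t\<leftarrow>ts. 0)" by (intro arg_cong[of _ _ sum_list] map_cong) auto
      then show ?thesis by simp
    qed
  qed
  have h01: "0 \<le> of_bool (S s \<noteq> 0) * (?b t / (?b t + S s))" "of_bool (S s \<noteq> 0) * (?b t / (?b t + S s)) \<le> 1" for s t
    using S0[of s] b0[of t] by (auto simp: divide_le_eq)
  have "measure_pmf.expectation (pair_pmf (gw_tree c (Suc K)) (gw_tree c K')) (\<lambda>(s, t). of_bool (S s \<noteq> 0) * (?b t / (?b t + S s))) =
     measure_pmf.expectation (pair_pmf (gw_tree c (Suc K)) D) (\<lambda>(s, t). of_bool (S s \<noteq> 0) * (?b t / (?b t + S s)))"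
    unfolding D_def by (rule expectation_pair_trunc[where B = 1 and j = "2 * k"]) (use h01 K in \<open>auto simp: tree_b_trunc\<close>)
  also have "\<dots> = measure_pmf.expectation (pair_pmf D (gw_tree c (Suc K))) (\<lambda>(t, s). of_bool (S s \<noteq> 0) * (?b t / (?b t + S s)))"
    by (subst expectation_pair_swap) (simp add: case_prod_beta)
  also have "\<dots> = measure_pmf.expectation (pair_pmf D N) (\<lambda>(t, ts). G t (\<Sum>t\<leftarrow>ts. ?b t))"
    using h01 sum0 by (subst expectation_pair_RNode[where B = 1]) (auto simp: N_def D_def G_def S_def child_sum_def case_prod_beta)
  finally have "c * measure_pmf.expectation (pair_pmf (gw_tree c (Suc K)) (gw_tree c K')) (\<lambda>(s, t). of_bool (S s \<noteq> 0) * (?b t / (?b t + S s))) =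
     c * measure_pmf.expectation (pair_pmf D N) (\<lambda>(t, ts). G t (\<Sum>t\<leftarrow>ts. ?b t))" by simp
  also have "\<dots> = measure_pmf.expectation N (\<lambda>ts. \<Sum>t\<leftarrow>ts. G t ((\<Sum>t\<leftarrow>ts. ?b t) - ?b t))"
    unfolding N_def by (rule mecke_pair[OF c G0 G1, symmetric])
  also have "\<dots> \<le> measure_pmf.expectation N (\<lambda>ts. of_bool (2 \<le> ?cnt ts))"
    using point by (intro expectation_mono_pmf) (auto simp: N_def intro!: mecke(2)[OF c G0 G1] integrable_pmf_bounded[of _ _ 1])
  also have "\<dots> = 1 - exp (- c * \<tau>) - c * \<tau> * exp (- c * \<tau>)"
    unfolding expectation_of_bool N_def prob_iid_list_two[OF c] D_def \<tau>_def prob_tree_b_pos[OF c K(1)] ..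
  finally show ?thesis .
qed

text \<open>\<open>tree_b_balance\<close> involves level \<open>Suc k\<close> for \<open>t\<close>
  and level \<open>k\<close> for \<open>s\<close>, whereas \<open>tree_b_two_children\<close> needs
  level \<open>k\<close> for both. The last two error terms pay for lowering the level of
  \<open>t\<close>: by Lipschitz continuity where the child sum is at least \<open>\<eta>\<close>,
  and trivially where it is positive but smaller.\<close>

lemma tree_b_step_lower:
  fixes c \<eta> :: real and k :: nat
  assumes c: "c > 0" and \<eta>: "\<eta> > 0"
  defines "\<tau> \<equiv> \<lambda>k. (ks_map c ^^ k) 0" and "e \<equiv> \<lambda>k. measure_pmf.expectation (gw_tree c (2 * k)) (tree_b k)"
  shows "\<tau> (Suc k) - (1 - exp (- c * \<tau> k) - c * \<tau> k * exp (- c * \<tau> k)) - c * ((e (Suc k) - e k) / \<eta>)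
     - c * measure_pmf.prob (gw_tree c (Suc (2 * k))) {s. 0 < child_sum (tree_b k) s \<and> child_sum (tree_b k) s < \<eta>} \<le> e (Suc k)"
proof -
  define K where "K = 2 * k"
  let ?S = "child_sum (tree_b k)" and ?b = "tree_b k" and ?b' = "tree_b (Suc k)"
  let ?P = "pair_pmf (gw_tree c (Suc K)) (gw_tree c (Suc (Suc K)))"
  let ?h = "\<lambda>b (s, t). of_bool (?S s \<noteq> 0) * (b t / (b t + ?S s)) :: real"
  have S0: "0 \<le> ?S s" for s by (rule child_sum_tree_b_nonneg)
  have b0: "0 \<le> ?b t" "?b t \<le> ?b' t" "?b' t \<le> 1" for t using tree_b_bounds tree_b_incr by blast+
  have e': "e (Suc k) = measure_pmf.expectation (gw_tree c (Suc (Suc K))) ?b'" by (simp only: e_def K_def mult_Suc_right add_2_eq_Suc)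
  have e: "e k = measure_pmf.expectation (gw_tree c (Suc (Suc K))) ?b"
    unfolding e_def by (rule expectation_gw_tree_trunc[where j = "2 * k"]) (auto simp: tree_b_trunc K_def)
  have hint: "integrable (measure_pmf ?P) (?h b)" if "\<And>t. 0 \<le> b t" for b
  proof (rule integrable_pmf_bounded[of _ _ 1])
    fix x
    have "0 \<le> ?h b x \<and> ?h b x \<le> 1"
      using frac_bounds[of "b (snd x)" "?S (fst x)", OF that S0] by (cases x) auto
    then show "\<bar>?h b x\<bar> \<le> 1" by linarith
  qed
  have intb: "integrable (measure_pmf M) (\<lambda>x. tree_b j (g x))" for M :: "'x pmf" and j g
    using tree_b_bounds by (intro integrable_pmf_bounded[of _ _ 1]) auto
  have "measure_pmf.expectation ?P (?h ?b') \<le> measure_pmf.expectation ?P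
      (\<lambda>x. ?h ?b x + (?b' (snd x) - ?b (snd x)) / \<eta> + of_bool (0 < ?S (fst x) \<and> ?S (fst x) < \<eta>))"
  proof (rule expectation_mono_pmf)
    fix x :: "rtree \<times> rtree"
    obtain s t where x: "x = (s, t)" by fastforce
    show "?h ?b' x \<le> ?h ?b x + (?b' (snd x) - ?b (snd x)) / \<eta> + of_bool (0 < ?S (fst x) \<and> ?S (fst x) < \<eta>)"
    proof (cases "?S s = 0")
      case True
      then show ?thesis using b0[of t] \<eta> by (simp add: x del: tree_b.simps)
    next
      case False
      then have pos: "0 < ?S s" using S0[of s] by simp
      have h1: "?b' t / (?b' t + ?S s) \<le> 1" using b0[of t] pos by (simp add: divide_le_eq del: tree_b.simps)
      have h2: "0 \<le> ?b t / (?b t + ?S s)" using b0[of t] pos by simp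
      have h3: "0 \<le> (?b' t - ?b t) / \<eta>" using b0[of t] \<eta> by simp
      show ?thesis
      proof (cases "?S s < \<eta>")
        case True
        then show ?thesis using h1 h2 h3 pos False by (simp add: x del: tree_b.simps)
      next
        case ge: False
        \<comment> \<open>The map \<open>b \<mapsto> b / (b + S)\<close> has slope at most
          \<open>1 / S\<close>, hence at most \<open>1 / \<eta>\<close>.\<close>
        have "?b' t / (?b' t + ?S s) - ?b t / (?b t + ?S s) = (?b' t - ?b t) * (?S s / ((?b' t + ?S s) * (?b t + ?S s)))"
          using b0[of t] pos by (simp add: divide_simps del: tree_b.simps) (simp add: algebra_simps del: tree_b.simps)
        also have "\<dots> \<le> (?b' t - ?b t) * (1 / \<eta>)"
        proof (rule mult_left_mono)
          have "?S s * \<eta> \<le> ?S s * ?S s" using ge pos by (intro mult_left_mono) auto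
          also have "\<dots> \<le> (?b' t + ?S s) * (?b t + ?S s)" using b0[of t] pos by (intro mult_mono) (auto simp del: tree_b.simps)
          finally show "?S s / ((?b' t + ?S s) * (?b t + ?S s)) \<le> 1 / \<eta>"
            using \<eta> b0[of t] pos by (simp add: divide_simps del: tree_b.simps)
        qed (use b0[of t] in simp)
        finally show ?thesis using ge False by (simp add: x del: tree_b.simps)
      qed
    qed
  next
    show "integrable (measure_pmf ?P) (?h ?b')" by (rule hint) (rule tree_b_bounds)
    have "integrable (measure_pmf ?P) (?h ?b)" by (rule hint) (rule tree_b_bounds)
    then show "integrable (measure_pmf ?P) (\<lambda>x. ?h ?b x + (?b' (snd x) - ?b (snd x)) / \<eta> + of_bool (0 < ?S (fst x) \<and> ?S (fst x) < \<eta>))"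
      by (intro Bochner_Integration.integrable_add integrable_divide Bochner_Integration.integrable_diff intb)
         (auto intro!: integrable_pmf_bounded[of _ _ 1])
  qed
  also have "\<dots> = measure_pmf.expectation ?P (?h ?b) + (e (Suc k) - e k) / \<eta> + measure_pmf.prob (gw_tree c (Suc K)) {s. 0 < ?S s \<and> ?S s < \<eta>}"
  proof -
    have ih: "integrable (measure_pmf ?P) (?h ?b)" by (rule hint) (rule tree_b_bounds)
    have id: "integrable (measure_pmf ?P) (\<lambda>x. (?b' (snd x) - ?b (snd x)) / \<eta>)"
      by (intro integrable_divide Bochner_Integration.integrable_diff intb)
    have ip: "integrable (measure_pmf ?P) (\<lambda>x. of_bool (0 < ?S (fst x) \<and> ?S (fst x) < \<eta>) :: real)"
      by (rule integrable_pmf_bounded[of _ _ 1]) simp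
    have "measure_pmf.expectation ?P (\<lambda>x. ?h ?b x + (?b' (snd x) - ?b (snd x)) / \<eta> + of_bool (0 < ?S (fst x) \<and> ?S (fst x) < \<eta>)) =
      measure_pmf.expectation ?P (?h ?b) + measure_pmf.expectation ?P (\<lambda>x. (?b' (snd x) - ?b (snd x)) / \<eta>)
       + measure_pmf.expectation ?P (\<lambda>x. of_bool (0 < ?S (fst x) \<and> ?S (fst x) < \<eta>))"
      unfolding Bochner_Integration.integral_add[OF Bochner_Integration.integrable_add[OF ih id] ip]
        Bochner_Integration.integral_add[OF ih id] ..
    also have "measure_pmf.expectation ?P (\<lambda>x. (?b' (snd x) - ?b (snd x)) / \<eta>) = (e (Suc k) - e k) / \<eta>"
      unfolding e e' using expectation_pair_pmf_snd[of "gw_tree c (Suc K)" "gw_tree c (Suc (Suc K))" "\<lambda>t. (?b' t - ?b t) / \<eta>"]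
        Bochner_Integration.integral_diff[OF intb intb, of "gw_tree c (Suc (Suc K))" "Suc k" "\<lambda>t. t" k "\<lambda>t. t"]
      by (simp del: tree_b.simps gw_tree.simps)
    also have "measure_pmf.expectation ?P (\<lambda>x. of_bool (0 < ?S (fst x) \<and> ?S (fst x) < \<eta>)) = measure_pmf.prob (gw_tree c (Suc K)) {s. 0 < ?S s \<and> ?S s < \<eta>}"
      using expectation_pair_pmf_fst[of "gw_tree c (Suc K)" "gw_tree c (Suc (Suc K))" "\<lambda>s. of_bool (0 < ?S s \<and> ?S s < \<eta>) :: real"]
      by (simp add: expectation_of_bool del: gw_tree.simps)
    finally show ?thesis .
  qed
  finally have "c * measure_pmf.expectation ?P (?h ?b') \<le> c * measure_pmf.expectation ?P (?h ?b) + c * ((e (Suc k) - e k) / \<eta>)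
     + c * measure_pmf.prob (gw_tree c (Suc K)) {s. 0 < ?S s \<and> ?S s < \<eta>}"
    using c by (simp only: distrib_left[symmetric] mult_le_cancel_left_pos)
  moreover have "c * measure_pmf.expectation ?P (?h ?b) \<le> 1 - exp (- c * \<tau> k) - c * \<tau> k * exp (- c * \<tau> k)"
    unfolding \<tau>_def by (rule tree_b_two_children[OF c]) (auto simp: K_def)
  moreover have "e (Suc k) = \<tau> (Suc k) - c * measure_pmf.expectation ?P (?h ?b')"
    unfolding e' tree_b_balance[OF c] using prob_tree_b_pos[OF c, of "Suc k" "Suc (Suc K)"] by (simp add: K_def \<tau>_def)
  ultimately show ?thesis unfolding K_def by linarith
qed

lemma prob_small_positive:
  fixes f :: "'a \<Rightarrow> real"
  assumes "\<delta> > 0"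
  shows "\<exists>\<eta>>0. measure_pmf.prob M {s. 0 < f s \<and> f s < \<eta>} < \<delta>"
proof -
  define A where "A n = {s. 0 < f s \<and> f s < inverse (real (Suc n))}" for n
  have "decseq A"
  proof (rule decseq_SucI)
    fix n
    have "inverse (real (Suc (Suc n))) \<le> inverse (real (Suc n))" by (intro le_imp_inverse_le) auto
    then have "0 < f s \<and> f s < inverse (real (Suc n))" if "0 < f s \<and> f s < inverse (real (Suc (Suc n)))" for s
      using that by linarith
    then show "A (Suc n) \<subseteq> A n" unfolding A_def by blast
  qed
  then have "(\<lambda>n. measure_pmf.prob M (A n)) \<longlonglongrightarrow> measure_pmf.prob M (\<Inter>n. A n)"
    by (intro measure_pmf.finite_Lim_measure_decseq) auto
  also have "(\<Inter>n. A n) = {}"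
  proof (rule ccontr)
    assume "(\<Inter>n. A n) \<noteq> {}"
    then obtain s where s: "\<And>n. s \<in> A n" by auto
    then have "0 < f s" by (simp add: A_def)
    then obtain n where "inverse (real (Suc n)) < f s" using reals_Archimedean by blast
    then show False using s[of n] by (simp add: A_def)
  qed
  finally have "(\<lambda>n. measure_pmf.prob M (A n)) \<longlonglongrightarrow> 0" by simp
  then have "\<forall>\<^sub>F n in sequentially. measure_pmf.prob M (A n) < \<delta>" using assms order_tendstoD(2) by blast
  then obtain n where "measure_pmf.prob M (A n) < \<delta>" by (auto simp: eventually_sequentially)
  then show ?thesis by (intro exI[of _ "inverse (real (Suc n))"]) (auto simp: A_def)
qed

lemma exp_diff_le:
  fixes c x y :: real
  assumes "c > 0" "0 \<le> x" "x \<le> y"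
  shows "exp (- c * x) - exp (- c * y) \<le> c * (y - x)"
proof -
  have "exp (- c * x) - exp (- c * y) = exp (- c * x) * (1 - exp (- c * (y - x)))"
    by (simp add: algebra_simps exp_add[symmetric])
  also have "\<dots> \<le> 1 * (c * (y - x))"
    using assms exp_ge_add_one_self[of "- c * (y - x)"] by (intro mult_mono) (auto simp del: exp_ge_add_one_self)
  finally show ?thesis by simp
qed

text \<open>A single \<open>\<eta>\<close> must serve all large \<open>k\<close>, because the
  increments of \<open>e\<close> are divided by it before \<open>k\<close> tends to infinity. It is
  chosen at a level \<open>k0\<close> where \<open>\<tau>\<close> is already close to its
  limit.\<close>

lemma tree_b_lower:
  assumes c: "c > 0" and \<delta>: "\<delta> > 0"
  shows "\<exists>k. ks_potential c (y_c c) - \<delta> \<le> measure_pmf.expectation (gw_tree c (2 * k)) (tree_b k) \<and> k > 0"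
proof -
  define \<tau> where "\<tau> = (\<lambda>k. (ks_map c ^^ k) 0)"
  define e where "e k = measure_pmf.expectation (gw_tree c (2 * k)) (tree_b k)" for k
  define y where "y = y_c c"
  have \<tau>_lim: "\<tau> \<longlonglongrightarrow> y" and \<tau>_le: "\<tau> k \<le> y" and y_fix: "ks_map c y = y" for k
    using ks_iterates_tendsto[OF c] by (auto simp: \<tau>_def y_def)
  \<comment> \<open>The error \<open>y - \<tau> k0\<close> later gets one factor \<open>c\<close>
    from \<open>exp_diff_le\<close> and another from \<open>tree_b_step_lower\<close>.\<close>
  have "\<forall>\<^sub>F k in sequentially. y - \<delta> / (4 * c\<^sup>2) < \<tau> k" using \<tau>_lim c \<delta> by (intro order_tendstoD) auto
  then obtain k0 where "y - \<delta> / (4 * c\<^sup>2) < \<tau> k0" by (auto simp: eventually_sequentially)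
  then have k0: "c * (c * (y - \<tau> k0)) \<le> \<delta> / 4" using c by (simp add: field_simps power2_eq_square)
  let ?S = "\<lambda>k. child_sum (tree_b k)"
  obtain \<eta> where \<eta>: "\<eta> > 0" "measure_pmf.prob (gw_tree c (Suc (2 * k0))) {s. 0 < ?S k0 s \<and> ?S k0 s < \<eta>} < \<delta> / (4 * c)"
    using prob_small_positive[of "\<delta> / (4 * c)" "gw_tree c (Suc (2 * k0))" "?S k0"] c \<delta> by auto
  have small: "c * measure_pmf.prob (gw_tree c (Suc (2 * k))) {s. 0 < ?S k s \<and> ?S k s < \<eta>} \<le> \<delta> / 2" if "k0 \<le> k" for k
  proof -
    let ?M = "gw_tree c (Suc (2 * k))"
    have b_mono: "tree_b k0 t \<le> tree_b k t" for t using that by (induction k rule: dec_induct) (auto intro: order_trans tree_b_incr simp del: tree_b.simps)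
    have mono: "?S k0 s \<le> ?S k s" for s by (intro child_sum_mono b_mono)
    have S_trunc: "?S k0 (trunc (Suc (2 * k0)) s) = ?S k0 s" for s by (simp add: child_sum_trunc tree_b_trunc del: trunc.simps)
    \<comment> \<open>A small positive child sum at level \<open>k\<close> was small and positive at
      level \<open>k0\<close> already, or it was zero there and has become positive since. The
      latter probability is a difference of void probabilities.\<close>
    have "of_bool (0 < ?S k s \<and> ?S k s < \<eta>) \<le> of_bool (0 < ?S k0 s \<and> ?S k0 s < \<eta>) + (of_bool (?S k0 s = 0) - of_bool (?S k s = 0) :: real)" for s
      using mono[of s] child_sum_tree_b_nonneg[of k0 s] by auto
    then have "measure_pmf.expectation ?M (\<lambda>s. of_bool (0 < ?S k s \<and> ?S k s < \<eta>)) \<le>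
       measure_pmf.expectation ?M (\<lambda>s. of_bool (0 < ?S k0 s \<and> ?S k0 s < \<eta>) + (of_bool (?S k0 s = 0) - of_bool (?S k s = 0) :: real))"
      by (intro expectation_mono_pmf Bochner_Integration.integrable_add Bochner_Integration.integrable_diff integrable_pmf_bounded[of _ _ 1]) auto
    also have "\<dots> = measure_pmf.prob ?M {s. 0 < ?S k0 s \<and> ?S k0 s < \<eta>} + (measure_pmf.prob ?M {s. ?S k0 s = 0} - measure_pmf.prob ?M {s. ?S k s = 0})"
      by (simp add: integrable_pmf_bounded[of _ _ 1] expectation_of_bool del: gw_tree.simps)
    also have "measure_pmf.prob ?M {s. ?S k0 s = 0} = exp (- c * \<tau> k0)"
      using prob_child_sum_zero[OF c, of "tree_b k0" "2 * k"] prob_tree_b_pos[OF c, of k0 "2 * k"] that tree_b_bounds(1) by (simp add: \<tau>_def del: gw_tree.simps)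
    also have "measure_pmf.prob ?M {s. ?S k s = 0} = exp (- c * \<tau> k)"
      using prob_child_sum_zero[OF c, of "tree_b k" "2 * k"] prob_tree_b_pos[OF c, of k "2 * k"] tree_b_bounds(1) by (simp add: \<tau>_def del: gw_tree.simps)
    also have "measure_pmf.prob ?M {s. 0 < ?S k0 s \<and> ?S k0 s < \<eta>} = measure_pmf.prob (gw_tree c (Suc (2 * k0))) {s. 0 < ?S k0 s \<and> ?S k0 s < \<eta>}"
      by (rule prob_gw_tree_trunc[where j = "Suc (2 * k0)"]) (use that S_trunc in auto)
    finally have "measure_pmf.prob ?M {s. 0 < ?S k s \<and> ?S k s < \<eta>} \<le> \<delta> / (4 * c) + (exp (- c * \<tau> k0) - exp (- c * \<tau> k))"
      using \<eta>(2) by (simp add: expectation_of_bool del: gw_tree.simps)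
    also have "exp (- c * \<tau> k0) - exp (- c * \<tau> k) \<le> c * (\<tau> k - \<tau> k0)"
    proof (rule exp_diff_le[OF c])
      show "0 \<le> \<tau> k0" by (cases k0) (auto simp: \<tau>_def intro: less_imp_le ks_map_pos)
      show "\<tau> k0 \<le> \<tau> k" using ks_iterates_incseq[OF c] that by (simp add: \<tau>_def incseq_def)
    qed
    also have "\<dots> \<le> c * (y - \<tau> k0)" using \<tau>_le c by simp
    finally have "c * measure_pmf.prob ?M {s. 0 < ?S k s \<and> ?S k s < \<eta>} \<le> c * (\<delta> / (4 * c) + c * (y - \<tau> k0))"
      using c by simp
    also have "\<dots> = \<delta> / 4 + c * (c * (y - \<tau> k0))" using c by (simp add: field_simps)
    finally show ?thesis using k0 by linarith
  qed
  have e_incr: "e k \<le> e (Suc k)" for k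
  proof -
    have "e k = measure_pmf.expectation (gw_tree c (2 * Suc k)) (tree_b k)"
      unfolding e_def by (rule expectation_gw_tree_trunc[where j = "2 * k"]) (auto simp: tree_b_trunc)
    also have "\<dots> \<le> e (Suc k)" unfolding e_def
      using tree_b_bounds by (intro expectation_mono_pmf tree_b_incr integrable_pmf_bounded[of _ _ 1]) (auto simp del: tree_b.simps)
    finally show ?thesis .
  qed
  have "e k \<le> 1" for k unfolding e_def by (rule expectation_bounds_pmf) (auto intro: tree_b_bounds)
  moreover have "incseq e" by (rule incseq_SucI) (rule e_incr)
  ultimately obtain L where L: "e \<longlonglongrightarrow> L" using incseq_convergent[of e 1] by blast
  \<comment> \<open>The means \<open>e k\<close> converge, so their increments vanish even after
    division by the fixed \<open>\<eta>\<close>; what remains is the potential at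
    \<open>y\<close>.\<close>
  have "(\<lambda>k. \<tau> (Suc k) - (1 - exp (- c * \<tau> k) - c * \<tau> k * exp (- c * \<tau> k)) - c * ((e (Suc k) - e k) / \<eta>)) \<longlonglongrightarrow>
      y - (1 - exp (- c * y) - c * y * exp (- c * y)) - c * ((L - L) / \<eta>)"
    by (intro tendsto_intros \<tau>_lim L LIMSEQ_Suc[OF \<tau>_lim] LIMSEQ_Suc[OF L]) (use \<eta> in auto)
  also have "y - (1 - exp (- c * y) - c * y * exp (- c * y)) - c * ((L - L) / \<eta>) = ks_potential c y"
    using y_fix by (simp add: ks_potential_def)
  finally have "\<forall>\<^sub>F k in sequentially. ks_potential c y - \<delta> / 2 < \<tau> (Suc k) - (1 - exp (- c * \<tau> k) - c * \<tau> k * exp (- c * \<tau> k)) - c * ((e (Suc k) - e k) / \<eta>)"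
    using \<delta> by (intro order_tendstoD) auto
  then have "\<forall>\<^sub>F k in sequentially. k0 \<le> k \<and> ks_potential c y - \<delta> / 2 < \<tau> (Suc k) - (1 - exp (- c * \<tau> k) - c * \<tau> k * exp (- c * \<tau> k)) - c * ((e (Suc k) - e k) / \<eta>)"
    by (intro eventually_conj eventually_ge_at_top)
  from eventually_happens[OF this] obtain k where k: "k0 \<le> k" "ks_potential c y - \<delta> / 2 < \<tau> (Suc k) - (1 - exp (- c * \<tau> k) - c * \<tau> k * exp (- c * \<tau> k)) - c * ((e (Suc k) - e k) / \<eta>)"
    by auto
  have "ks_potential c y - \<delta> \<le> e (Suc k)"
    using tree_b_step_lower[OF c \<eta>(1), of k] small[OF k(1)] k(2) by (simp only: e_def \<tau>_def)
  then show ?thesis by (intro exI[of _ "Suc k"]) (simp only: e_def y_def, simp)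
qed

section \<open>Upper bound on the tree\<close>

text \<open>Finite-\<open>l\<close> version of \<open>tree_b_balance\<close>. The weight
  \<open>w\<close> is evaluated at the value of the root without the child \<open>s\<close>, which
  after Mecke's formula is the value of the independent tree \<open>t\<close>. Weights allow a later
  split into small and large values of \<open>t\<close>.\<close>

lemma tree_x_balance:
  fixes c l :: real and k K :: nat and w :: "real \<Rightarrow> real"
  assumes c: "c > 0" and l: "l > 0" and w: "\<And>a. 0 \<le> w a" "\<And>a. w a \<le> 1"
  defines "Y \<equiv> \<lambda>s. 1 / (1 / l + child_sum (tree_x l k) s)" and "A' \<equiv> tree_x l (Suc (Suc k))"
  shows "c * measure_pmf.expectation (pair_pmf (gw_tree c (Suc K)) (gw_tree c (Suc (Suc K))))
             (\<lambda>(s, t). w (A' t) * (A' t * Y s / (1 + A' t * Y s))) =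
         measure_pmf.expectation (iid_list c (gw_tree c (Suc K)))
             (\<lambda>ts. \<Sum>s\<leftarrow>ts. w (1 / (1 + (\<Sum>s\<leftarrow>ts. Y s) - Y s)) * (Y s / (1 + (\<Sum>s\<leftarrow>ts. Y s))))"
    and "integrable (measure_pmf (iid_list c (gw_tree c (Suc K))))
             (\<lambda>ts. \<Sum>s\<leftarrow>ts. w (1 / (1 + (\<Sum>s\<leftarrow>ts. Y s) - Y s)) * (Y s / (1 + (\<Sum>s\<leftarrow>ts. Y s))))"
proof -
  define M where "M = gw_tree c (Suc K)"
  have Y0: "0 \<le> Y s" for s
    using l tree_x_bounds(1)[OF l] unfolding Y_def
    by (intro divide_nonneg_nonneg add_nonneg_nonneg child_sum_nonneg) (auto intro: less_imp_le)
  have sumY: "0 \<le> (\<Sum>s\<leftarrow>ts. Y s)" for ts using Y0 by (intro sum_list_nonneg) auto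
  have leY: "Y s \<le> (\<Sum>s\<leftarrow>ts. Y s)" if "s \<in> set ts" for s ts using member_le_sum_list_map[OF that, of Y] Y0 by simp
  define G where "G s z = w (1 / (1 + \<bar>z\<bar>)) * (Y s / (1 + Y s + \<bar>z\<bar>))" for s z
  have G0: "0 \<le> G s z" and G1: "G s z \<le> 1" for s z
  proof -
    have "1 + Y s + \<bar>z\<bar> = Y s + (1 + \<bar>z\<bar>)" by simp
    then have "0 \<le> Y s / (1 + Y s + \<bar>z\<bar>) \<and> Y s / (1 + Y s + \<bar>z\<bar>) \<le> 1"
      using frac_bounds[of "Y s" "1 + \<bar>z\<bar>"] Y0[of s] by simp
    then show "0 \<le> G s z" "G s z \<le> 1"
      using w[of "1 / (1 + \<bar>z\<bar>)"] unfolding G_def by (meson mult_le_one mult_nonneg_nonneg)+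
  qed
  have A'_eq: "A' (RNode ts) = 1 / (1 + (\<Sum>s\<leftarrow>ts. Y s))" for ts
    unfolding A'_def tree_x_step2[OF l] by (simp add: child_sum_def[of _ "RNode ts"] Y_def)
  have A'0: "0 < A' t" for t unfolding A'_def by (rule tree_x_bounds[OF l])
  have left: "(\<Sum>s\<leftarrow>ts. G s ((\<Sum>s\<leftarrow>ts. Y s) - Y s)) =
      (\<Sum>s\<leftarrow>ts. w (1 / (1 + (\<Sum>s\<leftarrow>ts. Y s) - Y s)) * (Y s / (1 + (\<Sum>s\<leftarrow>ts. Y s))))" for ts
  proof (intro arg_cong[of _ _ sum_list] map_cong refl)
    fix s assume "s \<in> set ts"
    then have "\<bar>(\<Sum>s\<leftarrow>ts. Y s) - Y s\<bar> = (\<Sum>s\<leftarrow>ts. Y s) - Y s" using leY by simp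
    then show "G s ((\<Sum>s\<leftarrow>ts. Y s) - Y s) = w (1 / (1 + (\<Sum>s\<leftarrow>ts. Y s) - Y s)) * (Y s / (1 + (\<Sum>s\<leftarrow>ts. Y s)))"
      by (simp add: G_def add_diff_eq)
  qed
  have right: "G s (\<Sum>s\<leftarrow>ts. Y s) = w (A' (RNode ts)) * (A' (RNode ts) * Y s / (1 + A' (RNode ts) * Y s))" for s ts
  proof -
    have "Y s / (1 + Y s + (\<Sum>s\<leftarrow>ts. Y s)) = A' (RNode ts) * Y s / (1 + A' (RNode ts) * Y s)"
      unfolding A'_eq using Y0[of s] sumY[of ts] by (simp add: divide_simps)
    then show ?thesis using sumY[of ts] by (simp add: G_def A'_eq)
  qed
  have h: "0 \<le> w (A' t) * (A' t * Y s / (1 + A' t * Y s))" "w (A' t) * (A' t * Y s / (1 + A' t * Y s)) \<le> 1" for s t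
  proof -
    have p: "0 \<le> A' t * Y s" using A'0[of t] Y0[of s] by simp
    then show "0 \<le> w (A' t) * (A' t * Y s / (1 + A' t * Y s))" using w(1) by simp
    show "w (A' t) * (A' t * Y s / (1 + A' t * Y s)) \<le> 1" using p w[of "A' t"]
      by (intro mult_le_one) (auto simp: divide_le_eq)
  qed
  have "measure_pmf.expectation (pair_pmf M (gw_tree c (Suc (Suc K)))) (\<lambda>(s, t). w (A' t) * (A' t * Y s / (1 + A' t * Y s))) =
     measure_pmf.expectation (pair_pmf M (iid_list c M)) (\<lambda>(s, ts). G s (\<Sum>s\<leftarrow>ts. Y s))"
    unfolding M_def right
    by (subst expectation_pair_RNode[where B = 1]) (use h in \<open>auto simp: case_prod_beta simp del: gw_tree.simps times_divide_eq_right\<close>)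
  then have "c * measure_pmf.expectation (pair_pmf M (gw_tree c (Suc (Suc K)))) (\<lambda>(s, t). w (A' t) * (A' t * Y s / (1 + A' t * Y s))) =
     c * measure_pmf.expectation (pair_pmf M (iid_list c M)) (\<lambda>(s, ts). G s (\<Sum>s\<leftarrow>ts. Y s))" by simp
  also have "\<dots> = measure_pmf.expectation (iid_list c M) (\<lambda>ts. \<Sum>s\<leftarrow>ts. G s ((\<Sum>s\<leftarrow>ts. Y s) - Y s))"
    by (rule mecke_pair[OF c, where G = G and B = 1, OF G0 G1, symmetric])
  finally show "c * measure_pmf.expectation (pair_pmf (gw_tree c (Suc K)) (gw_tree c (Suc (Suc K))))
             (\<lambda>(s, t). w (A' t) * (A' t * Y s / (1 + A' t * Y s))) =
         measure_pmf.expectation (iid_list c (gw_tree c (Suc K)))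
             (\<lambda>ts. \<Sum>s\<leftarrow>ts. w (1 / (1 + (\<Sum>s\<leftarrow>ts. Y s) - Y s)) * (Y s / (1 + (\<Sum>s\<leftarrow>ts. Y s))))"
    unfolding M_def left .
  show "integrable (measure_pmf (iid_list c (gw_tree c (Suc K))))
             (\<lambda>ts. \<Sum>s\<leftarrow>ts. w (1 / (1 + (\<Sum>s\<leftarrow>ts. Y s) - Y s)) * (Y s / (1 + (\<Sum>s\<leftarrow>ts. Y s))))"
    using mecke(2)[OF c, where G = G and B = 1 and f = Y and D = M, OF G0 G1] unfolding M_def left .
qed

text \<open>If two children send messages of size at least \<open>1 / \<epsilon>\<close>, the root
  stays below \<open>\<epsilon>\<close> after any one child is removed. So every share is counted,
  and their total is at least \<open>1 / (1 + \<epsilon>)\<close>.\<close>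

lemma tree_x_small_part:
  fixes c l \<epsilon> :: real and k K :: nat
  assumes c: "c > 0" and l: "l > 0" and \<epsilon>: "\<epsilon> > 0"
  defines "Y \<equiv> \<lambda>s. 1 / (1 / l + child_sum (tree_x l k) s)" and "A' \<equiv> tree_x l (Suc (Suc k))"
  defines "q \<equiv> measure_pmf.prob (gw_tree c (Suc K)) {s. 1 / \<epsilon> \<le> Y s}"
  shows "(1 - exp (- c * q) - c * q * exp (- c * q)) / (1 + \<epsilon>) \<le>
     c * measure_pmf.expectation (pair_pmf (gw_tree c (Suc K)) (gw_tree c (Suc (Suc K))))
             (\<lambda>(s, t). of_bool (A' t \<le> \<epsilon>) * (A' t * Y s / (1 + A' t * Y s)))"
proof -
  define N where "N = iid_list c (gw_tree c (Suc K))"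
  have Y0: "0 \<le> Y s" for s
    using l tree_x_bounds(1)[OF l] unfolding Y_def
    by (intro divide_nonneg_nonneg add_nonneg_nonneg child_sum_nonneg) (auto intro: less_imp_le)
  let ?cnt = "\<lambda>ts. \<Sum>s\<leftarrow>ts. of_bool (1 / \<epsilon> \<le> Y s) :: real"
  let ?\<Phi> = "\<lambda>ts. \<Sum>s\<leftarrow>ts. of_bool (1 / (1 + (\<Sum>s\<leftarrow>ts. Y s) - Y s) \<le> \<epsilon>) * (Y s / (1 + (\<Sum>s\<leftarrow>ts. Y s)))"
  have bal: "c * measure_pmf.expectation (pair_pmf (gw_tree c (Suc K)) (gw_tree c (Suc (Suc K))))
             (\<lambda>(s, t). of_bool (A' t \<le> \<epsilon>) * (A' t * Y s / (1 + A' t * Y s))) = measure_pmf.expectation N ?\<Phi>"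
    unfolding Y_def A'_def N_def by (rule tree_x_balance(1)[OF c l, where w = "\<lambda>a. of_bool (a \<le> \<epsilon>)"]) auto
  have int: "integrable (measure_pmf N) ?\<Phi>"
    unfolding Y_def A'_def N_def by (rule tree_x_balance(2)[OF c l, where w = "\<lambda>a. of_bool (a \<le> \<epsilon>)"]) auto
  have point: "of_bool (2 \<le> ?cnt ts) * (1 / (1 + \<epsilon>)) \<le>
     (\<Sum>s\<leftarrow>ts. of_bool (1 / (1 + (\<Sum>s\<leftarrow>ts. Y s) - Y s) \<le> \<epsilon>) * (Y s / (1 + (\<Sum>s\<leftarrow>ts. Y s))))" for ts
  proof (cases "2 \<le> ?cnt ts")
    case False
    have "0 \<le> 1 + (\<Sum>s\<leftarrow>ts. Y s)" using Y0 by (intro add_nonneg_nonneg sum_list_nonneg) auto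
    then show ?thesis using False Y0 by (auto intro!: sum_list_nonneg mult_nonneg_nonneg divide_nonneg_nonneg)
  next
    case True
    let ?\<Sigma> = "\<Sum>s\<leftarrow>ts. Y s"
    \<comment> \<open>At least one of the two big messages survives the removal of
      \<open>s\<close>.\<close>
    have rest: "1 / \<epsilon> \<le> ?\<Sigma> - Y s" if s: "s \<in> set ts" for s
    proof -
      obtain xs ys where ts: "ts = xs @ s # ys" using s by (meson split_list)
      have "(0::real) < ?cnt (xs @ ys)" using True ts by (cases "1 / \<epsilon> \<le> Y s") auto
      then have "?cnt (xs @ ys) \<noteq> 0" by simp
      then obtain u where u: "u \<in> set (xs @ ys)" "1 / \<epsilon> \<le> Y u" unfolding sum_list_of_bool_eq_0_iff by blast
      have "Y u \<le> (\<Sum>s\<leftarrow>xs @ ys. Y s)" using member_le_sum_list_map[OF u(1), of Y] Y0 by simp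
      then show ?thesis using u(2) ts by simp
    qed
    have ne: "ts \<noteq> []" using True by auto
    then obtain s0 where "s0 \<in> set ts" by (cases ts) auto
    then have big: "1 / \<epsilon> \<le> ?\<Sigma>" using rest[of s0] Y0[of s0] by linarith
    have inveps: "0 < 1 / \<epsilon>" using \<epsilon> by simp
    have "1 / (1 + ?\<Sigma> - Y s) \<le> \<epsilon>" if "s \<in> set ts" for s
    proof -
      have "1 / (1 + ?\<Sigma> - Y s) \<le> 1 / (1 / \<epsilon>)"
        using rest[OF that] inveps by (intro divide_left_mono mult_pos_pos) linarith+
      then show ?thesis by simp
    qed
    then have "(\<Sum>s\<leftarrow>ts. of_bool (1 / (1 + ?\<Sigma> - Y s) \<le> \<epsilon>) * (Y s / (1 + ?\<Sigma>))) = (\<Sum>s\<leftarrow>ts. Y s / (1 + ?\<Sigma>))"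
      by (intro arg_cong[of _ _ sum_list] map_cong) auto
    also have "\<dots> = ?\<Sigma> / (1 + ?\<Sigma>)" by (simp only: divide_inverse[of _ "1 + ?\<Sigma>"] sum_list_mult_const)
    also have "1 / (1 + \<epsilon>) \<le> ?\<Sigma> / (1 + ?\<Sigma>)"
    proof -
      have "1 \<le> ?\<Sigma> * \<epsilon>" using big \<epsilon> by (simp add: field_simps)
      moreover have "0 < ?\<Sigma>" using big inveps by linarith
      ultimately show ?thesis using \<epsilon> by (simp add: field_simps)
    qed
    finally show ?thesis using True by simp
  qed
  have "(1 - exp (- c * q) - c * q * exp (- c * q)) / (1 + \<epsilon>) = measure_pmf.expectation N (\<lambda>ts. of_bool (2 \<le> ?cnt ts) * (1 / (1 + \<epsilon>)))"
    using prob_iid_list_two[OF c, of "gw_tree c (Suc K)" "\<lambda>s. 1 / \<epsilon> \<le> Y s"]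
    by (simp add: expectation_of_bool N_def q_def del: gw_tree.simps)
  also have "\<dots> \<le> measure_pmf.expectation N (\<lambda>ts. \<Sum>s\<leftarrow>ts. of_bool (1 / (1 + (\<Sum>s\<leftarrow>ts. Y s) - Y s) \<le> \<epsilon>) * (Y s / (1 + (\<Sum>s\<leftarrow>ts. Y s))))"
    by (intro expectation_mono_pmf point int integrable_mult_left integrable_pmf_bounded[of _ _ 1]) simp
  finally show ?thesis unfolding bal .
qed

text \<open>As in \<open>tree_b_two_children\<close>, \<open>t\<close> becomes an additional child
  of \<open>s\<close>, with share \<open>A t / (A t + 1 / l + child_sum A s)\<close>. If some child
  exceeds \<open>\<epsilon>\<close>, the shares of such children add up to 1 except for the part due
  to \<open>1 / l\<close> and to the small children, and the common denominator is at least
  \<open>\<epsilon>\<close>.\<close>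

lemma tree_x_large_part:
  fixes c l \<epsilon> \<epsilon>' \<delta> :: real and k K K' :: nat
  assumes c: "c > 0" and l: "l > 0" and \<epsilon>: "0 < \<epsilon>'" "\<epsilon>' < \<epsilon>" and K: "k \<le> K" "k \<le> K'"
  defines "A \<equiv> tree_x l k" and "Y \<equiv> \<lambda>s. 1 / (1 / l + child_sum (tree_x l k) s)"
  defines "\<tau> \<equiv> measure_pmf.prob (gw_tree c K) {t. \<epsilon> < A t}"
  assumes gap: "measure_pmf.prob (gw_tree c K) {t. \<epsilon>' < A t \<and> A t \<le> \<epsilon>} \<le> \<delta>"
  shows "1 - exp (- c * \<tau>) - 1 / (l * \<epsilon>) - c * (\<epsilon>' / \<epsilon>) - c * \<delta> \<le>
     c * measure_pmf.expectation (pair_pmf (gw_tree c (Suc K)) (gw_tree c K'))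
             (\<lambda>(s, t). of_bool (\<epsilon> < A t) * (A t * Y s / (1 + A t * Y s)))"
proof -
  define D where "D = gw_tree c K"
  define N where "N = iid_list c D"
  have A0: "0 < A t" "A t \<le> 1" for t using tree_x_bounds[OF l] by (auto simp: A_def)
  have CS0: "0 \<le> child_sum A s" for s using A0 by (intro child_sum_nonneg) (auto intro: less_imp_le)
  have il: "0 < 1 / l" using l by simp
  have Y0: "0 \<le> Y s" for s using CS0[of s] il unfolding Y_def A_def by simp
  have h: "0 \<le> of_bool (\<epsilon> < A t) * (A t * Y s / (1 + A t * Y s))" "of_bool (\<epsilon> < A t) * (A t * Y s / (1 + A t * Y s)) \<le> 1" for s t
    using frac_bounds[of "A t * Y s" 1] A0[of t] Y0[of s] by (auto simp: add.commute)
  define G where "G t z = of_bool (\<epsilon> < A t) * (A t / (A t + 1 / l + \<bar>z\<bar>))" for t z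
  have G0: "0 \<le> G t z" and G1: "G t z \<le> 1" for t z
  proof -
    have "0 \<le> A t / (A t + (1 / l + \<bar>z\<bar>)) \<and> A t / (A t + (1 / l + \<bar>z\<bar>)) \<le> 1"
      using A0[of t] il by (intro frac_bounds) auto
    then show "0 \<le> G t z" "G t z \<le> 1" by (auto simp: G_def add.assoc)
  qed
  have sumA: "0 \<le> (\<Sum>t\<leftarrow>ts. A t)" for ts using A0 by (intro sum_list_nonneg) (auto intro: less_imp_le)
  have leA: "A t \<le> (\<Sum>t\<leftarrow>ts. A t)" if "t \<in> set ts" for t ts using member_le_sum_list_map[OF that, of A] A0 by (simp add: less_imp_le)
  have right: "of_bool (\<epsilon> < A t) * (A t * Y (RNode ts) / (1 + A t * Y (RNode ts))) = G t (\<Sum>t\<leftarrow>ts. A t)" for t ts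
  proof -
    have "A t * (1 / r) / (1 + A t * (1 / r)) = A t / (A t + r)" if "r > 0" for r
      using that A0[of t] by (simp add: divide_simps)
    from this[of "1 / l + (\<Sum>t\<leftarrow>ts. A t)"] show ?thesis
      using il sumA[of ts] by (simp add: G_def Y_def child_sum_def A_def[symmetric] add.assoc)
  qed
  have "measure_pmf.expectation (pair_pmf (gw_tree c (Suc K)) (gw_tree c K')) (\<lambda>(s, t). of_bool (\<epsilon> < A t) * (A t * Y s / (1 + A t * Y s))) =
     measure_pmf.expectation (pair_pmf (gw_tree c (Suc K)) D) (\<lambda>(s, t). of_bool (\<epsilon> < A t) * (A t * Y s / (1 + A t * Y s)))"
    unfolding D_def by (rule expectation_pair_trunc[where B = 1 and j = k]) (use h K in \<open>auto simp: A_def tree_x_trunc\<close>)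
  also have "\<dots> = measure_pmf.expectation (pair_pmf D (gw_tree c (Suc K))) (\<lambda>(t, s). of_bool (\<epsilon> < A t) * (A t * Y s / (1 + A t * Y s)))"
    by (subst expectation_pair_swap) (simp add: case_prod_beta)
  also have "\<dots> = measure_pmf.expectation (pair_pmf D N) (\<lambda>(t, ts). G t (\<Sum>t\<leftarrow>ts. A t))"
    unfolding N_def D_def right[symmetric]
    by (subst expectation_pair_RNode[where B = 1]) (use h in \<open>auto simp: case_prod_beta simp del: gw_tree.simps times_divide_eq_right\<close>)
  finally have "c * measure_pmf.expectation (pair_pmf (gw_tree c (Suc K)) (gw_tree c K')) (\<lambda>(s, t). of_bool (\<epsilon> < A t) * (A t * Y s / (1 + A t * Y s))) =
     c * measure_pmf.expectation (pair_pmf D N) (\<lambda>(t, ts). G t (\<Sum>t\<leftarrow>ts. A t))" by simp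
  also have "\<dots> = measure_pmf.expectation N (\<lambda>ts. \<Sum>t\<leftarrow>ts. G t ((\<Sum>t\<leftarrow>ts. A t) - A t))"
    unfolding N_def by (rule mecke_pair[OF c, where G = G and B = 1, OF G0 G1, symmetric])
  finally have eq: "c * measure_pmf.expectation (pair_pmf (gw_tree c (Suc K)) (gw_tree c K')) (\<lambda>(s, t). of_bool (\<epsilon> < A t) * (A t * Y s / (1 + A t * Y s))) =
     measure_pmf.expectation N (\<lambda>ts. \<Sum>t\<leftarrow>ts. G t ((\<Sum>t\<leftarrow>ts. A t) - A t))" .
  let ?small = "\<lambda>t. A t * of_bool (A t \<le> \<epsilon>)"
  have small01: "0 \<le> ?small t" "?small t \<le> 1" for t using A0[of t] by auto
  have point: "1 - of_bool (\<forall>t\<in>set ts. \<not> \<epsilon> < A t) - 1 / (l * \<epsilon>) - (\<Sum>t\<leftarrow>ts. ?small t) / \<epsilon> \<le> (\<Sum>t\<leftarrow>ts. G t ((\<Sum>t\<leftarrow>ts. A t) - A t))" for ts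
  proof (cases "\<forall>t\<in>set ts. \<not> \<epsilon> < A t")
    case True
    have "0 \<le> (\<Sum>t\<leftarrow>ts. G t ((\<Sum>t\<leftarrow>ts. A t) - A t))" using G0 by (intro sum_list_nonneg) auto
    moreover have "0 \<le> (\<Sum>t\<leftarrow>ts. ?small t) / \<epsilon>" using small01 \<epsilon> by (intro divide_nonneg_nonneg sum_list_nonneg) auto
    moreover have "0 \<le> 1 / (l * \<epsilon>)" using l \<epsilon> by simp
    moreover have "of_bool (\<forall>t\<in>set ts. \<not> \<epsilon> < A t) = (1::real)" using True by simp
    ultimately show ?thesis by linarith
  next
    case False
    then obtain t0 where t0: "t0 \<in> set ts" "\<epsilon> < A t0" by auto
    let ?s = "\<Sum>t\<leftarrow>ts. A t" and ?sm = "\<Sum>t\<leftarrow>ts. ?small t"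
    have T: "\<epsilon> \<le> 1 / l + ?s" using t0 leA[OF t0(1)] il by linarith
    have "(\<Sum>t\<leftarrow>ts. G t (?s - A t)) = (\<Sum>t\<leftarrow>ts. of_bool (\<epsilon> < A t) * A t / (1 / l + ?s))"
      using leA by (intro arg_cong[of _ _ sum_list] map_cong) (auto simp: G_def)
    also have "\<dots> = (\<Sum>t\<leftarrow>ts. of_bool (\<epsilon> < A t) * A t) / (1 / l + ?s)"
      by (simp only: divide_inverse[of _ "1 / l + ?s"] sum_list_mult_const)
    also have "(\<Sum>t\<leftarrow>ts. of_bool (\<epsilon> < A t) * A t) = ?s - ?sm"
      by (induction ts) auto
    also have "(?s - ?sm) / (1 / l + ?s) = 1 - (1 / l + ?sm) / (1 / l + ?s)"
    proof -
      have Tn: "1 / l + ?s \<noteq> 0" using T \<epsilon> by linarith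
      have "1 - (1 / l + ?sm) / (1 / l + ?s) = ((1 / l + ?s) - (1 / l + ?sm)) / (1 / l + ?s)"
        by (simp only: diff_divide_distrib divide_self[OF Tn])
      then show ?thesis by simp
    qed
    also have "\<dots> \<ge> 1 - (1 / l + ?sm) / \<epsilon>"
    proof -
      have "0 \<le> ?sm" using small01 by (intro sum_list_nonneg) auto
      then have "(1 / l + ?sm) / (1 / l + ?s) \<le> (1 / l + ?sm) / \<epsilon>"
        using T \<epsilon> il by (intro divide_left_mono mult_pos_pos) auto
      then show ?thesis by simp
    qed
    finally show ?thesis using False by (simp add: add_divide_distrib)
  qed
  have isum: "integrable (measure_pmf N) (\<lambda>ts. \<Sum>t\<leftarrow>ts. ?small t)"
    unfolding N_def by (rule expectation_sum_iid_list(2)[OF c small01])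
  have "measure_pmf.expectation N (\<lambda>ts. 1 - of_bool (\<forall>t\<in>set ts. \<not> \<epsilon> < A t) - 1 / (l * \<epsilon>) - (\<Sum>t\<leftarrow>ts. ?small t) / \<epsilon>)
     \<le> measure_pmf.expectation N (\<lambda>ts. \<Sum>t\<leftarrow>ts. G t ((\<Sum>t\<leftarrow>ts. A t) - A t))"
  proof (rule expectation_mono_pmf[OF point])
    show "integrable (measure_pmf N) (\<lambda>ts. 1 - of_bool (\<forall>t\<in>set ts. \<not> \<epsilon> < A t) - 1 / (l * \<epsilon>) - (\<Sum>t\<leftarrow>ts. ?small t) / \<epsilon>)"
      using isum by (intro Bochner_Integration.integrable_diff integrable_divide) (auto intro!: integrable_pmf_bounded[of _ _ 1])
    show "integrable (measure_pmf N) (\<lambda>ts. \<Sum>t\<leftarrow>ts. G t ((\<Sum>t\<leftarrow>ts. A t) - A t))"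
      unfolding N_def by (rule mecke(2)[OF c, where G = G and B = 1, OF G0 G1])
  qed
  also have "measure_pmf.expectation N (\<lambda>ts. 1 - of_bool (\<forall>t\<in>set ts. \<not> \<epsilon> < A t) - 1 / (l * \<epsilon>) - (\<Sum>t\<leftarrow>ts. ?small t) / \<epsilon>) =
     1 - measure_pmf.prob N {ts. \<forall>t\<in>set ts. \<not> \<epsilon> < A t} - 1 / (l * \<epsilon>) - c * measure_pmf.expectation D ?small / \<epsilon>"
  proof -
    have ib: "integrable (measure_pmf N) (\<lambda>ts. of_bool (\<forall>t\<in>set ts. \<not> \<epsilon> < A t) :: real)"
      by (rule integrable_pmf_bounded[of _ _ 1]) simp
    have "measure_pmf.expectation N (\<lambda>ts. 1 - of_bool (\<forall>t\<in>set ts. \<not> \<epsilon> < A t) - 1 / (l * \<epsilon>) - (\<Sum>t\<leftarrow>ts. ?small t) / \<epsilon>) =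
      1 - measure_pmf.expectation N (\<lambda>ts. of_bool (\<forall>t\<in>set ts. \<not> \<epsilon> < A t)) - 1 / (l * \<epsilon>) - measure_pmf.expectation N (\<lambda>ts. \<Sum>t\<leftarrow>ts. ?small t) / \<epsilon>"
      using ib isum by (simp del: of_bool_not_iff)
    also have "measure_pmf.expectation N (\<lambda>ts. \<Sum>t\<leftarrow>ts. ?small t) = c * measure_pmf.expectation D ?small"
      unfolding N_def by (rule expectation_sum_iid_list(1)[OF c small01])
    finally show ?thesis unfolding expectation_of_bool .
  qed
  also have "measure_pmf.prob N {ts. \<forall>t\<in>set ts. \<not> \<epsilon> < A t} = exp (- c * \<tau>)"
    unfolding N_def prob_iid_list_all[OF c] \<tau>_def D_def by simp
  finally have main: "1 - exp (- c * \<tau>) - 1 / (l * \<epsilon>) - c * measure_pmf.expectation D ?small / \<epsilon> \<le> measure_pmf.expectation N (\<lambda>ts. \<Sum>t\<leftarrow>ts. G t ((\<Sum>t\<leftarrow>ts. A t) - A t))" .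
  \<comment> \<open>A value of at most \<open>\<epsilon>\<close> is either at most
    \<open>\<epsilon>'\<close> or in the window between the thresholds, which has little
    mass.\<close>
  have "measure_pmf.expectation D ?small \<le> measure_pmf.expectation D (\<lambda>t. \<epsilon>' + \<epsilon> * of_bool (\<epsilon>' < A t \<and> A t \<le> \<epsilon>))"
  proof (rule expectation_mono_pmf)
    show "integrable (measure_pmf D) ?small" by (rule integrable_pmf_bounded[of _ _ 1]) (use small01 in \<open>auto simp: abs_le_iff intro: order_trans[of _ 0]\<close>)
    show "integrable (measure_pmf D) (\<lambda>t. \<epsilon>' + \<epsilon> * of_bool (\<epsilon>' < A t \<and> A t \<le> \<epsilon>))"
      by (rule integrable_pmf_bounded[of _ _ "\<epsilon>' + \<epsilon>"]) (use \<epsilon> in auto)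
  qed (use \<epsilon> in auto)
  also have "\<dots> = \<epsilon>' + \<epsilon> * measure_pmf.prob D {t. \<epsilon>' < A t \<and> A t \<le> \<epsilon>}"
    by (subst Bochner_Integration.integral_add) (auto simp: expectation_of_bool intro!: integrable_pmf_bounded[of _ _ 1])
  also have "\<dots> \<le> \<epsilon>' + \<epsilon> * \<delta>" using gap \<epsilon> by (simp add: D_def)
  finally have "c * measure_pmf.expectation D ?small / \<epsilon> \<le> c * (\<epsilon>' + \<epsilon> * \<delta>) / \<epsilon>"
    using c \<epsilon> by (intro divide_right_mono mult_left_mono) auto
  also have "\<dots> = c * (\<epsilon>' / \<epsilon>) + c * \<delta>" using \<epsilon> by (simp add: field_simps)
  finally show ?thesis using main unfolding eq by linarith
qed


section \<open>Thresholds for negligible values\<close>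

lemma prob_mono_pmf:
  "(\<And>x. P x \<Longrightarrow> Q x) \<Longrightarrow> measure_pmf.prob M {x. P x} \<le> measure_pmf.prob M {x. Q x}"
  by (rule measure_pmf.finite_measure_mono) auto

lemma prob_or_le:
  "(\<And>x. P x \<Longrightarrow> Q x \<or> R x) \<Longrightarrow> measure_pmf.prob M {x. P x} \<le> measure_pmf.prob M {x. Q x} + measure_pmf.prob M {x. R x}"
proof -
  assume "\<And>x. P x \<Longrightarrow> Q x \<or> R x"
  then have "measure_pmf.prob M {x. P x} \<le> measure_pmf.prob M ({x. Q x} \<union> {x. R x})"
    by (intro measure_pmf.finite_measure_mono) auto
  also have "\<dots> \<le> measure_pmf.prob M {x. Q x} + measure_pmf.prob M {x. R x}"
    by (intro measure_Un_le) auto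
  finally show ?thesis .
qed

lemma sum_list_le_length:
  assumes "\<And>x. x \<in> set xs \<Longrightarrow> f x \<le> (b::real)"
  shows "(\<Sum>x\<leftarrow>xs. f x) \<le> real (length xs) * b"
  using assms by (induction xs) (auto simp: algebra_simps, smt (verit))

text \<open>Two scales \<open>\<epsilon>' < \<epsilon>\<close> with little mass of the iterate between them separate the negligible values from
  the others, so that the exact zero/nonzero calculus of the limit \<open>l = \<infinity>\<close> holds approximately.\<close>

lemma tree_x_threshold:
  fixes c l \<epsilon> \<epsilon>' :: real and k K :: nat
  assumes c: "c > 0" and l: "l > 0" and \<epsilon>: "0 < \<epsilon>'" "\<epsilon>' < \<epsilon>" "\<epsilon>' \<le> 1 / 2" "1 / l \<le> \<epsilon> / 2"
  defines "A \<equiv> tree_x l k" and "A' \<equiv> tree_x l (Suc (Suc k))" and "Y \<equiv> \<lambda>s. 1 / (1 / l + child_sum (tree_x l k) s)"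
  defines "q \<equiv> measure_pmf.prob (gw_tree c (Suc K)) {s. 1 / \<epsilon> \<le> Y s}"
  shows "q \<le> exp (- c * measure_pmf.prob (gw_tree c K) {t. \<epsilon> < A t})"
    and "exp (- c * measure_pmf.prob (gw_tree c K) {t. \<epsilon>' < A t}) \<le> q + 2 * c * (\<epsilon>' / \<epsilon>)"
    and "exp (- c * q) \<le> measure_pmf.prob (gw_tree c (Suc (Suc K))) {t. \<epsilon>' < A' t} + 2 * c * (\<epsilon>' / \<epsilon>)"
proof -
  define N where "N = iid_list c (gw_tree c K)"
  define N1 where "N1 = iid_list c (gw_tree c (Suc K))"
  have A0: "0 < A t" "A t \<le> 1" for t using tree_x_bounds[OF l] by (auto simp: A_def)
  have il: "0 < 1 / l" using l by simp
  have CS0: "0 \<le> child_sum A s" for s using A0 by (intro child_sum_nonneg) (auto intro: less_imp_le)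
  have Y_iff: "1 / \<epsilon> \<le> Y s \<longleftrightarrow> 1 / l + child_sum A s \<le> \<epsilon>" for s
  proof -
    have "0 < 1 / l + child_sum A s" using il CS0[of s] by linarith
    then show ?thesis using \<epsilon> unfolding Y_def A_def[symmetric] by (simp add: divide_simps)
  qed
  have Y0: "0 \<le> Y s" for s using CS0[of s] il unfolding Y_def A_def by simp
  have q: "q = measure_pmf.prob N {ts. 1 / l + (\<Sum>t\<leftarrow>ts. A t) \<le> \<epsilon>}"
    by (simp add: q_def Y_iff N_def measure_map_pmf vimage_def child_sum_def)
  have leA: "A t \<le> (\<Sum>t\<leftarrow>ts. A t)" if "t \<in> set ts" for t ts using member_le_sum_list_map[OF that, of A] A0 by (simp add: less_imp_le)
  have "q \<le> measure_pmf.prob N {ts. \<forall>t\<in>set ts. \<not> \<epsilon> < A t}"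
    unfolding q
  proof (rule prob_mono_pmf, intro ballI)
    fix ts t assume "1 / l + (\<Sum>t\<leftarrow>ts. A t) \<le> \<epsilon>" "t \<in> set ts"
    then show "\<not> \<epsilon> < A t" using leA[of t ts] il by linarith
  qed
  then show "q \<le> exp (- c * measure_pmf.prob (gw_tree c K) {t. \<epsilon> < A t})"
    unfolding N_def prob_iid_list_all[OF c] by simp
  \<comment> \<open>Fewer than \<open>r\<close> children with values at most
    \<open>\<epsilon>'\<close> contribute at most \<open>\<epsilon> / 2\<close>; having
    \<open>r\<close> or more children has probability at most \<open>c / r\<close> by Markov's
    inequality.\<close>
  define r where "r = \<epsilon> / (2 * \<epsilon>')"
  have r: "r > 0" "c / r = 2 * c * (\<epsilon>' / \<epsilon>)" "r * \<epsilon>' = \<epsilon> / 2" using \<epsilon> by (auto simp: r_def field_simps)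
  have "measure_pmf.prob N {ts. \<forall>t\<in>set ts. \<not> \<epsilon>' < A t} \<le> q + measure_pmf.prob N {ts. r \<le> real (length ts)}"
    unfolding q
  proof (rule prob_or_le)
    fix ts assume small: "\<forall>t\<in>set ts. \<not> \<epsilon>' < A t"
    show "1 / l + (\<Sum>t\<leftarrow>ts. A t) \<le> \<epsilon> \<or> r \<le> real (length ts)"
    proof (rule disjCI)
      assume "\<not> r \<le> real (length ts)"
      then have "real (length ts) * \<epsilon>' \<le> r * \<epsilon>'" using \<epsilon> by (intro mult_right_mono) auto
      moreover have "(\<Sum>t\<leftarrow>ts. A t) \<le> real (length ts) * \<epsilon>'" using small by (intro sum_list_le_length) (simp add: not_less)
      ultimately show "1 / l + (\<Sum>t\<leftarrow>ts. A t) \<le> \<epsilon>" using r(3) \<epsilon>(4) by linarith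
    qed
  qed
  also have "measure_pmf.prob N {ts. r \<le> real (length ts)} \<le> 2 * c * (\<epsilon>' / \<epsilon>)"
    unfolding N_def r(2)[symmetric] by (rule prob_length_iid_list[OF c r(1)])
  finally show "exp (- c * measure_pmf.prob (gw_tree c K) {t. \<epsilon>' < A t}) \<le> q + 2 * c * (\<epsilon>' / \<epsilon>)"
    unfolding N_def prob_iid_list_all[OF c] by simp
  have A'_eq: "A' (RNode ts) = 1 / (1 + (\<Sum>s\<leftarrow>ts. Y s))" for ts
    unfolding A'_def tree_x_step2[OF l] by (simp add: child_sum_def[of _ "RNode ts"] Y_def)
  have "exp (- c * q) = measure_pmf.prob N1 {ts. \<forall>s\<in>set ts. \<not> 1 / \<epsilon> \<le> Y s}"
    unfolding N1_def prob_iid_list_all[OF c] q_def by simp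
  also have "\<dots> \<le> measure_pmf.prob N1 {ts. \<epsilon>' < A' (RNode ts)} + measure_pmf.prob N1 {ts. r \<le> real (length ts)}"
  proof (rule prob_or_le)
    fix ts assume small: "\<forall>s\<in>set ts. \<not> 1 / \<epsilon> \<le> Y s"
    show "\<epsilon>' < A' (RNode ts) \<or> r \<le> real (length ts)"
    proof (rule disjCI)
      assume "\<not> r \<le> real (length ts)"
      then have "real (length ts) * (1 / \<epsilon>) < r * (1 / \<epsilon>)" using \<epsilon> by (intro mult_strict_right_mono) auto
      also have "r * (1 / \<epsilon>) = 1 / (2 * \<epsilon>')" using \<epsilon> by (simp add: r_def)
      finally have "(\<Sum>s\<leftarrow>ts. Y s) < 1 / (2 * \<epsilon>')"
        using sum_list_le_length[of ts Y "1 / \<epsilon>"] small by (auto simp: not_le intro: less_imp_le order_le_less_trans)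
      moreover have "1 \<le> 1 / (2 * \<epsilon>')" using \<epsilon> by (simp add: field_simps)
      ultimately have "1 + (\<Sum>s\<leftarrow>ts. Y s) < 1 / (2 * \<epsilon>') + 1 / (2 * \<epsilon>')" by linarith
      also have "\<dots> = 1 / \<epsilon>'" using \<epsilon> by (simp add: field_simps)
      finally have "1 + (\<Sum>s\<leftarrow>ts. Y s) < 1 / \<epsilon>'" .
      moreover have "0 \<le> (\<Sum>s\<leftarrow>ts. Y s)" using Y0 by (intro sum_list_nonneg) auto
      ultimately show "\<epsilon>' < A' (RNode ts)" unfolding A'_eq using \<epsilon> by (simp add: field_simps)
    qed
  qed
  also have "measure_pmf.prob N1 {ts. r \<le> real (length ts)} \<le> 2 * c * (\<epsilon>' / \<epsilon>)"
    unfolding N1_def r(2)[symmetric] by (rule prob_length_iid_list[OF c r(1)])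
  also have "measure_pmf.prob N1 {ts. \<epsilon>' < A' (RNode ts)} = measure_pmf.prob (gw_tree c (Suc (Suc K))) {t. \<epsilon>' < A' t}"
    by (simp add: N1_def measure_map_pmf vimage_def)
  finally show "exp (- c * q) \<le> measure_pmf.prob (gw_tree c (Suc (Suc K))) {t. \<epsilon>' < A' t} + 2 * c * (\<epsilon>' / \<epsilon>)" by simp
qed


text \<open>The two parts of the balance bound the mean of \<open>A'\<close> by an expression in
  \<open>q\<close> and \<open>\<tau>\<close>. The threshold estimates eliminate \<open>q\<close> and
  leave the potential at \<open>\<tau>\<close>, which \<open>ks_potential_le\<close> bounds whatever
  \<open>\<tau>\<close> is. In particular \<open>\<tau>\<close> need not be close to a fixed
  point.\<close>

lemma tree_x_upper_step:
  fixes c l \<epsilon> \<epsilon>' \<delta> :: real and k K :: nat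
  assumes c: "c > 0" and l: "l > 0" and \<epsilon>: "0 < \<epsilon>'" "\<epsilon>' < \<epsilon>" "\<epsilon>' \<le> 1 / 2" "1 / l \<le> \<epsilon> / 2"
    and k: "even k" "k \<le> K" and \<delta>: "\<delta> \<ge> 0"
  defines "A \<equiv> tree_x l k" and "A' \<equiv> tree_x l (Suc (Suc k))"
  assumes gap: "measure_pmf.prob (gw_tree c K) {t. \<epsilon>' < A t \<and> A t \<le> \<epsilon>} \<le> \<delta>"
    and close: "measure_pmf.prob (gw_tree c (Suc (Suc K))) {t. \<epsilon> < A t} - measure_pmf.prob (gw_tree c (Suc (Suc K))) {t. \<epsilon> < A' t} \<le> \<delta>"
    and diff: "l * (measure_pmf.expectation (gw_tree c (Suc (Suc K))) A - measure_pmf.expectation (gw_tree c (Suc (Suc K))) A') \<le> \<delta>"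
  shows "measure_pmf.expectation (gw_tree c (Suc (Suc K))) A' \<le>
    ks_potential c (y_c c) + \<epsilon> + 1 / (l * \<epsilon>) + (c + 4 * c\<^sup>2) * (\<epsilon>' / \<epsilon>) + (4 * c + c\<^sup>2) * \<delta>"
proof -
  define M2 where "M2 = gw_tree c (Suc (Suc K))"
  define Y where "Y = (\<lambda>s. 1 / (1 / l + child_sum (tree_x l k) s))"
  define P where "P = pair_pmf (gw_tree c (Suc K)) M2"
  define \<tau> where "\<tau> = measure_pmf.prob (gw_tree c K) {t. \<epsilon> < A t}"
  define q where "q = measure_pmf.prob (gw_tree c (Suc K)) {s. 1 / \<epsilon> \<le> Y s}"
  define h where "h = (\<lambda>a y :: real. a * y / (1 + a * y))"
  have A0: "0 < A t" "A t \<le> 1" and A'0: "0 < A' t" "A' t \<le> 1" for t using tree_x_bounds[OF l] by (auto simp: A_def A'_def simp del: tree_x.simps)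
  have A'A: "A' t \<le> A t" for t using tree_x_alternating[OF l, of k t] k(1) by (simp add: A_def A'_def del: tree_x.simps)
  have il: "0 < 1 / l" using l by simp
  have CS0: "0 \<le> child_sum A s" for s using A0 by (intro child_sum_nonneg) (auto intro: less_imp_le)
  have Y0: "0 \<le> Y s" for s using CS0[of s] il unfolding Y_def A_def by simp
  have Yl: "Y s \<le> l" for s
  proof -
    have "Y s \<le> 1 / (1 / l)" unfolding Y_def A_def[symmetric] using CS0[of s] il by (intro divide_left_mono mult_pos_pos add_pos_nonneg) auto
    then show ?thesis by simp
  qed
  have h01: "0 \<le> h a y" "h a y \<le> 1" if "0 \<le> a" "0 \<le> y" for a y
    using frac_bounds[of "a * y" 1] that by (auto simp: h_def add.commute)
  have int: "integrable (measure_pmf P) f" if "\<And>x. 0 \<le> f x \<and> f x \<le> 1" for f :: "rtree \<times> rtree \<Rightarrow> real"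
    by (rule integrable_pmf_bounded[of _ _ 1]) (use that in \<open>auto simp: abs_le_iff intro: order_trans[of _ 0]\<close>)
  let ?\<Phi> = "\<lambda>w. \<lambda>(s, t). w (A' t) * h (A' t) (Y s)"
  have hA': "0 \<le> h (A' t) (Y s)" "h (A' t) (Y s) \<le> 1" for s t using h01[of "A' t" "Y s"] A'0[of t] Y0[of s] by auto
  have hA: "0 \<le> h (A t) (Y s)" "h (A t) (Y s) \<le> 1" for s t using h01[of "A t" "Y s"] A0[of t] Y0[of s] by auto
  \<comment> \<open>The balance with constant weight 1: the shares of all children add up to 1 minus
    the root value.\<close>
  have total: "1 - measure_pmf.expectation M2 A' = c * measure_pmf.expectation P (\<lambda>(s, t). h (A' t) (Y s))"
  proof -
    let ?N = "iid_list c (gw_tree c (Suc K))"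
    have "c * measure_pmf.expectation P (\<lambda>(s, t). 1 * (A' t * Y s / (1 + A' t * Y s))) =
       measure_pmf.expectation ?N (\<lambda>ts. \<Sum>s\<leftarrow>ts. 1 * (Y s / (1 + (\<Sum>s\<leftarrow>ts. Y s))))"
      unfolding P_def M2_def Y_def A'_def by (rule tree_x_balance(1)[OF c l, where w = "\<lambda>_. 1"]) auto
    also have "(\<lambda>ts. \<Sum>s\<leftarrow>ts. 1 * (Y s / (1 + (\<Sum>s\<leftarrow>ts. Y s)))) = (\<lambda>ts. 1 - A' (RNode ts))"
    proof
      fix ts
      have nonneg: "0 \<le> (\<Sum>s\<leftarrow>ts. Y s)" using Y0 by (intro sum_list_nonneg) auto
      have "A' (RNode ts) = 1 / (1 + (\<Sum>s\<leftarrow>ts. Y s))"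
        unfolding A'_def tree_x_step2[OF l] by (simp add: child_sum_def[of _ "RNode ts"] Y_def)
      moreover have "(\<Sum>s\<leftarrow>ts. 1 * (Y s / (1 + (\<Sum>s\<leftarrow>ts. Y s)))) = (\<Sum>s\<leftarrow>ts. Y s) / (1 + (\<Sum>s\<leftarrow>ts. Y s))"
        by (simp only: mult_1 divide_inverse[of _ "1 + (\<Sum>s\<leftarrow>ts. Y s)"] sum_list_mult_const)
      moreover have "(\<Sum>s\<leftarrow>ts. Y s) / (1 + (\<Sum>s\<leftarrow>ts. Y s)) = 1 - 1 / (1 + (\<Sum>s\<leftarrow>ts. Y s))"
        using nonneg by (simp add: field_simps)
      ultimately show "(\<Sum>s\<leftarrow>ts. 1 * (Y s / (1 + (\<Sum>s\<leftarrow>ts. Y s)))) = 1 - A' (RNode ts)"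
        by (simp only:)
    qed
    also have "measure_pmf.expectation ?N (\<lambda>ts. 1 - A' (RNode ts)) = measure_pmf.expectation M2 (\<lambda>t. 1 - A' t)"
      by (simp add: M2_def)
    also have "\<dots> = 1 - measure_pmf.expectation M2 A'"
      using A'0 by (subst Bochner_Integration.integral_diff) (auto intro!: integrable_pmf_bounded[of _ _ 1] simp: less_imp_le)
    finally show ?thesis by (simp add: h_def)
  qed
  have split: "measure_pmf.expectation P (\<lambda>(s, t). h (A' t) (Y s)) =
     measure_pmf.expectation P (?\<Phi> (\<lambda>a. of_bool (a \<le> \<epsilon>))) + measure_pmf.expectation P (?\<Phi> (\<lambda>a. of_bool (\<epsilon> < a)))"
  proof -
    have "(\<lambda>(s, t). h (A' t) (Y s)) = (\<lambda>x. ?\<Phi> (\<lambda>a. of_bool (a \<le> \<epsilon>)) x + ?\<Phi> (\<lambda>a. of_bool (\<epsilon> < a)) x)"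
      by (auto simp: fun_eq_iff)
    then show ?thesis using hA' by (simp only:) (intro Bochner_Integration.integral_add int, auto)
  qed
  have part1: "(1 - exp (- c * q) - c * q * exp (- c * q)) / (1 + \<epsilon>) \<le> c * measure_pmf.expectation P (?\<Phi> (\<lambda>a. of_bool (a \<le> \<epsilon>)))"
    unfolding P_def M2_def q_def Y_def A'_def h_def using \<epsilon> by (intro tree_x_small_part[OF c l]) auto
  have part2: "1 - exp (- c * \<tau>) - 1 / (l * \<epsilon>) - c * (\<epsilon>' / \<epsilon>) - c * \<delta> \<le> c * measure_pmf.expectation P (\<lambda>(s, t). of_bool (\<epsilon> < A t) * h (A t) (Y s))"
    unfolding P_def M2_def \<tau>_def Y_def A_def h_def using \<epsilon> k gap[unfolded A_def] by (intro tree_x_large_part[OF c l]) auto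
  \<comment> \<open>The large part is known for \<open>A\<close>, but the balance needs
    \<open>A'\<close>. As \<open>Y s\<close> is at most \<open>l\<close>, the map
    \<open>a \<mapsto> h a (Y s)\<close> has Lipschitz constant \<open>l\<close>, which explains the
    factor \<open>l\<close> in the assumption \<open>diff\<close>; \<open>close\<close> pays for the
    change of the indicator.\<close>
  have "measure_pmf.expectation P (\<lambda>(s, t). of_bool (\<epsilon> < A t) * h (A t) (Y s)) \<le>
     measure_pmf.expectation P (\<lambda>x. ?\<Phi> (\<lambda>a. of_bool (\<epsilon> < a)) x + (l * (A (snd x) - A' (snd x)) + (of_bool (\<epsilon> < A (snd x)) - of_bool (\<epsilon> < A' (snd x)))))"
  proof (rule expectation_mono_pmf)
    fix x :: "rtree \<times> rtree"
    obtain s t where x: "x = (s, t)" by fastforce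
    have ld: "0 \<le> l * (A t - A' t)" using l A'A[of t] by simp
    have "h (A t) (Y s) - h (A' t) (Y s) \<le> l * (A t - A' t)"
    proof -
      have p: "0 \<le> A t * Y s" "0 \<le> A' t * Y s" using A0[of t] A'0[of t] Y0[of s] by auto
      have "h (A t) (Y s) - h (A' t) (Y s) = (A t - A' t) * Y s / ((1 + A t * Y s) * (1 + A' t * Y s))"
        unfolding h_def using p by (simp add: divide_simps) (simp add: algebra_simps)
      also have "\<dots> \<le> (A t - A' t) * Y s / 1"
      proof (rule divide_left_mono)
        show "1 \<le> (1 + A t * Y s) * (1 + A' t * Y s)" using p mult_mono[of 1 "1 + A t * Y s" 1 "1 + A' t * Y s"] by simp
      qed (use p A'A[of t] Y0[of s] in auto)
      also have "\<dots> \<le> (A t - A' t) * l" using Yl[of s] A'A[of t] by (simp add: mult_left_mono)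
      finally show ?thesis by (simp add: mult.commute)
    qed
    then show "(case x of (s, t) \<Rightarrow> of_bool (\<epsilon> < A t) * h (A t) (Y s)) \<le> ?\<Phi> (\<lambda>a. of_bool (\<epsilon> < a)) x + (l * (A (snd x) - A' (snd x)) + (of_bool (\<epsilon> < A (snd x)) - of_bool (\<epsilon> < A' (snd x))))"
      using ld A'A[of t] hA[of t s] hA'[of t s] by (auto simp: x)
  next
    show "integrable (measure_pmf P) (\<lambda>(s, t). of_bool (\<epsilon> < A t) * h (A t) (Y s))" using hA by (intro int) auto
    have "integrable (measure_pmf P) (?\<Phi> (\<lambda>a. of_bool (\<epsilon> < a)))" using hA' by (intro int) auto
    then show "integrable (measure_pmf P) (\<lambda>x. ?\<Phi> (\<lambda>a. of_bool (\<epsilon> < a)) x + (l * (A (snd x) - A' (snd x)) + (of_bool (\<epsilon> < A (snd x)) - of_bool (\<epsilon> < A' (snd x)))))"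
      using A0 A'0 hA' by (intro Bochner_Integration.integrable_add Bochner_Integration.integrable_diff integrable_mult_right int) (auto intro: less_imp_le)
  qed
  also have "\<dots> = measure_pmf.expectation P (?\<Phi> (\<lambda>a. of_bool (\<epsilon> < a))) +
      measure_pmf.expectation P (\<lambda>x. l * (A (snd x) - A' (snd x)) + (of_bool (\<epsilon> < A (snd x)) - of_bool (\<epsilon> < A' (snd x))))"
    using A0 A'0 hA' by (intro Bochner_Integration.integral_add Bochner_Integration.integrable_add Bochner_Integration.integrable_diff integrable_mult_right int) (auto intro: less_imp_le)
  also have "measure_pmf.expectation P (\<lambda>x. l * (A (snd x) - A' (snd x)) + (of_bool (\<epsilon> < A (snd x)) - of_bool (\<epsilon> < A' (snd x)))) =
     measure_pmf.expectation M2 (\<lambda>t. l * (A t - A' t) + (of_bool (\<epsilon> < A t) - of_bool (\<epsilon> < A' t)))"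
    unfolding P_def by (rule expectation_pair_pmf_snd)
  also have "\<dots> = l * (measure_pmf.expectation M2 A - measure_pmf.expectation M2 A') + (measure_pmf.prob M2 {t. \<epsilon> < A t} - measure_pmf.prob M2 {t. \<epsilon> < A' t})"
  proof -
    have i: "integrable (measure_pmf M2) A" "integrable (measure_pmf M2) A'"
      "integrable (measure_pmf M2) (\<lambda>t. of_bool (\<epsilon> < A t) :: real)" "integrable (measure_pmf M2) (\<lambda>t. of_bool (\<epsilon> < A' t) :: real)"
      using A0 A'0 by (auto intro!: integrable_pmf_bounded[of _ _ 1] simp: less_imp_le)
    show ?thesis using i by (simp add: expectation_of_bool[symmetric])
  qed
  finally have "measure_pmf.expectation P (\<lambda>(s, t). of_bool (\<epsilon> < A t) * h (A t) (Y s)) \<le> measure_pmf.expectation P (?\<Phi> (\<lambda>a. of_bool (\<epsilon> < a))) + 2 * \<delta>"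
    using diff close unfolding M2_def by linarith
  then have "c * measure_pmf.expectation P (\<lambda>(s, t). of_bool (\<epsilon> < A t) * h (A t) (Y s)) \<le> c * (measure_pmf.expectation P (?\<Phi> (\<lambda>a. of_bool (\<epsilon> < a))) + 2 * \<delta>)"
    using c by (intro mult_left_mono) auto
  then have upper1: "measure_pmf.expectation M2 A' \<le> 1 - (1 - exp (- c * q) - c * q * exp (- c * q)) / (1 + \<epsilon>)
      - (1 - exp (- c * \<tau>) - 1 / (l * \<epsilon>) - c * (\<epsilon>' / \<epsilon>) - c * \<delta>) + 2 * c * \<delta>"
    using part1 part2 total unfolding split distrib_left by linarith
  have q01: "0 \<le> q" "q \<le> 1" and \<tau>01: "0 \<le> \<tau>" "\<tau> \<le> 1" by (auto simp: q_def \<tau>_def)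
  have frac: "1 - exp (- c * q) - c * q * exp (- c * q) - \<epsilon> \<le> (1 - exp (- c * q) - c * q * exp (- c * q)) / (1 + \<epsilon>)"
  proof -
    let ?u = "1 - exp (- c * q) - c * q * exp (- c * q)"
    have "0 \<le> c * q * exp (- c * q)" using c q01 by simp
    then have u: "?u \<le> 1" by (smt (verit) exp_gt_zero)
    have "?u * \<epsilon> \<le> 1 * \<epsilon>" using u \<epsilon> by (intro mult_right_mono) auto
    then have "(?u - \<epsilon>) * (1 + \<epsilon>) \<le> ?u" using \<epsilon> by (simp add: algebra_simps)
    then show ?thesis using \<epsilon> by (simp add: pos_le_divide_eq)
  qed
  note th = tree_x_threshold[OF c l \<epsilon>, where k = k and K = K]
  have th1: "q \<le> exp (- c * \<tau>)" unfolding q_def \<tau>_def Y_def A_def by (rule th(1))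
  have \<tau>': "measure_pmf.prob (gw_tree c K) {t. \<epsilon>' < A t} \<le> \<tau> + \<delta>"
    using prob_or_le[of "\<lambda>t. \<epsilon>' < A t" "\<lambda>t. \<epsilon> < A t" "\<lambda>t. \<epsilon>' < A t \<and> A t \<le> \<epsilon>" "gw_tree c K"] gap unfolding \<tau>_def by force
  have "exp (- c * (\<tau> + \<delta>)) \<le> exp (- c * measure_pmf.prob (gw_tree c K) {t. \<epsilon>' < A t})" using \<tau>' c by simp
  also have "\<dots> \<le> q + 2 * c * (\<epsilon>' / \<epsilon>)" unfolding q_def Y_def A_def by (rule th(2))
  finally have th2: "exp (- c * \<tau>) \<le> q + 2 * c * (\<epsilon>' / \<epsilon>) + c * \<delta>"
    using exp_diff_le[OF c \<tau>01(1), of "\<tau> + \<delta>"] \<delta> by simp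
  have "exp (- c * q) \<le> measure_pmf.prob M2 {t. \<epsilon>' < A' t} + 2 * c * (\<epsilon>' / \<epsilon>)"
    unfolding q_def Y_def A'_def M2_def by (rule th(3))
  \<comment> \<open>Even iterates decrease, so the next level is bounded by the present one; this
    closes the estimates in \<open>\<tau>\<close> alone.\<close>
  also have "measure_pmf.prob M2 {t. \<epsilon>' < A' t} \<le> measure_pmf.prob M2 {t. \<epsilon>' < A t}"
    by (rule prob_mono_pmf) (use A'A in \<open>auto intro: less_le_trans\<close>)
  also have "measure_pmf.prob M2 {t. \<epsilon>' < A t} = measure_pmf.prob (gw_tree c K) {t. \<epsilon>' < A t}"
    unfolding M2_def by (rule prob_gw_tree_trunc[where j = k]) (use k in \<open>auto simp: A_def tree_x_trunc\<close>)
  finally have th3: "exp (- c * q) \<le> \<tau> + \<delta> + 2 * c * (\<epsilon>' / \<epsilon>)" using \<tau>' by linarith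
  define \<eta> where "\<eta> = \<epsilon>' / \<epsilon>"
  have \<eta>0: "0 \<le> \<eta>" using \<epsilon> by (simp add: \<eta>_def)
  define z where "z = exp (- c * \<tau>)"
  have z01: "0 \<le> z" "z \<le> 1" using c \<tau>01 by (auto simp: z_def)
  have e1: "exp (- c * q) \<le> exp (- c * z) + c * (2 * c * \<eta> + c * \<delta>)"
  proof -
    have "exp (- c * q) - exp (- c * z) \<le> c * (z - q)" using th1 q01 by (intro exp_diff_le[OF c]) (auto simp: z_def)
    also have "\<dots> \<le> c * (2 * c * \<eta> + c * \<delta>)" using th2 c by (intro mult_left_mono) (auto simp: z_def \<eta>_def)
    finally show ?thesis by linarith
  qed
  \<comment> \<open>The upper bounds for \<open>q\<close> and for \<open>exp (- c * q)\<close> are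
    multiplied, so the product \<open>\<tau> * z\<close> required by the potential appears.\<close>
  have e2: "c * q * exp (- c * q) \<le> c * \<tau> * z + c * (\<delta> + 2 * c * \<eta>)"
  proof -
    have "q * exp (- c * q) \<le> z * (\<tau> + (\<delta> + 2 * c * \<eta>))"
      using th1 th3 q01 z01 by (intro mult_mono) (auto simp: z_def \<eta>_def)
    also have "\<dots> \<le> \<tau> * z + (\<delta> + 2 * c * \<eta>)"
      using mult_right_mono[of z 1 "\<delta> + 2 * c * \<eta>"] z01 \<delta> c \<eta>0 by (simp add: algebra_simps)
    finally have "c * (q * exp (- c * q)) \<le> c * (\<tau> * z + (\<delta> + 2 * c * \<eta>))" using c by (intro mult_left_mono) auto
    then show ?thesis by (simp add: algebra_simps)
  qed
  have pot: "c * \<tau> * z + z + exp (- c * z) - 1 \<le> ks_potential c (y_c c)"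
    using ks_potential_le[OF c \<tau>01] by (simp add: ks_potential_def ks_map_def z_def)
  have "measure_pmf.expectation M2 A' \<le> exp (- c * q) + c * q * exp (- c * q) + z - 1 + \<epsilon> + 1 / (l * \<epsilon>) + c * \<eta> + 3 * c * \<delta>"
    using upper1 frac unfolding z_def \<eta>_def by linarith
  also have "\<dots> \<le> ks_potential c (y_c c) + \<epsilon> + 1 / (l * \<epsilon>) + (c * \<eta> + 3 * c * \<delta> + c * (2 * c * \<eta> + c * \<delta>) + c * (\<delta> + 2 * c * \<eta>))"
    using e1 e2 pot by linarith
  also have "\<dots> = ks_potential c (y_c c) + \<epsilon> + 1 / (l * \<epsilon>) + (c + 4 * c\<^sup>2) * \<eta> + (4 * c + c\<^sup>2) * \<delta>"
    by (simp add: algebra_simps power2_eq_square)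
  finally show ?thesis unfolding M2_def \<eta>_def .
qed


lemma decseq_bounded_diff_tendsto_0:
  fixes a :: "nat \<Rightarrow> real"
  assumes "\<And>k. a (Suc k) \<le> a k" "\<And>k. 0 \<le> a k"
  shows "(\<lambda>k. a k - a (Suc k)) \<longlonglongrightarrow> 0"
proof -
  have "decseq a" by (rule decseq_SucI) (rule assms)
  then obtain L where L: "a \<longlonglongrightarrow> L" using decseq_convergent[of a 0] assms(2) by blast
  show ?thesis using tendsto_diff[OF L LIMSEQ_Suc[OF L]] by simp
qed

text \<open>Pigeonhole over geometric scales: among \<open>J\<close> disjoint windows between
  consecutive thresholds one has mass at most \<open>\<gamma>\<close>. The number \<open>l\<close>
  is chosen for the finest scale, and the depth afterwards, so that consecutive even iterates differ
  in mean by less than \<open>\<gamma> / l\<close>.\<close>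

lemma tree_x_upper:
  fixes c \<delta> :: real
  assumes c: "c > 0" and \<delta>: "\<delta> > 0"
  shows "\<exists>L>0. \<forall>l\<ge>L. \<exists>k. even k \<and> measure_pmf.expectation (gw_tree c k) (tree_x l k) \<le> ks_potential c (y_c c) + \<delta>"
proof -
  \<comment> \<open>The sum of the error coefficients in \<open>tree_x_upper_step\<close>; the final
    2 stands for \<open>\<epsilon> j\<close> and \<open>1 / (l * \<epsilon> j)\<close>.\<close>
  define C where "C = (c + 4 * c\<^sup>2) + (4 * c + c\<^sup>2) + 2"
  define \<gamma> where "\<gamma> = min (1 / 2) (\<delta> / C)"
  have C: "C > 0" using c by (auto simp: C_def intro!: add_pos_nonneg)
  have \<gamma>: "0 < \<gamma>" "\<gamma> \<le> 1 / 2" "C * \<gamma> \<le> \<delta>"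
  proof -
    show "0 < \<gamma>" using \<delta> C by (simp add: \<gamma>_def)
    show "\<gamma> \<le> 1 / 2" by (simp only: \<gamma>_def min.cobounded1)
    have "C * \<gamma> \<le> C * (\<delta> / C)" using C by (intro mult_left_mono) (auto simp: \<gamma>_def)
    then show "C * \<gamma> \<le> \<delta>" using C by simp
  qed
  obtain J :: nat where J: "1 / \<gamma> < real J" using reals_Archimedean2 by blast
  have "0 < real J" by (rule order_less_trans[OF _ J]) (use \<gamma> in simp)
  then have J0: "J > 0" by simp
  have J1: "1 < real J * \<gamma>" using J \<gamma> by (simp add: field_simps)
  define \<epsilon> where "\<epsilon> j = \<gamma> ^ Suc j" for j
  have \<epsilon>0: "0 < \<epsilon> j" for j using \<gamma> by (simp add: \<epsilon>_def)
  have \<epsilon>S: "\<epsilon> (Suc j) = \<gamma> * \<epsilon> j" for j by (simp add: \<epsilon>_def)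
  have \<epsilon>_le: "\<epsilon> j \<le> \<gamma>" for j
    using power_decreasing[of 1 "Suc j" \<gamma>] \<gamma> by (simp add: \<epsilon>_def del: power_Suc)
  show ?thesis
  \<comment> \<open>With this bound \<open>1 / l\<close> is at most
    \<open>\<gamma> * \<epsilon> j\<close> for every \<open>j < J\<close>, whichever scale is
    selected later.\<close>
  proof (intro exI[of _ "1 / \<gamma> ^ Suc J"] conjI allI impI)
    show "0 < 1 / \<gamma> ^ Suc J" using \<gamma> by simp
    fix l assume lL: "1 / \<gamma> ^ Suc J \<le> l"
    have "0 < 1 / \<gamma> ^ Suc J" using \<gamma> by simp
    then have l: "l > 0" using lL by linarith
    have il: "1 / l \<le> \<gamma> ^ Suc J" using lL l \<gamma> by (simp add: field_simps)
    have il': "1 / l \<le> \<gamma> * \<epsilon> j" if "j < J" for j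
    proof -
      have "\<gamma> ^ Suc J \<le> \<gamma> ^ Suc (Suc j)" using that \<gamma> by (intro power_decreasing) auto
      then show ?thesis using il by (simp add: \<epsilon>_def)
    qed
    define A where "A k = tree_x l (2 * k)" for k
    define e where "e k = measure_pmf.expectation (gw_tree c (2 * k)) (A k)" for k
    define p where "p j k = measure_pmf.prob (gw_tree c (2 * k)) {t. \<epsilon> j < A k t}" for j k
    have A01: "0 < A k t" "A k t \<le> 1" for k t using tree_x_bounds[OF l] by (auto simp: A_def)
    have A_decr: "A (Suc k) t \<le> A k t" for k t using tree_x_alternating[OF l, of "2 * k" t] by (simp add: A_def del: tree_x.simps)
    have A_trunc: "A k (trunc j t) = A k t" if "2 * k \<le> j" for k j t unfolding A_def by (rule tree_x_trunc[OF that])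
    have e_eq: "e k = measure_pmf.expectation (gw_tree c K) (A k)" if "2 * k \<le> K" for k K
      unfolding e_def by (rule expectation_gw_tree_trunc[where j = "2 * k"]) (use that A_trunc in auto)
    have p_eq: "p j k = measure_pmf.prob (gw_tree c K) {t. \<epsilon> j < A k t}" if "2 * k \<le> K" for j k K
      unfolding p_def by (rule prob_gw_tree_trunc[where j = "2 * k"]) (use that A_trunc in auto)
    have iA: "integrable (measure_pmf M) (A k)" for M k
      using A01 by (auto intro!: integrable_pmf_bounded[of _ _ 1] simp: less_imp_le)
    have e_decr: "e (Suc k) \<le> e k" for k
      using e_eq[of k "2 * Suc k"] e_eq[of "Suc k" "2 * Suc k"] expectation_mono_pmf[OF A_decr iA iA] by (simp del: gw_tree.simps)
    have e0: "0 \<le> e k" for k unfolding e_def using A01 by (intro integral_nonneg_AE) (auto intro: less_imp_le)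
    have p_decr: "p j (Suc k) \<le> p j k" for j k
    proof -
      have "p j (Suc k) = measure_pmf.prob (gw_tree c (2 * Suc k)) {t. \<epsilon> j < A (Suc k) t}" by (simp add: p_def)
      also have "\<dots> \<le> measure_pmf.prob (gw_tree c (2 * Suc k)) {t. \<epsilon> j < A k t}"
        by (rule prob_mono_pmf) (use A_decr in \<open>auto intro: less_le_trans\<close>)
      also have "\<dots> = p j k" using p_eq[of k "2 * Suc k" j] by simp
      finally show ?thesis .
    qed
    have "\<forall>\<^sub>F k in sequentially. e k - e (Suc k) < \<gamma> / l"
      using decseq_bounded_diff_tendsto_0[of e, OF e_decr e0] \<gamma> l by (intro order_tendstoD) auto
    moreover have "\<forall>\<^sub>F k in sequentially. \<forall>j\<in>{..<J}. p j k - p j (Suc k) < \<gamma>"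
    proof (intro eventually_ball_finite ballI)
      fix j
      have "0 \<le> p j k" for k by (simp add: p_def)
      then show "\<forall>\<^sub>F k in sequentially. p j k - p j (Suc k) < \<gamma>"
        using decseq_bounded_diff_tendsto_0[of "p j", OF p_decr] \<gamma> by (intro order_tendstoD) auto
    qed simp
    ultimately have "\<forall>\<^sub>F k in sequentially. e k - e (Suc k) < \<gamma> / l \<and> (\<forall>j\<in>{..<J}. p j k - p j (Suc k) < \<gamma>)"
      by (rule eventually_conj)
    from eventually_happens[OF this] obtain k where k: "e k - e (Suc k) < \<gamma> / l" "\<And>j. j < J \<Longrightarrow> p j k - p j (Suc k) < \<gamma>"
      by auto
    \<comment> \<open>The window masses telescope to at most 1, whereas \<open>J * \<gamma>\<close>
      exceeds 1.\<close>
    have "\<exists>j<J. p (Suc j) k - p j k \<le> \<gamma>"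
    proof (rule ccontr)
      assume "\<not> ?thesis"
      then have "(\<Sum>j<J. \<gamma>) \<le> (\<Sum>j<J. p (Suc j) k - p j k)" by (intro sum_mono) (auto simp: not_le less_imp_le)
      also have "\<dots> = p J k - p 0 k" by (rule sum_lessThan_telescope)
      also have "\<dots> \<le> 1" unfolding p_def by (smt (verit) measure_nonneg measure_pmf.prob_le_1)
      finally show False using J1 by simp
    qed
    then obtain j where j: "j < J" "p (Suc j) k - p j k \<le> \<gamma>" by auto
    have gap: "measure_pmf.prob (gw_tree c (2 * k)) {t. \<epsilon> (Suc j) < A k t \<and> A k t \<le> \<epsilon> j} \<le> \<gamma>"
    proof -
      have lt: "\<epsilon> (Suc j) < \<epsilon> j" using \<epsilon>S[of j] \<epsilon>0[of j] \<gamma> by simp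
      have "measure_pmf.expectation (gw_tree c (2 * k)) (\<lambda>t. of_bool (\<epsilon> (Suc j) < A k t \<and> A k t \<le> \<epsilon> j)) =
         measure_pmf.expectation (gw_tree c (2 * k)) (\<lambda>t. of_bool (\<epsilon> (Suc j) < A k t) - of_bool (\<epsilon> j < A k t))"
        by (rule Bochner_Integration.integral_cong) (use lt in auto)
      also have "\<dots> = p (Suc j) k - p j k"
        by (subst Bochner_Integration.integral_diff) (auto simp: p_def expectation_of_bool intro!: integrable_pmf_bounded[of _ _ 1])
      finally show ?thesis using j(2) by (simp add: expectation_of_bool)
    qed
    have A_eq: "A k = tree_x l (2 * k)" "A (Suc k) = tree_x l (Suc (Suc (2 * k)))" by (simp_all add: A_def del: tree_x.simps)
    have "measure_pmf.expectation (gw_tree c (Suc (Suc (2 * k)))) (A (Suc k)) \<le>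
      ks_potential c (y_c c) + \<epsilon> j + 1 / (l * \<epsilon> j) + (c + 4 * c\<^sup>2) * (\<epsilon> (Suc j) / \<epsilon> j) + (4 * c + c\<^sup>2) * \<gamma>"
      unfolding A_eq
    proof (rule tree_x_upper_step[OF c l])
      show "0 < \<epsilon> (Suc j)" by (rule \<epsilon>0)
      show "\<epsilon> (Suc j) < \<epsilon> j" using \<epsilon>S[of j] \<epsilon>0[of j] \<gamma> by simp
      show "\<epsilon> (Suc j) \<le> 1 / 2" using \<epsilon>_le[of "Suc j"] \<gamma> by linarith
      have "\<gamma> * \<epsilon> j \<le> 1 / 2 * \<epsilon> j" using \<gamma> \<epsilon>0[of j] by (intro mult_right_mono) auto
      then show "1 / l \<le> \<epsilon> j / 2" using il'[OF j(1)] by simp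
      show "measure_pmf.prob (gw_tree c (2 * k)) {t. \<epsilon> (Suc j) < tree_x l (2 * k) t \<and> tree_x l (2 * k) t \<le> \<epsilon> j} \<le> \<gamma>"
        using gap by (simp add: A_def)
      show "measure_pmf.prob (gw_tree c (Suc (Suc (2 * k)))) {t. \<epsilon> j < tree_x l (2 * k) t} -
        measure_pmf.prob (gw_tree c (Suc (Suc (2 * k)))) {t. \<epsilon> j < tree_x l (Suc (Suc (2 * k))) t} \<le> \<gamma>"
        using k(2)[OF j(1)] p_eq[of k "Suc (Suc (2 * k))" j] p_eq[of "Suc k" "Suc (Suc (2 * k))" j]
        unfolding A_eq by (simp del: gw_tree.simps tree_x.simps)
      have "l * (e k - e (Suc k)) \<le> \<gamma>" using k(1) l by (simp add: field_simps)
      then show "l * (measure_pmf.expectation (gw_tree c (Suc (Suc (2 * k)))) (tree_x l (2 * k)) -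
         measure_pmf.expectation (gw_tree c (Suc (Suc (2 * k)))) (tree_x l (Suc (Suc (2 * k))))) \<le> \<gamma>"
        using e_eq[of k "Suc (Suc (2 * k))"] e_eq[of "Suc k" "Suc (Suc (2 * k))"] unfolding A_eq by (simp del: gw_tree.simps tree_x.simps)
    qed (use \<gamma> in auto)
    also have "\<dots> \<le> ks_potential c (y_c c) + \<gamma> + \<gamma> + (c + 4 * c\<^sup>2) * \<gamma> + (4 * c + c\<^sup>2) * \<gamma>"
    proof -
      have "1 / (l * \<epsilon> j) \<le> \<gamma>"
        using il'[OF j(1)] \<epsilon>0[of j] l by (simp add: field_simps)
      moreover have "\<epsilon> (Suc j) / \<epsilon> j = \<gamma>" using \<epsilon>S[of j] \<epsilon>0[of j] by simp
      ultimately show ?thesis using \<epsilon>_le[of j] by simp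
    qed
    also have "\<dots> = ks_potential c (y_c c) + C * \<gamma>" by (simp add: C_def algebra_simps)
    also have "\<dots> \<le> ks_potential c (y_c c) + \<delta>" using \<gamma> by simp
    finally show "\<exists>k. even k \<and> measure_pmf.expectation (gw_tree c k) (tree_x l k) \<le> ks_potential c (y_c c) + \<delta>"
      unfolding A_eq by (intro exI[of _ "Suc (Suc (2 * k))"]) (simp del: gw_tree.simps tree_x.simps)
  qed
qed

section \<open>Messages in the percolated graph\<close>

lemma regular_graph_two_uniform: "regular_graph d V E \<Longrightarrow> two_uniform E"
  unfolding regular_graph_def simple_graph_def two_uniform_def
  by (auto intro: finite_subset[of E "Pow V"])

lemma regular_graph_finite: "regular_graph d V E \<Longrightarrow> finite V" "regular_graph d V E \<Longrightarrow> finite E"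
  using regular_graph_two_uniform unfolding regular_graph_def simple_graph_def two_uniform_def by blast+

lemma free_nbrs_in_V: "regular_graph d V E \<Longrightarrow> u \<in> free_nbrs E W v \<Longrightarrow> u \<in> V \<and> u \<noteq> v \<and> u \<notin> W"
  using regular_graph_two_uniform[of d V E] two_uniform_not_loop[of E v u]
  unfolding regular_graph_def simple_graph_def free_nbrs_def by auto

text \<open>Deleting \<open>W\<close> costs a vertex at most \<open>card W\<close> of its
  \<open>d\<close> neighbours, so normalising by \<open>d\<close> is harmless for bounded
  \<open>W\<close>.\<close>

lemma card_free_nbrs:
  assumes "regular_graph d V E" "v \<in> V" "finite W"
  shows "card (free_nbrs E W v) \<le> d" "d \<le> card (free_nbrs E W v) + card W"
proof -
  have E: "two_uniform E" "finite E" using regular_graph_two_uniform[OF assms(1)] regular_graph_finite(2)[OF assms(1)] by auto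
  have "bij_betw (\<lambda>u. {v, u}) (free_nbrs E {} v) {e \<in> E. v \<in> e}"
    unfolding bij_betw_def
  proof
    show "inj_on (\<lambda>u. {v, u}) (free_nbrs E {} v)" by (auto simp: inj_on_def doubleton_eq_iff)
    show "(\<lambda>u. {v, u}) ` free_nbrs E {} v = {e \<in> E. v \<in> e}"
      using two_uniform_edge[OF E(1)] by (auto simp: free_nbrs_def image_iff) metis
  qed
  then have d: "card (free_nbrs E {} v) = d"
    using assms by (simp add: bij_betw_same_card regular_graph_def degree_def)
  have fin: "finite (free_nbrs E X v)" for X by (rule finite_free_nbrs[OF E(2)])
  have "free_nbrs E W v \<subseteq> free_nbrs E {} v" by (auto simp: free_nbrs_def)
  then show "card (free_nbrs E W v) \<le> d" using d card_mono[OF fin] by metis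
  have "free_nbrs E {} v \<subseteq> free_nbrs E W v \<union> W" by (auto simp: free_nbrs_def)
  then have "d \<le> card (free_nbrs E W v \<union> W)" using d card_mono[of "free_nbrs E W v \<union> W"] fin assms(3) by (metis finite_Un)
  also have "\<dots> \<le> card (free_nbrs E W v) + card W" by (rule card_Un_le)
  finally show "d \<le> card (free_nbrs E W v) + card W" .
qed

definition perc_x :: "real \<Rightarrow> 'a set set \<Rightarrow> nat \<Rightarrow> ('a set \<Rightarrow> bool) \<Rightarrow> 'a set \<Rightarrow> 'a \<Rightarrow> real" where
  "perc_x l E k f W v = uncovered_approx l {e \<in> E. f e} k W v"

text \<open>The sum runs over neighbours in the full graph, with the edge indicators explicit, so
  that the edges at \<open>v\<close> can be averaged apart from the messages.\<close>

definition perc_s :: "real \<Rightarrow> 'a set set \<Rightarrow> nat \<Rightarrow> ('a set \<Rightarrow> bool) \<Rightarrow> 'a set \<Rightarrow> 'a \<Rightarrow> real" where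
  "perc_s l E k f W v = (\<Sum>u\<in>free_nbrs E W v. of_bool (f {v, u}) * perc_x l E k f (insert v W) u)"

lemma perc_x_Suc:
  assumes "finite E"
  shows "perc_x l E (Suc k) f W v = 1 / (1 + l * perc_s l E k f W v)"
proof -
  have "(\<Sum>u\<in>free_nbrs {e \<in> E. f e} W v. perc_x l E k f (insert v W) u) = perc_s l E k f W v"
    unfolding perc_s_def
    by (rule sum.mono_neutral_cong_left[OF finite_free_nbrs[OF assms]]) (auto simp: free_nbrs_def)
  then show ?thesis by (simp add: perc_x_def)
qed

lemma perc_x_0: "perc_x l E 0 f W v = 1"
  by (simp add: perc_x_def)

lemma perc_x_bounds: "l > 0 \<Longrightarrow> 0 < perc_x l E k f W v" "l > 0 \<Longrightarrow> perc_x l E k f W v \<le> 1"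
  using uncovered_approx_bounds[of l "{e \<in> E. f e}" k W v] by (simp_all add: perc_x_def)

lemma perc_s_nonneg: "l > 0 \<Longrightarrow> 0 \<le> perc_s l E k f W v"
  unfolding perc_s_def by (intro sum_nonneg mult_nonneg_nonneg) (auto intro: less_imp_le perc_x_bounds)

text \<open>A message computed outside \<open>W\<close> reads only edges disjoint from
  \<open>W\<close>. Messages sent to \<open>v\<close> are computed with \<open>v\<close> deleted,
  hence they are independent of the edges at \<open>v\<close>.\<close>

lemma perc_x_cong:
  assumes "two_uniform E"
  shows "v \<notin> W \<Longrightarrow> (\<And>e. e \<in> E \<Longrightarrow> e \<inter> W = {} \<Longrightarrow> f e = g e) \<Longrightarrow> perc_x l E k f W v = perc_x l E k g W v"
proof (induction k arbitrary: W v)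
  case 0
  then show ?case by (simp add: perc_x_0)
next
  case (Suc k)
  have fin: "finite E" using assms by (simp add: two_uniform_def)
  have "perc_s l E k f W v = perc_s l E k g W v"
    unfolding perc_s_def
  proof (rule sum.cong[OF refl])
    fix u assume u: "u \<in> free_nbrs E W v"
    then have "u \<noteq> v" using two_uniform_not_loop[OF assms] by (auto simp: free_nbrs_def)
    then have "perc_x l E k f (insert v W) u = perc_x l E k g (insert v W) u"
      using u Suc.prems by (intro Suc.IH) (auto simp: free_nbrs_def)
    moreover have "f {v, u} = g {v, u}" using u Suc.prems by (auto simp: free_nbrs_def)
    ultimately show "of_bool (f {v, u}) * perc_x l E k f (insert v W) u = of_bool (g {v, u}) * perc_x l E k g (insert v W) u" by simp
  qed
  then show ?case by (simp add: perc_x_Suc[OF fin])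
qed

lemma perc_x_upd:
  assumes "two_uniform E" "v \<notin> W" "e \<inter> W \<noteq> {}"
  shows "perc_x l E k (f(e := b)) W v = perc_x l E k f W v"
  by (rule perc_x_cong[OF assms(1,2)]) (use assms(3) in auto)

text \<open>Deleting one further vertex changes a depth-\<open>k\<close> message in mean by at most
  this constant times \<open>c / d\<close>. The summand 1 accounts for a lost edge, the other one
  for the change passed on by about \<open>c\<close> retained neighbours; \<open>l\<close> is the
  Lipschitz constant of a step.\<close>

primrec perturb_const :: "real \<Rightarrow> real \<Rightarrow> nat \<Rightarrow> real" where
  "perturb_const l c 0 = 0"
| "perturb_const l c (Suc k) = l * (1 + c * perturb_const l c k)"

lemma perturb_const_nonneg: "l > 0 \<Longrightarrow> c > 0 \<Longrightarrow> 0 \<le> perturb_const l c k"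
  by (induction k) auto

lemma inverse_lipschitz:
  fixes a b l :: real
  assumes "0 \<le> a" "0 \<le> b" "l > 0"
  shows "\<bar>1 / (1 + l * a) - 1 / (1 + l * b)\<bar> \<le> l * \<bar>a - b\<bar>"
proof -
  have p: "0 \<le> l * a" "0 \<le> l * b" using assms by auto
  have "1 / (1 + l * a) - 1 / (1 + l * b) = l * (b - a) / ((1 + l * a) * (1 + l * b))"
    using p by (simp add: divide_simps) (simp add: algebra_simps)
  then have "\<bar>1 / (1 + l * a) - 1 / (1 + l * b)\<bar> = l * \<bar>a - b\<bar> / ((1 + l * a) * (1 + l * b))"
    using p assms by (simp add: abs_mult abs_minus_commute)
  also have "\<dots> \<le> l * \<bar>a - b\<bar> / 1"
    using p assms mult_mono[of 1 "1 + l * a" 1 "1 + l * b"] by (intro divide_left_mono) auto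
  finally show ?thesis by simp
qed

text \<open>The bound for messages enters as a hypothesis, so that the lemma is both the induction
  step of \<open>perc_perturb_x\<close> and, combined with it, the final estimate for
  \<open>perc_s\<close>.\<close>

lemma perc_perturb_s:
  fixes E :: "'a set set"
  assumes reg: "regular_graph d V E" and l: "l > 0" and c: "c > 0" and d: "c \<le> real d" "d > 0"
    and IH: "\<And>W z v. v \<in> V \<Longrightarrow> v \<notin> W \<Longrightarrow> z \<noteq> v \<Longrightarrow> finite W \<Longrightarrow>
        measure_pmf.expectation (edge_pmf E (c / d)) (\<lambda>f. \<bar>perc_x l E k f W v - perc_x l E k f (insert z W) v\<bar>) \<le> perturb_const l c k * (c / d)"
    and v: "v \<in> V" "v \<notin> W" "z \<noteq> v" "finite W"
  shows "measure_pmf.expectation (edge_pmf E (c / d)) (\<lambda>f. \<bar>perc_s l E k f W v - perc_s l E k f (insert z W) v\<bar>) \<le> (1 + c * perturb_const l c k) * (c / d)"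
proof -
  let ?p = "c / real d"
  let ?E = "measure_pmf.expectation (edge_pmf E ?p)"
  have p: "0 \<le> ?p" "?p \<le> 1" using c d by auto
  have E: "two_uniform E" "finite E" using regular_graph_two_uniform[OF reg] regular_graph_finite(2)[OF reg] by auto
  let ?F = "free_nbrs E W v"
  have finF: "finite ?F" by (rule finite_free_nbrs[OF E(2)])
  have F': "free_nbrs E (insert z W) v = ?F - {z}" by (auto simp: free_nbrs_def)
  let ?D = "\<lambda>u f. \<bar>perc_x l E k f (insert v W) u - perc_x l E k f (insert z (insert v W)) u\<bar>"
  have point: "\<bar>perc_s l E k f W v - perc_s l E k f (insert z W) v\<bar> \<le>
     of_bool (z \<in> ?F) * of_bool (f {v, z}) + (\<Sum>u\<in>?F - {z}. of_bool (f {v, u}) * ?D u f)" for f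
  proof -
    let ?g = "\<lambda>u. of_bool (f {v, u}) * perc_x l E k f (insert v W) u"
    have "perc_s l E k f W v = (if z \<in> ?F then ?g z else 0) + (\<Sum>u\<in>?F - {z}. ?g u)"
    proof (cases "z \<in> ?F")
      case True
      then show ?thesis unfolding perc_s_def using finF by (simp only: sum.remove if_True)
    next
      case False
      then have "?F - {z} = ?F" by auto
      then show ?thesis unfolding perc_s_def using False by (simp only: if_False add_0)
    qed
    moreover have "perc_s l E k f (insert z W) v = (\<Sum>u\<in>?F - {z}. of_bool (f {v, u}) * perc_x l E k f (insert z (insert v W)) u)"
      unfolding perc_s_def F' by (simp add: insert_commute)
    ultimately have "perc_s l E k f W v - perc_s l E k f (insert z W) v = (if z \<in> ?F then ?g z else 0) +
        (\<Sum>u\<in>?F - {z}. of_bool (f {v, u}) * (perc_x l E k f (insert v W) u - perc_x l E k f (insert z (insert v W)) u))"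
      by (simp add: sum_subtractf right_diff_distrib)
    also have "\<bar>\<dots>\<bar> \<le> \<bar>if z \<in> ?F then ?g z else 0\<bar> + \<bar>\<Sum>u\<in>?F - {z}. of_bool (f {v, u}) * (perc_x l E k f (insert v W) u - perc_x l E k f (insert z (insert v W)) u)\<bar>"
      by (rule abs_triangle_ineq)
    also have "\<bar>if z \<in> ?F then ?g z else 0\<bar> \<le> of_bool (z \<in> ?F) * of_bool (f {v, z})"
      using perc_x_bounds[OF l, of E k f "insert v W" z] by auto
    also have "\<bar>\<Sum>u\<in>?F - {z}. of_bool (f {v, u}) * (perc_x l E k f (insert v W) u - perc_x l E k f (insert z (insert v W)) u)\<bar>
       \<le> (\<Sum>u\<in>?F - {z}. of_bool (f {v, u}) * ?D u f)"
      by (rule order_trans[OF sum_abs]) (simp add: abs_mult)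
    finally show ?thesis by simp
  qed
  have "?E (\<lambda>f. \<bar>perc_s l E k f W v - perc_s l E k f (insert z W) v\<bar>) \<le> ?E (\<lambda>f. of_bool (z \<in> ?F) * of_bool (f {v, z}) + (\<Sum>u\<in>?F - {z}. of_bool (f {v, u}) * ?D u f))"
    using point E(2) by (intro integral_mono) auto
  also have "\<dots> = ?E (\<lambda>f. of_bool (z \<in> ?F) * of_bool (f {v, z})) + (\<Sum>u\<in>?F - {z}. ?E (\<lambda>f. of_bool (f {v, u}) * ?D u f))"
    using E(2) by simp
  also have "?E (\<lambda>f. of_bool (z \<in> ?F) * of_bool (f {v, z})) \<le> ?p"
  proof (cases "z \<in> ?F")
    case True
    then have "{v, z} \<in> E" by (simp add: free_nbrs_def)
    then show ?thesis using True expectation_edge_indicator[OF E(2) _ p, of "{v, z}" "\<lambda>_. 1"] by simp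
  qed (use p in simp)
  \<comment> \<open>Each of at most \<open>d\<close> neighbours is joined with probability
    \<open>c / d\<close>, independently of the change in its message.\<close>
  also have "(\<Sum>u\<in>?F - {z}. ?E (\<lambda>f. of_bool (f {v, u}) * ?D u f)) \<le> (\<Sum>u\<in>?F - {z}. ?p * (perturb_const l c k * ?p))"
  proof (rule sum_mono)
    fix u assume u: "u \<in> ?F - {z}"
    then have uV: "u \<in> V" "u \<noteq> v" "u \<notin> W" "u \<noteq> z" using free_nbrs_in_V[OF reg] by auto
    have edge: "{v, u} \<in> E" using u by (simp add: free_nbrs_def)
    have "?E (\<lambda>f. of_bool (f {v, u}) * ?D u f) = ?p * ?E (?D u)"
      using uV by (intro expectation_edge_indicator[OF E(2) edge p]) (simp add: perc_x_upd[OF E(1)])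
    also have "\<dots> \<le> ?p * (perturb_const l c k * ?p)"
      using uV v p by (intro mult_left_mono IH) auto
    finally show "?E (\<lambda>f. of_bool (f {v, u}) * ?D u f) \<le> ?p * (perturb_const l c k * ?p)" .
  qed
  also have "\<dots> \<le> real d * (?p * (perturb_const l c k * ?p))"
  proof -
    have "card (?F - {z}) \<le> d" using card_free_nbrs(1)[OF reg v(1,4)] card_mono[OF finF, of "?F - {z}"] by auto
    moreover have "0 \<le> ?p * (perturb_const l c k * ?p)" using p(1) perturb_const_nonneg[OF l c, of k] by (intro mult_nonneg_nonneg)
    ultimately show ?thesis unfolding sum_constant by (intro mult_right_mono) auto
  qed
  also have "\<dots> = c * perturb_const l c k * ?p" using d by simp
  finally show ?thesis by (simp add: algebra_simps add_divide_distrib)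
qed

lemma perc_perturb_x:
  fixes E :: "'a set set"
  assumes reg: "regular_graph d V E" and l: "l > 0" and c: "c > 0" and d: "c \<le> real d" "d > 0"
  shows "v \<in> V \<Longrightarrow> v \<notin> W \<Longrightarrow> z \<noteq> v \<Longrightarrow> finite W \<Longrightarrow>
        measure_pmf.expectation (edge_pmf E (c / d)) (\<lambda>f. \<bar>perc_x l E k f W v - perc_x l E k f (insert z W) v\<bar>) \<le> perturb_const l c k * (c / d)"
proof (induction k arbitrary: W z v)
  case 0
  then show ?case by (simp add: perc_x_0)
next
  case (Suc k)
  have fin: "finite E" using reg regular_graph_finite(2) by blast
  let ?E = "measure_pmf.expectation (edge_pmf E (c / d))"
  have "?E (\<lambda>f. \<bar>perc_x l E (Suc k) f W v - perc_x l E (Suc k) f (insert z W) v\<bar>) \<le> ?E (\<lambda>f. l * \<bar>perc_s l E k f W v - perc_s l E k f (insert z W) v\<bar>)"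
    using fin inverse_lipschitz[OF perc_s_nonneg[OF l] perc_s_nonneg[OF l] l] by (intro integral_mono) (auto simp: perc_x_Suc)
  also have "\<dots> \<le> l * ((1 + c * perturb_const l c k) * (c / d))"
    using mult_left_mono[OF perc_perturb_s[OF reg l c d Suc.IH Suc.prems] less_imp_le[OF l]] by simp
  finally show ?case by simp
qed

section \<open>Laplace transforms of message sums\<close>

lemma exp_neg_lipschitz:
  fixes a b :: real
  assumes "0 \<le> a" "0 \<le> b"
  shows "\<bar>exp (- a) - exp (- b)\<bar> \<le> \<bar>a - b\<bar>"
proof -
  have *: "exp (- x) - exp (- y) \<le> y - x" "exp (- y) \<le> exp (- x)" if "0 \<le> x" "x \<le> y" for x y :: real
    using exp_diff_le[of 1 x y] that by auto
  show ?thesis using *[of a b] *[of b a] assms by (cases "a \<le> b") auto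
qed

lemma one_minus_exp_bound:
  fixes z :: real
  assumes "0 \<le> z"
  shows "\<bar>(1 - z) - exp (- z)\<bar> \<le> z\<^sup>2"
proof -
  have "1 - z \<le> exp (- z)" using exp_ge_add_one_self[of "- z"] by simp
  moreover have "exp (- z) \<le> 1 - z + z\<^sup>2"
  proof (cases "z \<le> 1")
    case True
    have "(1 + z) * exp (- z) \<le> 1"
    proof -
      have "(1 + z) * exp (- z) \<le> exp z * exp (- z)" using exp_ge_add_one_self[of z] by (intro mult_right_mono) auto
      then show ?thesis by (simp add: exp_add[symmetric])
    qed
    then have "exp (- z) \<le> 1 / (1 + z)" using assms by (simp add: field_simps)
    also have "\<dots> \<le> 1 - z + z\<^sup>2"
    proof -
      have "(1 - z + z\<^sup>2) * (1 + z) = 1 + z ^ 3" by (simp add: algebra_simps power2_eq_square power3_eq_cube)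
      then have "1 \<le> (1 - z + z\<^sup>2) * (1 + z)" using assms by simp
      then show ?thesis using assms by (simp add: pos_divide_le_eq)
    qed
    finally show ?thesis .
  next
    case False
    have "exp (- z) \<le> 1" using assms by simp
    also have "1 \<le> 1 + z * (z - 1)" using False by simp
    finally show ?thesis by (simp add: algebra_simps power2_eq_square)
  qed
  ultimately show ?thesis by (simp add: abs_le_iff)
qed


lemma laplace_edge_pmf_inj:
  fixes a :: "('e \<Rightarrow> bool) \<Rightarrow> 't \<Rightarrow> real"
  assumes "finite E" "inj_on g T" "g ` T \<subseteq> E" "0 \<le> p" "p \<le> 1"
    and a: "\<And>f t t' b. t \<in> T \<Longrightarrow> t' \<in> T \<Longrightarrow> a (f(g t := b)) t' = a f t'"
  shows "measure_pmf.expectation (edge_pmf E p) (\<lambda>f. \<Prod>t\<in>T. exp (- (of_bool (f (g t)) * a f t))) =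
    measure_pmf.expectation (edge_pmf E p) (\<lambda>f. \<Prod>t\<in>T. 1 - p * (1 - exp (- a f t)))"
proof -
  have inv: "inv_into T g (g t) = t" if "t \<in> T" for t using that assms(2) by simp
  have "measure_pmf.expectation (edge_pmf E p) (\<lambda>f. \<Prod>e\<in>g ` T. exp (- (of_bool (f e) * a f (inv_into T g e)))) =
    measure_pmf.expectation (edge_pmf E p) (\<lambda>f. \<Prod>e\<in>g ` T. 1 - p * (1 - exp (- a f (inv_into T g e))))"
    by (rule laplace_edge_pmf[OF assms(1,3-5)]) (auto simp: inv a)
  then show ?thesis using assms(2) by (simp add: prod.reindex inv cong: prod.cong)
qed

text \<open>The roots in \<open>R\<close> see disjoint sets of edges, and the messages they receive do not use these edges.\<close>

lemma laplace_roots: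
  fixes E :: "'a set set" and j k d :: nat
  assumes reg: "regular_graph d V E" and l: "l > 0" and c: "c > 0" and d: "c \<le> real d" "d > 0"
    and R: "R \<subseteq> V" "R \<subseteq> W" "finite W" and m: "m \<ge> 0"
  defines "a \<equiv> \<lambda>x f. (\<Sum>w\<in>free_nbrs E W x. 1 - exp (- (real j * perc_x l E k f W w))) / real d"
  shows "\<bar>measure_pmf.expectation (edge_pmf E (c / d))
       (\<lambda>f. \<Prod>x\<in>R. exp (- (real j * (\<Sum>w\<in>free_nbrs E W x. of_bool (f {x, w}) * perc_x l E k f W w)))) - exp (- (c * (real (card R) * m)))\<bar>
     \<le> real (card R) * (c\<^sup>2 / d) + c * (\<Sum>x\<in>R. measure_pmf.expectation (edge_pmf E (c / d)) (\<lambda>f. \<bar>a x f - m\<bar>))"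
proof -
  let ?p = "c / real d"
  let ?E = "measure_pmf.expectation (edge_pmf E ?p)"
  let ?X = "\<lambda>f. perc_x l E k f W"
  have p: "0 \<le> ?p" "?p \<le> 1" using c d by auto
  have E: "two_uniform E" "finite E" using regular_graph_two_uniform[OF reg] regular_graph_finite(2)[OF reg] by auto
  have finR: "finite R" using R finite_subset by blast
  have finF: "finite (free_nbrs E W x)" for x by (rule finite_free_nbrs[OF E(2)])
  define T where "T = Sigma R (free_nbrs E W)"
  define g where "g = (\<lambda>t :: 'a \<times> 'a. {fst t, snd t})"
  have finT: "finite T" unfolding T_def using finR finF by (intro finite_SigmaI) auto
  have T: "fst t \<in> R" "fst t \<in> W" "snd t \<notin> W" "g t \<in> E" if "t \<in> T" for t
    using that R by (auto simp: T_def g_def free_nbrs_def)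
  \<comment> \<open>The root of a pair lies in \<open>W\<close> and its neighbour does not, so the
    unordered edge determines the pair.\<close>
  have inj: "inj_on g T"
    unfolding inj_on_def g_def using T by (auto simp: doubleton_eq_iff prod_eq_iff) (metis T)+
  have cardT: "card T \<le> card R * d"
  proof -
    have "card T = (\<Sum>x\<in>R. card (free_nbrs E W x))" unfolding T_def using finR finF by (intro card_SigmaI) auto
    also have "\<dots> \<le> (\<Sum>x\<in>R. d)" using R by (intro sum_mono card_free_nbrs(1)[OF reg]) auto
    finally show ?thesis by simp
  qed
  define b where "b f t = 1 - exp (- (real j * ?X f (snd t)))" for f and t :: "'a \<times> 'a"
  have b01: "0 \<le> b f t" "b f t \<le> 1" for f t
    using perc_x_bounds(1)[OF l, of E k f W "snd t"] by (auto simp: b_def)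
  have sumT: "(\<Sum>t\<in>T. b f t) = real d * (\<Sum>x\<in>R. a x f)" for f
  proof -
    have "(\<Sum>t\<in>T. b f t) = (\<Sum>x\<in>R. \<Sum>w\<in>free_nbrs E W x. b f (x, w))"
      unfolding T_def using finR finF by (subst sum.Sigma) auto
    also have "\<dots> = (\<Sum>x\<in>R. real d * a x f)" using d by (simp add: a_def b_def)
    finally show ?thesis by (simp add: sum_distrib_left)
  qed
  have "?E (\<lambda>f. \<Prod>x\<in>R. exp (- (real j * (\<Sum>w\<in>free_nbrs E W x. of_bool (f {x, w}) * ?X f w)))) =
    ?E (\<lambda>f. \<Prod>t\<in>T. exp (- (of_bool (f (g t)) * (real j * ?X f (snd t)))))"
  proof (rule Bochner_Integration.integral_cong[OF refl])
    fix f
    have "(\<Prod>t\<in>T. exp (- (of_bool (f (g t)) * (real j * ?X f (snd t))))) =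
       (\<Prod>x\<in>R. \<Prod>w\<in>free_nbrs E W x. exp (- (of_bool (f {x, w}) * (real j * ?X f w))))"
      unfolding T_def using finR finF by (subst prod.Sigma) (auto simp: g_def intro!: prod.cong)
    also have "\<dots> = (\<Prod>x\<in>R. exp (- (real j * (\<Sum>w\<in>free_nbrs E W x. of_bool (f {x, w}) * ?X f w))))"
    proof (rule prod.cong[OF refl])
      fix x
      have "(\<Sum>w\<in>free_nbrs E W x. - (of_bool (f {x, w}) * (real j * ?X f w))) = - (real j * (\<Sum>w\<in>free_nbrs E W x. of_bool (f {x, w}) * ?X f w))"
        by (simp only: sum_negf sum_distrib_left mult.left_commute)
      then show "(\<Prod>w\<in>free_nbrs E W x. exp (- (of_bool (f {x, w}) * (real j * ?X f w)))) = exp (- (real j * (\<Sum>w\<in>free_nbrs E W x. of_bool (f {x, w}) * ?X f w)))"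
        by (simp only: exp_sum[OF finF, symmetric])
    qed
    finally show "(\<Prod>x\<in>R. exp (- (real j * (\<Sum>w\<in>free_nbrs E W x. of_bool (f {x, w}) * ?X f w)))) = (\<Prod>t\<in>T. exp (- (of_bool (f (g t)) * (real j * ?X f (snd t)))))" ..
  qed
  also have "\<dots> = ?E (\<lambda>f. \<Prod>t\<in>T. 1 - ?p * b f t)"
    unfolding b_def
  proof (rule laplace_edge_pmf_inj[OF E(2) inj _ p])
    show "g ` T \<subseteq> E" using T by auto
    fix f t t' b assume "t \<in> T" "t' \<in> T"
    then show "real j * ?X (f(g t := b)) (snd t') = real j * ?X f (snd t')"
      using T[of t] T[of t'] by (subst perc_x_upd[OF E(1)]) (auto simp: g_def)
  qed
  finally have eq: "?E (\<lambda>f. \<Prod>x\<in>R. exp (- (real j * (\<Sum>w\<in>free_nbrs E W x. of_bool (f {x, w}) * ?X f w)))) = ?E (\<lambda>f. \<Prod>t\<in>T. 1 - ?p * b f t)" .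
  have point: "\<bar>(\<Prod>t\<in>T. 1 - ?p * b f t) - exp (- (c * (real (card R) * m)))\<bar> \<le> real (card R) * (c\<^sup>2 / d) + c * (\<Sum>x\<in>R. \<bar>a x f - m\<bar>)" for f
  proof -
    have pb: "0 \<le> ?p * b f t" "?p * b f t \<le> ?p" for t
      using mult_nonneg_nonneg[OF p(1) b01(1)[of f t]] mult_left_mono[OF b01(2)[of f t] p(1)] by (simp_all only: mult_1_right)
    have "\<bar>(\<Prod>t\<in>T. 1 - ?p * b f t) - (\<Prod>t\<in>T. exp (- (?p * b f t)))\<bar> \<le> (\<Sum>t\<in>T. \<bar>(1 - ?p * b f t) - exp (- (?p * b f t))\<bar>)"
    proof -
      have n1: "norm (1 - ?p * b f t) \<le> 1" for t
        using pb[of t] p unfolding real_norm_def abs_le_iff by linarith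
      have n2: "norm (exp (- (?p * b f t))) \<le> 1" for t
        using pb(1)[of t] by (simp only: real_norm_def abs_exp_cancel exp_le_one_iff neg_le_0_iff_le)
      show ?thesis using norm_prod_diff[of T, OF n1 n2] by (simp only: real_norm_def)
    qed
    also have "\<dots> \<le> (\<Sum>t\<in>T. ?p\<^sup>2)"
    proof (rule sum_mono)
      fix t
      have "\<bar>(1 - ?p * b f t) - exp (- (?p * b f t))\<bar> \<le> (?p * b f t)\<^sup>2" by (rule one_minus_exp_bound) (rule pb)
      also have "\<dots> \<le> ?p\<^sup>2" using pb by (intro power_mono) auto
      finally show "\<bar>(1 - ?p * b f t) - exp (- (?p * b f t))\<bar> \<le> ?p\<^sup>2" .
    qed
    \<comment> \<open>At most \<open>card R * d\<close> factors, each replaced by an exponential at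
      cost \<open>(c / d)\<^sup>2\<close>, give a total of order 1/d.\<close>
    also have "\<dots> \<le> real (card R * d) * ?p\<^sup>2"
      unfolding sum_constant using cardT by (intro mult_right_mono of_nat_mono) auto
    also have "\<dots> = real (card R) * (c\<^sup>2 / d)" using d by (simp add: power2_eq_square)
    also have "(\<Prod>t\<in>T. exp (- (?p * b f t))) = exp (- (c * (\<Sum>x\<in>R. a x f)))"
      using finT d by (simp add: exp_sum[symmetric] sum_negf sum_divide_distrib[symmetric] sum_distrib_left[symmetric] sumT)
    finally have 1: "\<bar>(\<Prod>t\<in>T. 1 - ?p * b f t) - exp (- (c * (\<Sum>x\<in>R. a x f)))\<bar> \<le> real (card R) * (c\<^sup>2 / d)" .
    have "0 \<le> a x f" for x using b01[of f "(x, _)"] by (auto simp: a_def b_def intro!: divide_nonneg_nonneg sum_nonneg)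
    then have "\<bar>exp (- (c * (\<Sum>x\<in>R. a x f))) - exp (- (c * (real (card R) * m)))\<bar> \<le> \<bar>c * (\<Sum>x\<in>R. a x f) - c * (real (card R) * m)\<bar>"
      using c m by (intro exp_neg_lipschitz mult_nonneg_nonneg sum_nonneg) auto
    also have "\<dots> = c * \<bar>\<Sum>x\<in>R. a x f - m\<bar>" using c by (simp add: sum_subtractf abs_mult right_diff_distrib[symmetric])
    also have "\<dots> \<le> c * (\<Sum>x\<in>R. \<bar>a x f - m\<bar>)" using c by (intro mult_left_mono sum_abs) auto
    finally show ?thesis using 1 by linarith
  qed
  have "\<bar>?E (\<lambda>f. \<Prod>t\<in>T. 1 - ?p * b f t) - exp (- (c * (real (card R) * m)))\<bar> = \<bar>?E (\<lambda>f. (\<Prod>t\<in>T. 1 - ?p * b f t) - exp (- (c * (real (card R) * m))))\<bar>"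
    using E(2) by simp
  also have "\<dots> \<le> ?E (\<lambda>f. \<bar>(\<Prod>t\<in>T. 1 - ?p * b f t) - exp (- (c * (real (card R) * m)))\<bar>)" by (rule integral_abs_bound)
  also have "\<dots> \<le> ?E (\<lambda>f. real (card R) * (c\<^sup>2 / d) + c * (\<Sum>x\<in>R. \<bar>a x f - m\<bar>))"
    using E(2) point by (intro integral_mono) auto
  also have "\<dots> = real (card R) * (c\<^sup>2 / d) + c * (\<Sum>x\<in>R. ?E (\<lambda>f. \<bar>a x f - m\<bar>))"
    using E(2) by simp
  finally show ?thesis unfolding eq .
qed

text \<open>The substitution \<open>w = exp (- s)\<close> compactifies the half-line:
  \<open>1 / (1 + l * s)\<close> becomes \<open>1 / (1 - l * ln w)\<close>, and \<open>w = 0\<close>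
  stands for \<open>s\<close> = infinity.\<close>

lemma message_continuous:
  fixes \<psi> :: "real \<Rightarrow> real"
  assumes "continuous_on {0..1} \<psi>" "l > 0"
  shows "continuous_on {0..1} (\<lambda>w. \<psi> (if w = 0 then 0 else 1 / (1 - l * ln w)))"
proof (rule continuous_on_compose2[OF assms(1)])
  let ?g = "\<lambda>w :: real. if w = 0 then 0 else 1 / (1 - l * ln w)"
  have den: "1 \<le> 1 - l * ln w" if "w \<in> {0<..1}" for w
    using that assms(2) by (simp add: mult_le_0_iff)
  show "?g ` {0..1} \<subseteq> {0..1}"
  proof
    fix y assume "y \<in> ?g ` {0..1}"
    then obtain w where w: "w \<in> {0..1}" "y = ?g w" by blast
    show "y \<in> {0..1}"
    proof (cases "w = 0")
      case False
      then have "1 \<le> 1 - l * ln w" using den[of w] w(1) by simp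
      then have "0 \<le> 1 / (1 - l * ln w)" "1 / (1 - l * ln w) \<le> 1" by (simp_all add: divide_le_eq_1)
      then show ?thesis using False w(2) by simp
    qed (use w in simp)
  qed
  show "continuous_on {0..1} ?g"
    unfolding continuous_on_eq_continuous_within
  proof
    fix x :: real assume x: "x \<in> {0..1}"
    show "continuous (at x within {0..1}) ?g"
    proof (cases "x = 0")
      case True
      have "((\<lambda>w. 1 / (1 - l * ln w)) \<longlongrightarrow> 0) (at_right 0)"
        using assms(2) by real_asymp
      then have "(?g \<longlongrightarrow> 0) (at_right 0)"
        by (rule Lim_transform_eventually) (auto simp: eventually_at_right_less intro!: eventually_mono[OF eventually_at_right_less])
      then have "(?g \<longlongrightarrow> ?g 0) (at 0 within {0..1})"
        using at_within_Icc_at_right[of 0 "1::real"] by simp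
      then show ?thesis using True by (simp add: continuous_within)
    next
      case False
      then have pos: "x > 0" using x by simp
      have "isCont (\<lambda>w. 1 / (1 - l * ln w)) x"
        using pos den[of x] x by (intro continuous_intros) auto
      moreover have "\<forall>\<^sub>F w in nhds x. 1 / (1 - l * ln w) = ?g w"
        using eventually_nhds_in_open[of "{0<..}" x] pos by (auto elim!: eventually_mono)
      ultimately have "isCont ?g x" by (simp cong: isCont_cong)
      then show ?thesis by (rule continuous_at_imp_continuous_at_within)
    qed
  qed
qed

text \<open>Weierstrass approximation in \<open>w = exp (- s)\<close>. The approximation is uniform
  on the whole half-line, so Laplace transforms at integers determine the limits of all continuous
  test functions.\<close>

lemma message_approx:
  fixes \<psi> :: "real \<Rightarrow> real"
  assumes "continuous_on {0..1} \<psi>" "l > 0" "\<epsilon> > 0"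
  obtains n and a :: "nat \<Rightarrow> real" where "\<And>s. s \<ge> 0 \<Longrightarrow> \<bar>\<psi> (1 / (1 + l * s)) - (\<Sum>i\<le>n. a i * exp (- (real i * s)))\<bar> \<le> \<epsilon>"
proof -
  let ?G = "\<lambda>w. \<psi> (if w = 0 then 0 else 1 / (1 - l * ln w))"
  obtain q where q: "real_polynomial_function q" "\<And>w. w \<in> {0..1} \<Longrightarrow> \<bar>?G w - q w\<bar> < \<epsilon>"
    using Stone_Weierstrass_real_polynomial_function[OF compact_Icc message_continuous[OF assms(1,2)] assms(3)] by auto
  obtain a n where an: "q = (\<lambda>x. \<Sum>i\<le>n. a i * x ^ i)" using real_polynomial_function_imp_sum[OF q(1)] by auto
  have "\<bar>\<psi> (1 / (1 + l * s)) - (\<Sum>i\<le>n. a i * exp (- (real i * s)))\<bar> \<le> \<epsilon>" if "s \<ge> 0" for s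
  proof -
    have "exp (- s) \<in> {0..1}" using that by simp
    from q(2)[OF this] show ?thesis
      by (simp add: an exp_of_nat_mult[symmetric] mult.commute less_imp_le)
  qed
  then show ?thesis using that by blast
qed

section \<open>The local limit\<close>

lemma expectation_abs_le_sqrt:
  fixes X :: "('e \<Rightarrow> bool) \<Rightarrow> real"
  assumes "finite E" "measure_pmf.expectation (edge_pmf E p) (\<lambda>f. (X f)\<^sup>2) \<le> B"
  shows "measure_pmf.expectation (edge_pmf E p) (\<lambda>f. \<bar>X f\<bar>) \<le> sqrt B"
proof (rule real_le_rsqrt)
  have "0 \<le> measure_pmf.variance (edge_pmf E p) (\<lambda>f. \<bar>X f\<bar>)" by simp
  also have "\<dots> = measure_pmf.expectation (edge_pmf E p) (\<lambda>f. \<bar>X f\<bar>\<^sup>2) - (measure_pmf.expectation (edge_pmf E p) (\<lambda>f. \<bar>X f\<bar>))\<^sup>2"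
    using assms(1) by (intro measure_pmf.variance_eq) auto
  finally show "(measure_pmf.expectation (edge_pmf E p) (\<lambda>f. \<bar>X f\<bar>))\<^sup>2 \<le> B" using assms(2) by simp
qed

text \<open>Chebyshev's argument: asymptotic pairwise uncorrelatedness suffices, as the diagonal
  contributes only 1/d. The sum is divided by \<open>d\<close> although up to \<open>m\<close> terms
  may be missing, whence the \<open>m\<close> in the bound.\<close>

lemma weak_law:
  fixes a :: "'u \<Rightarrow> ('e \<Rightarrow> bool) \<Rightarrow> real" and d m :: nat
  assumes E: "finite E" and F: "finite F" "card F \<le> d" "d \<le> card F + m" "d > 0"
    and a: "\<And>u f. u \<in> F \<Longrightarrow> 0 \<le> a u f" "\<And>u f. u \<in> F \<Longrightarrow> a u f \<le> 1" and L: "0 \<le> L" "L \<le> 1" and \<epsilon>: "\<epsilon> \<ge> 0"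
    and single: "\<And>u. u \<in> F \<Longrightarrow> \<bar>measure_pmf.expectation (edge_pmf E p) (a u) - L\<bar> \<le> \<epsilon>"
    and pair: "\<And>u u'. u \<in> F \<Longrightarrow> u' \<in> F \<Longrightarrow> u \<noteq> u' \<Longrightarrow> \<bar>measure_pmf.expectation (edge_pmf E p) (\<lambda>f. a u f * a u' f) - L\<^sup>2\<bar> \<le> \<epsilon>"
  shows "measure_pmf.expectation (edge_pmf E p) (\<lambda>f. \<bar>(\<Sum>u\<in>F. a u f) / real d - L\<bar>) \<le> sqrt (3 * \<epsilon> + (1 + 2 * real m) / real d)"
proof (rule expectation_abs_le_sqrt[OF E])
  let ?E = "measure_pmf.expectation (edge_pmf E p)"
  have int: "integrable (measure_pmf (edge_pmf E p)) g" for g :: "_ \<Rightarrow> real" using E by simp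
  have sq: "?E (\<lambda>f. (\<Sum>u\<in>F. a u f)\<^sup>2) \<le> real d + (real d)\<^sup>2 * (L\<^sup>2 + \<epsilon>)"
  proof -
    have "?E (\<lambda>f. (\<Sum>u\<in>F. a u f)\<^sup>2) = (\<Sum>u\<in>F. \<Sum>u'\<in>F. ?E (\<lambda>f. a u f * a u' f))"
      using int by (simp add: power2_eq_square sum_product)
    also have "\<dots> \<le> (\<Sum>u\<in>F. \<Sum>u'\<in>F. of_bool (u = u') + (L\<^sup>2 + \<epsilon>))"
    proof (intro sum_mono)
      fix u u' assume u: "u \<in> F" "u' \<in> F"
      show "?E (\<lambda>f. a u f * a u' f) \<le> of_bool (u = u') + (L\<^sup>2 + \<epsilon>)"
      proof (cases "u = u'")
        case True
        have "?E (\<lambda>f. a u f * a u' f) \<le> 1" using u a by (intro expectation_bounds_pmf(2)[where a = 0]) (auto intro: mult_le_one)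
        then show ?thesis using True \<epsilon> by (simp add: add_increasing2)
      next
        case False
        then show ?thesis using pair[OF u False] by simp
      qed
    qed
    also have "\<dots> = real (card F) + real (card F) * real (card F) * (L\<^sup>2 + \<epsilon>)"
      using F(1) by (simp add: sum.distrib algebra_simps)
    also have "\<dots> \<le> real d + real d * real d * (L\<^sup>2 + \<epsilon>)"
      using F(2) \<epsilon> by (intro add_mono mult_mono) auto
    finally show ?thesis by (simp add: power2_eq_square)
  qed
  have lin: "real d * (L - \<epsilon>) - real m \<le> ?E (\<lambda>f. \<Sum>u\<in>F. a u f)"
  proof -
    have "(real d - real m) * L \<le> real (card F) * L" using F(3) L by (intro mult_right_mono) auto
    moreover have "real m * L \<le> real m * 1" using L by (intro mult_left_mono) auto
    moreover have "real (card F) * \<epsilon> \<le> real d * \<epsilon>" using F(2) \<epsilon> by (intro mult_right_mono) auto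
    ultimately have "real d * (L - \<epsilon>) - real m \<le> real (card F) * (L - \<epsilon>)" by (simp add: algebra_simps)
    also have "\<dots> = (\<Sum>u\<in>F. L - \<epsilon>)" by simp
    also have "\<dots> \<le> (\<Sum>u\<in>F. ?E (a u))" using single by (intro sum_mono) (simp add: abs_le_iff, smt (verit))
    also have "\<dots> = ?E (\<lambda>f. \<Sum>u\<in>F. a u f)" using int by simp
    finally show ?thesis .
  qed
  have "?E (\<lambda>f. ((\<Sum>u\<in>F. a u f) / real d - L)\<^sup>2) = ?E (\<lambda>f. (\<Sum>u\<in>F. a u f)\<^sup>2 / (real d)\<^sup>2 - 2 * L / real d * (\<Sum>u\<in>F. a u f) + L\<^sup>2)"
    by (intro Bochner_Integration.integral_cong) (simp_all add: power2_diff power_divide)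
  also have "\<dots> = ?E (\<lambda>f. (\<Sum>u\<in>F. a u f)\<^sup>2) / (real d)\<^sup>2 - 2 * L / real d * ?E (\<lambda>f. \<Sum>u\<in>F. a u f) + L\<^sup>2"
    using int by simp
  also have "\<dots> \<le> (real d + (real d)\<^sup>2 * (L\<^sup>2 + \<epsilon>)) / (real d)\<^sup>2 - 2 * L / real d * (real d * (L - \<epsilon>) - real m) + L\<^sup>2"
    using sq lin L F(4) by (intro add_mono diff_mono divide_right_mono mult_left_mono) auto
  also have "\<dots> = (1 + 2 * L * real m) / real d + (1 + 2 * L) * \<epsilon>"
    using F(4) by (simp add: field_simps power2_eq_square)
  also have "\<dots> \<le> (1 + 2 * real m) / real d + 3 * \<epsilon>"
    using L \<epsilon> F(4) mult_right_mono[of L 1 "real m"] by (intro add_mono divide_right_mono mult_right_mono) auto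
  finally show "?E (\<lambda>f. ((\<Sum>u\<in>F. a u f) / real d - L)\<^sup>2) \<le> 3 * \<epsilon> + (1 + 2 * real m) / real d" by simp
qed

lemma expectation_gw_tree_laplace:
  assumes "c > 0" "l > 0"
  shows "measure_pmf.expectation (gw_tree c (Suc k)) (\<lambda>t. exp (- (real j * child_sum (tree_x l k) t))) =
    exp (- (c * measure_pmf.expectation (gw_tree c k) (\<lambda>t. 1 - exp (- (real j * tree_x l k t)))))"
proof -
  have prod: "exp (- (real j * (\<Sum>t\<leftarrow>ts. tree_x l k t))) = prod_list (map (\<lambda>t. exp (- (real j * tree_x l k t))) ts)" for ts
  proof (induction ts)
    case (Cons t ts)
    have "exp (- (real j * (\<Sum>t\<leftarrow>t # ts. tree_x l k t))) = exp (- (real j * tree_x l k t)) * exp (- (real j * (\<Sum>t\<leftarrow>ts. tree_x l k t)))"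
      by (simp add: exp_add[symmetric] distrib_left)
    then show ?case using Cons by simp
  qed simp
  have le1: "exp (- (real j * tree_x l k t)) \<le> 1" for t
    using tree_x_bounds(1)[OF assms(2), of k t] by simp
  have "measure_pmf.expectation (gw_tree c (Suc k)) (\<lambda>t. exp (- (real j * child_sum (tree_x l k) t))) =
     measure_pmf.expectation (iid_list c (gw_tree c k)) (\<lambda>ts. prod_list (map (\<lambda>t. exp (- (real j * tree_x l k t))) ts))"
    by (simp add: child_sum_def prod)
  also have "\<dots> = exp (- c * (1 - measure_pmf.expectation (gw_tree c k) (\<lambda>t. exp (- (real j * tree_x l k t)))))"
    using le1 by (intro expectation_prod_iid_list[OF assms(1)]) auto
  also have "1 - measure_pmf.expectation (gw_tree c k) (\<lambda>t. exp (- (real j * tree_x l k t))) =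
     measure_pmf.expectation (gw_tree c k) (\<lambda>t. 1 - exp (- (real j * tree_x l k t)))"
    using le1 by (subst Bochner_Integration.integral_diff) (auto intro!: integrable_pmf_bounded[of _ _ 1])
  finally show ?thesis by simp
qed

locale percolated_sequence =
  fixes c l :: real and V :: "nat \<Rightarrow> 'a set" and E :: "nat \<Rightarrow> 'a set set"
  assumes c: "c > 0" and l: "l > 0" and reg: "\<And>d. regular_graph d (V d) (E d)"
begin

abbreviation ex :: "nat \<Rightarrow> (('a set \<Rightarrow> bool) \<Rightarrow> real) \<Rightarrow> real" where
  "ex d \<equiv> measure_pmf.expectation (edge_pmf (E d) (c / real d))"

abbreviation x :: "nat \<Rightarrow> nat \<Rightarrow> ('a set \<Rightarrow> bool) \<Rightarrow> 'a set \<Rightarrow> 'a \<Rightarrow> real" where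
  "x d \<equiv> perc_x l (E d)"

abbreviation s :: "nat \<Rightarrow> nat \<Rightarrow> ('a set \<Rightarrow> bool) \<Rightarrow> 'a set \<Rightarrow> 'a \<Rightarrow> real" where
  "s d \<equiv> perc_s l (E d)"

abbreviation nb :: "nat \<Rightarrow> 'a set \<Rightarrow> 'a \<Rightarrow> 'a set" where
  "nb d \<equiv> free_nbrs (E d)"

definition L :: "nat \<Rightarrow> nat \<Rightarrow> real" where
  "L k j = measure_pmf.expectation (gw_tree c (Suc k)) (\<lambda>t. exp (- (real j * child_sum (tree_x l k) t)))"

text \<open>The induction hypothesis for the local limit: neighbourhood averages converge in L1,
  uniformly over the root and over deleted sets of bounded size. Uniformity in \<open>W\<close> is
  essential, since the step adds one or two roots to \<open>W\<close>.\<close>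

definition nbr_avg_limit :: "nat \<Rightarrow> bool" where
  "nbr_avg_limit k \<longleftrightarrow> (\<forall>\<psi> m \<epsilon>. continuous_on {0..1} \<psi> \<longrightarrow> \<epsilon> > 0 \<longrightarrow>
     (\<forall>\<^sub>F d in sequentially. \<forall>v W. v \<in> V d \<longrightarrow> finite W \<longrightarrow> card W \<le> m \<longrightarrow>
        ex d (\<lambda>f. \<bar>(\<Sum>u\<in>nb d W v. \<psi> (x d k f W u)) / real d - measure_pmf.expectation (gw_tree c k) (\<lambda>t. \<psi> (tree_x l k t))\<bar>) \<le> \<epsilon>))"

lemma finE: "finite (E d)" using regular_graph_finite(2)[OF reg] .

lemma int: "integrable (measure_pmf (edge_pmf (E d) p)) (g :: _ \<Rightarrow> real)"
  using finE by simp

lemma eventually_large: "\<forall>\<^sub>F d in sequentially. c \<le> real d \<and> 0 < d \<and> K / real d \<le> \<epsilon>" if "\<epsilon> > 0" for K \<epsilon> :: real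
proof (intro eventually_conj)
  show "\<forall>\<^sub>F d in sequentially. c \<le> real d" by real_asymp
  show "\<forall>\<^sub>F d in sequentially. 0 < (d::nat)" by (rule eventually_gt_at_top)
  have "(\<lambda>d. K / real d) \<longlonglongrightarrow> 0" by real_asymp
  then show "\<forall>\<^sub>F d in sequentially. K / real d \<le> \<epsilon>"
    using order_tendstoD(2)[OF _ that] by (blast intro: eventually_mono less_imp_le)
qed

lemma L_bounds: "0 \<le> L k j" "L k j \<le> 1"
proof -
  have "0 \<le> real j * child_sum (tree_x l k) t" for t
    using tree_x_bounds(1)[OF l] by (intro mult_nonneg_nonneg child_sum_nonneg) (auto intro: less_imp_le)
  then show "0 \<le> L k j" "L k j \<le> 1" unfolding L_def by (auto intro!: expectation_bounds_pmf)
qed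

lemma nbr_avg_limit_0: "nbr_avg_limit 0"
  unfolding nbr_avg_limit_def
proof (intro allI impI)
  fix \<psi> :: "real \<Rightarrow> real" and m \<epsilon> assume \<epsilon>: "(\<epsilon> :: real) > 0"
  show "\<forall>\<^sub>F d in sequentially. \<forall>v W. v \<in> V d \<longrightarrow> finite W \<longrightarrow> card W \<le> m \<longrightarrow>
        ex d (\<lambda>f. \<bar>(\<Sum>u\<in>nb d W v. \<psi> (x d 0 f W u)) / real d - measure_pmf.expectation (gw_tree c 0) (\<lambda>t. \<psi> (tree_x l 0 t))\<bar>) \<le> \<epsilon>"
    using eventually_large[OF \<epsilon>, of "real m * \<bar>\<psi> 1\<bar>"]
  proof (rule eventually_mono, intro allI impI)
    fix d v and W :: "'a set" assume d: "c \<le> real d \<and> 0 < d \<and> real m * \<bar>\<psi> 1\<bar> / real d \<le> \<epsilon>" and v: "v \<in> V d" "finite W" "card W \<le> m"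
    note cd = card_free_nbrs[OF reg v(1,2)]
    have "\<bar>real (card (nb d W v)) * \<psi> 1 / real d - \<psi> 1\<bar> = \<bar>(real (card (nb d W v)) - real d) * \<psi> 1\<bar> / real d"
      using d by (simp add: field_simps)
    also have "\<dots> \<le> real m * \<bar>\<psi> 1\<bar> / real d"
      unfolding abs_mult using cd v(3) d by (intro divide_right_mono mult_right_mono) auto
    finally show "ex d (\<lambda>f. \<bar>(\<Sum>u\<in>nb d W v. \<psi> (x d 0 f W u)) / real d - measure_pmf.expectation (gw_tree c 0) (\<lambda>t. \<psi> (tree_x l 0 t))\<bar>) \<le> \<epsilon>"
      using d by (simp add: perc_x_0)
  qed
qed

text \<open>\<open>laplace_roots\<close> reduces the transform at level \<open>Suc k\<close> to
  neighbourhood averages of \<open>1 - exp (- j * y)\<close> at level \<open>k\<close>, which the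
  hypothesis controls. One root yields means, two roots yield pair correlations.\<close>

lemma laplace_limit:
  assumes "nbr_avg_limit k" "\<epsilon> > 0"
  shows "\<forall>\<^sub>F d in sequentially. \<forall>R W. R \<subseteq> V d \<longrightarrow> R \<subseteq> W \<longrightarrow> finite W \<longrightarrow> card W \<le> m \<longrightarrow> card R \<le> 2 \<longrightarrow>
     \<bar>ex d (\<lambda>f. \<Prod>y\<in>R. exp (- (real j * (\<Sum>w\<in>nb d W y. of_bool (f {y, w}) * x d k f W w)))) - L k j ^ card R\<bar> \<le> \<epsilon>"
proof -
  let ?\<psi> = "\<lambda>y :: real. 1 - exp (- (real j * y))"
  define \<mu> where "\<mu> = measure_pmf.expectation (gw_tree c k) (\<lambda>t. ?\<psi> (tree_x l k t))"
  have \<mu>0: "0 \<le> \<mu>" unfolding \<mu>_def using tree_x_bounds(1)[OF l] by (intro Bochner_Integration.integral_nonneg) (simp add: less_imp_le)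
  have "\<forall>\<^sub>F d in sequentially. \<forall>v W. v \<in> V d \<longrightarrow> finite W \<longrightarrow> card W \<le> m \<longrightarrow>
        ex d (\<lambda>f. \<bar>(\<Sum>u\<in>nb d W v. ?\<psi> (x d k f W u)) / real d - \<mu>\<bar>) \<le> \<epsilon> / (4 * c)"
    unfolding \<mu>_def using assms c unfolding nbr_avg_limit_def
    by (elim allE[of _ ?\<psi>] allE[of _ m] allE[of _ "\<epsilon> / (4 * c)"] impE) (auto intro!: continuous_intros)
  moreover have "\<forall>\<^sub>F d in sequentially. c \<le> real d \<and> 0 < d \<and> 2 * c\<^sup>2 / real d \<le> \<epsilon> / 2"
    using assms by (intro eventually_large) auto
  ultimately show ?thesis
  proof eventually_elim
    case (elim d)
    show ?case
    proof (intro allI impI)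
      fix R and W :: "'a set" assume R: "R \<subseteq> V d" "R \<subseteq> W" "finite W" "card W \<le> m" "card R \<le> 2"
      have finR: "finite R" using R finite_subset by blast
      have Lp: "exp (- (c * (real (card R) * \<mu>))) = L k j ^ card R"
        unfolding L_def expectation_gw_tree_laplace[OF c l] \<mu>_def[symmetric] exp_of_nat_mult[symmetric] by (simp add: algebra_simps)
      have "\<bar>ex d (\<lambda>f. \<Prod>y\<in>R. exp (- (real j * (\<Sum>w\<in>nb d W y. of_bool (f {y, w}) * x d k f W w)))) - L k j ^ card R\<bar>
        \<le> real (card R) * (c\<^sup>2 / d) + c * (\<Sum>y\<in>R. ex d (\<lambda>f. \<bar>(\<Sum>w\<in>nb d W y. ?\<psi> (x d k f W w)) / real d - \<mu>\<bar>))"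
        unfolding Lp[symmetric] using elim R \<mu>0 by (intro laplace_roots[OF reg l c]) auto
      also have "\<dots> \<le> 2 * (c\<^sup>2 / d) + c * (\<Sum>y\<in>R. \<epsilon> / (4 * c))"
        using elim R c by (intro add_mono mult_right_mono mult_left_mono sum_mono) auto
      also have "c * (\<Sum>y\<in>R. \<epsilon> / (4 * c)) = real (card R) * (\<epsilon> / 4)" using c by simp
      also have "\<dots> \<le> 2 * (\<epsilon> / 4)" using R assms(2) by (intro mult_right_mono) auto
      finally show "\<bar>ex d (\<lambda>f. \<Prod>y\<in>R. exp (- (real j * (\<Sum>w\<in>nb d W y. of_bool (f {y, w}) * x d k f W w)))) - L k j ^ card R\<bar> \<le> \<epsilon>"
        using elim by simp
    qed
  qed
qed

lemma nb_insert_self: "nb d (insert v W) v = nb d W v"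
  using two_uniform_not_loop[OF regular_graph_two_uniform[OF reg[of d]]] by (auto simp: free_nbrs_def)

lemma laplace_single:
  assumes "nbr_avg_limit k" "\<epsilon> > 0"
  shows "\<forall>\<^sub>F d in sequentially. \<forall>u W. u \<in> V d \<longrightarrow> finite W \<longrightarrow> card W \<le> m \<longrightarrow>
     \<bar>ex d (\<lambda>f. exp (- (real j * s d k f W u))) - L k j\<bar> \<le> \<epsilon>"
  using laplace_limit[OF assms, of "Suc m" j]
proof (rule eventually_mono, intro allI impI)
  fix d u and W :: "'a set"
  assume lim: "\<forall>R W. R \<subseteq> V d \<longrightarrow> R \<subseteq> W \<longrightarrow> finite W \<longrightarrow> card W \<le> Suc m \<longrightarrow> card R \<le> 2 \<longrightarrow>
     \<bar>ex d (\<lambda>f. \<Prod>y\<in>R. exp (- (real j * (\<Sum>w\<in>nb d W y. of_bool (f {y, w}) * x d k f W w)))) - L k j ^ card R\<bar> \<le> \<epsilon>"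
    and u: "u \<in> V d" "finite W" "card W \<le> m"
  have "card (insert u W) \<le> Suc m" using u card_insert_le_m1[of "Suc m" W u] by (simp add: card_insert_if)
  then show "\<bar>ex d (\<lambda>f. exp (- (real j * s d k f W u))) - L k j\<bar> \<le> \<epsilon>"
    using lim[rule_format, of "{u}" "insert u W"] u by (simp add: nb_insert_self perc_s_def)
qed

text \<open>In \<open>laplace_limit\<close> both roots are deleted for both sums, whereas here
  \<open>u'\<close> may still be used from \<open>u\<close> and conversely. Deleting the other root
  changes each factor by O(1/d) in mean.\<close>

lemma laplace_pair:
  assumes "nbr_avg_limit k" "\<epsilon> > 0"
  shows "\<forall>\<^sub>F d in sequentially. \<forall>u u' W. u \<in> V d \<longrightarrow> u' \<in> V d \<longrightarrow> u \<noteq> u' \<longrightarrow> u \<notin> W \<longrightarrow> u' \<notin> W \<longrightarrow> finite W \<longrightarrow> card W \<le> m \<longrightarrow>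
     \<bar>ex d (\<lambda>f. exp (- (real j * s d k f W u)) * exp (- (real j * s d k f W u'))) - (L k j)\<^sup>2\<bar> \<le> \<epsilon>"
proof -
  define B where "B = real j * ((1 + c * perturb_const l c k) * c)"
  have "\<forall>\<^sub>F d in sequentially. c \<le> real d \<and> 0 < d \<and> (2 * B) / real d \<le> \<epsilon> / 2"
    using assms by (intro eventually_large) auto
  moreover have "\<forall>\<^sub>F d in sequentially. \<forall>R W. R \<subseteq> V d \<longrightarrow> R \<subseteq> W \<longrightarrow> finite W \<longrightarrow> card W \<le> m + 2 \<longrightarrow> card R \<le> 2 \<longrightarrow>
     \<bar>ex d (\<lambda>f. \<Prod>y\<in>R. exp (- (real j * (\<Sum>w\<in>nb d W y. of_bool (f {y, w}) * x d k f W w)))) - L k j ^ card R\<bar> \<le> \<epsilon> / 2"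
    using assms by (intro laplace_limit) auto
  ultimately show ?thesis
  proof eventually_elim
    case (elim d)
    show ?case
    proof (intro allI impI)
      fix u u' and W :: "'a set" assume u: "u \<in> V d" "u' \<in> V d" "u \<noteq> u'" "u \<notin> W" "u' \<notin> W" "finite W" "card W \<le> m"
      let ?W = "insert u (insert u' W)"
      let ?a = "\<lambda>W u f. exp (- (real j * s d k f W u))"
      have a01: "0 \<le> ?a W u f" "?a W u f \<le> 1" for W u f using perc_s_nonneg[OF l, of "E d" k f W u] by auto
      have S: "s d k f (insert u' W) u = (\<Sum>w\<in>nb d ?W u. of_bool (f {u, w}) * x d k f ?W w)"
        "s d k f (insert u W) u' = (\<Sum>w\<in>nb d ?W u'. of_bool (f {u', w}) * x d k f ?W w)" for f
        unfolding perc_s_def insert_commute[of u' u W] nb_insert_self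
        using nb_insert_self[of d u' "insert u W"] by (simp_all only: insert_commute[of u' u W])
      have P: "(\<Prod>y\<in>{u, u'}. g y) = g u * g u'" for g :: "'a \<Rightarrow> real" using u(3) by simp
      have "\<bar>ex d (\<lambda>f. \<Prod>y\<in>{u, u'}. exp (- (real j * (\<Sum>w\<in>nb d ?W y. of_bool (f {y, w}) * x d k f ?W w)))) - L k j ^ card {u, u'}\<bar> \<le> \<epsilon> / 2"
        by (rule elim(2)[rule_format]) (use u in \<open>auto simp: card_insert_if\<close>)
      moreover have card_2: "card {u, u'} = 2" using u(3) by simp
      ultimately have near: "\<bar>ex d (\<lambda>f. ?a (insert u' W) u f * ?a (insert u W) u' f) - (L k j)\<^sup>2\<bar> \<le> \<epsilon> / 2"
        unfolding P S using card_2 by (simp only:)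
      have pert: "ex d (\<lambda>f. \<bar>?a W v f - ?a (insert z W) v f\<bar>) \<le> B / real d" if "v \<in> V d" "v \<notin> W" "z \<noteq> v" for v z
      proof -
        have "ex d (\<lambda>f. \<bar>?a W v f - ?a (insert z W) v f\<bar>) \<le> ex d (\<lambda>f. real j * \<bar>s d k f W v - s d k f (insert z W) v\<bar>)"
        proof (intro integral_mono int)
          fix f
          have "\<bar>?a W v f - ?a (insert z W) v f\<bar> \<le> \<bar>real j * s d k f W v - real j * s d k f (insert z W) v\<bar>"
            by (intro exp_neg_lipschitz mult_nonneg_nonneg perc_s_nonneg[OF l]) auto
          then show "\<bar>?a W v f - ?a (insert z W) v f\<bar> \<le> real j * \<bar>s d k f W v - s d k f (insert z W) v\<bar>"
            by (simp add: abs_mult right_diff_distrib[symmetric])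
        qed
        also have "\<dots> = real j * ex d (\<lambda>f. \<bar>s d k f W v - s d k f (insert z W) v\<bar>)" by simp
        also have "\<dots> \<le> real j * ((1 + c * perturb_const l c k) * (c / real d))"
          using elim(1) that u(6) by (intro mult_left_mono perc_perturb_s[OF reg l c] perc_perturb_x[OF reg l c]) auto
        also have "\<dots> = B / real d" by (simp add: B_def)
        finally show ?thesis .
      qed
      have "\<bar>ex d (\<lambda>f. ?a W u f * ?a W u' f) - ex d (\<lambda>f. ?a (insert u' W) u f * ?a (insert u W) u' f)\<bar>
        = \<bar>ex d (\<lambda>f. ?a W u f * ?a W u' f - ?a (insert u' W) u f * ?a (insert u W) u' f)\<bar>" using int by simp
      also have "\<dots> \<le> ex d (\<lambda>f. \<bar>?a W u f * ?a W u' f - ?a (insert u' W) u f * ?a (insert u W) u' f\<bar>)" by (rule integral_abs_bound)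
      also have "\<dots> \<le> ex d (\<lambda>f. \<bar>?a W u f - ?a (insert u' W) u f\<bar> + \<bar>?a W u' f - ?a (insert u W) u' f\<bar>)"
      proof (intro integral_mono int)
        fix f
        have *: "\<bar>p * q - p' * q'\<bar> \<le> \<bar>p - p'\<bar> + \<bar>q - q'\<bar>" if "0 \<le> q" "q \<le> 1" "0 \<le> p'" "p' \<le> 1" for p q p' q' :: real
        proof -
          have "p * q - p' * q' = (p - p') * q + p' * (q - q')" by (simp add: algebra_simps)
          also have "\<bar>\<dots>\<bar> \<le> \<bar>p - p'\<bar> * q + p' * \<bar>q - q'\<bar>"
            using abs_triangle_ineq[of "(p - p') * q" "p' * (q - q')"] that by (simp add: abs_mult)
          also have "\<dots> \<le> \<bar>p - p'\<bar> * 1 + 1 * \<bar>q - q'\<bar>" using that by (intro add_mono mult_left_mono mult_right_mono) auto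
          finally show ?thesis by simp
        qed
        show "\<bar>?a W u f * ?a W u' f - ?a (insert u' W) u f * ?a (insert u W) u' f\<bar> \<le> \<bar>?a W u f - ?a (insert u' W) u f\<bar> + \<bar>?a W u' f - ?a (insert u W) u' f\<bar>"
          by (intro * a01)
      qed
      also have "\<dots> = ex d (\<lambda>f. \<bar>?a W u f - ?a (insert u' W) u f\<bar>) + ex d (\<lambda>f. \<bar>?a W u' f - ?a (insert u W) u' f\<bar>)" using int by simp
      also have "\<dots> \<le> B / real d + B / real d" using u by (intro add_mono pert) auto
      also have "\<dots> \<le> \<epsilon> / 2" using elim(1) by simp
      finally show "\<bar>ex d (\<lambda>f. ?a W u f * ?a W u' f) - (L k j)\<^sup>2\<bar> \<le> \<epsilon>" using near by linarith
    qed
  qed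
qed

text \<open>The weak law over the neighbours. The tolerances \<open>\<epsilon>\<^sup>2 / 6\<close>
  and \<open>\<epsilon>\<^sup>2 / 2\<close> make the bound of \<open>weak_law\<close> exactly
  \<open>\<epsilon>\<close>.\<close>

lemma exp_avg_limit:
  assumes "nbr_avg_limit k" "\<epsilon> > 0"
  shows "\<forall>\<^sub>F d in sequentially. \<forall>v W. v \<in> V d \<longrightarrow> finite W \<longrightarrow> card W \<le> m \<longrightarrow>
     ex d (\<lambda>f. \<bar>(\<Sum>u\<in>nb d W v. exp (- (real j * s d k f W u))) / real d - L k j\<bar>) \<le> \<epsilon>"
proof -
  have \<epsilon>': "\<epsilon>\<^sup>2 / 6 > 0" using assms by simp
  have "\<forall>\<^sub>F d in sequentially. c \<le> real d \<and> 0 < d \<and> (1 + 2 * real m) / real d \<le> \<epsilon>\<^sup>2 / 2"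
    using assms by (intro eventually_large) auto
  with laplace_single[OF assms(1) \<epsilon>', of m j] laplace_pair[OF assms(1) \<epsilon>', of m j] show ?thesis
  proof eventually_elim
    case (elim d)
    show ?case
    proof (intro allI impI)
      fix v and W :: "'a set" assume v: "v \<in> V d" "finite W" "card W \<le> m"
      have "ex d (\<lambda>f. \<bar>(\<Sum>u\<in>nb d W v. exp (- (real j * s d k f W u))) / real d - L k j\<bar>) \<le> sqrt (3 * (\<epsilon>\<^sup>2 / 6) + (1 + 2 * real m) / real d)"
      proof (rule weak_law[OF finE])
        show "finite (nb d W v)" by (rule finite_free_nbrs[OF finE])
        show "card (nb d W v) \<le> d" "d \<le> card (nb d W v) + m" using card_free_nbrs[OF reg v(1,2)] v(3) by auto
        show "d > 0" using elim by simp
        show "exp (- (real j * s d k f W u)) \<le> 1" for u f using perc_s_nonneg[OF l, of "E d" k f W u] by simp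
        show "\<bar>ex d (\<lambda>f. exp (- (real j * s d k f W u))) - L k j\<bar> \<le> \<epsilon>\<^sup>2 / 6" if "u \<in> nb d W v" for u
          using elim(1) v free_nbrs_in_V[OF reg that] by blast
        show "\<bar>ex d (\<lambda>f. exp (- (real j * s d k f W u)) * exp (- (real j * s d k f W u'))) - (L k j)\<^sup>2\<bar> \<le> \<epsilon>\<^sup>2 / 6"
          if "u \<in> nb d W v" "u' \<in> nb d W v" "u \<noteq> u'" for u u'
          using elim(2) v that(3) free_nbrs_in_V[OF reg that(1)] free_nbrs_in_V[OF reg that(2)] by blast
      qed (use L_bounds in auto)
      also have "\<dots> \<le> sqrt (\<epsilon>\<^sup>2)" using elim(3) by (intro real_sqrt_le_mono) linarith
      also have "\<dots> = \<epsilon>" using assms by simp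
      finally show "ex d (\<lambda>f. \<bar>(\<Sum>u\<in>nb d W v. exp (- (real j * s d k f W u))) / real d - L k j\<bar>) \<le> \<epsilon>" .
    qed
  qed
qed

lemma tree_approx:
  assumes approx: "\<And>r. r \<ge> 0 \<Longrightarrow> \<bar>\<psi> (1 / (1 + l * r)) - (\<Sum>i\<le>n. a i * exp (- (real i * r)))\<bar> \<le> \<epsilon>"
    and B: "\<And>y. y \<in> {0..1} \<Longrightarrow> \<bar>\<psi> y\<bar> \<le> B"
  shows "\<bar>measure_pmf.expectation (gw_tree c (Suc k)) (\<lambda>t. \<psi> (tree_x l (Suc k) t)) - (\<Sum>i\<le>n. a i * L k i)\<bar> \<le> \<epsilon>"
proof -
  let ?M = "gw_tree c (Suc k)"
  let ?r = "child_sum (tree_x l k)"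
  have r0: "0 \<le> ?r t" for t using tree_x_bounds(1)[OF l] by (intro child_sum_nonneg) (auto intro: less_imp_le)
  have i1: "integrable (measure_pmf ?M) (\<lambda>t. \<psi> (tree_x l (Suc k) t))"
    by (rule integrable_pmf_bounded[of _ _ B]) (use B tree_x_bounds[OF l, of "Suc k"] in \<open>auto intro: less_imp_le simp del: tree_x.simps\<close>)
  have i2: "integrable (measure_pmf ?M) (\<lambda>t. exp (- (real i * ?r t)))" for i
    by (rule integrable_pmf_bounded[of _ _ 1]) (use r0 in auto)
  have "(\<Sum>i\<le>n. a i * L k i) = measure_pmf.expectation ?M (\<lambda>t. \<Sum>i\<le>n. a i * exp (- (real i * ?r t)))"
    unfolding L_def by (subst Bochner_Integration.integral_sum) (auto intro!: i2 simp del: gw_tree.simps)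
  then have "\<bar>measure_pmf.expectation ?M (\<lambda>t. \<psi> (tree_x l (Suc k) t)) - (\<Sum>i\<le>n. a i * L k i)\<bar> =
     \<bar>measure_pmf.expectation ?M (\<lambda>t. \<psi> (tree_x l (Suc k) t) - (\<Sum>i\<le>n. a i * exp (- (real i * ?r t))))\<bar>"
    by (subst Bochner_Integration.integral_diff[OF i1]) (auto intro!: i2 Bochner_Integration.integrable_sum simp del: gw_tree.simps)
  also have "\<dots> \<le> measure_pmf.expectation ?M (\<lambda>t. \<bar>\<psi> (tree_x l (Suc k) t) - (\<Sum>i\<le>n. a i * exp (- (real i * ?r t)))\<bar>)"
    by (rule integral_abs_bound)
  also have "\<dots> \<le> \<epsilon>"
    using approx r0 by (intro expectation_bounds_pmf(2)[where a = 0]) auto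
  finally show ?thesis .
qed

text \<open>The test function of the message is an exponential sum in \<open>perc_s\<close> up to a
  uniform error, on the graph and on the tree alike; the averages of the exponentials converge by
  \<open>exp_avg_limit\<close>.\<close>

lemma nbr_avg_limit_Suc:
  assumes "nbr_avg_limit k"
  shows "nbr_avg_limit (Suc k)"
  unfolding nbr_avg_limit_def
proof (intro allI impI)
  fix \<psi> :: "real \<Rightarrow> real" and m \<epsilon> assume cont: "continuous_on {0..1} \<psi>" and \<epsilon>: "(\<epsilon> :: real) > 0"
  have "\<epsilon> / 4 > 0" using \<epsilon> by simp
  from message_approx[OF cont l this] obtain n a where
    a: "\<And>r. r \<ge> 0 \<Longrightarrow> \<bar>\<psi> (1 / (1 + l * r)) - (\<Sum>i\<le>n. a i * exp (- (real i * r)))\<bar> \<le> \<epsilon> / 4" by blast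
  obtain B where "\<forall>y\<in>{0..1}. \<bar>\<psi> y\<bar> \<le> B"
    using compact_imp_bounded[OF compact_continuous_image[OF cont compact_Icc]] unfolding bounded_iff by auto
  then have B: "\<bar>\<psi> y\<bar> \<le> B" if "y \<in> {0..1}" for y using that by blast
  let ?\<mu> = "measure_pmf.expectation (gw_tree c (Suc k)) (\<lambda>t. \<psi> (tree_x l (Suc k) t))"
  note tree = tree_approx[where \<psi> = \<psi> and n = n and a = a and \<epsilon> = "\<epsilon> / 4" and B = B and k = k, OF a B]
  \<comment> \<open>An error budget per exponential such that the errors weighted by
    \<open>\<bar>a i\<bar>\<close> sum to at most \<open>\<epsilon> / 2\<close>; adding 1 avoids
    division by zero.\<close>
  define \<eta> where "\<eta> i = \<epsilon> / (2 * (real n + 1) * (\<bar>a i\<bar> + 1))" for i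
  have \<eta>: "\<eta> i > 0" "\<bar>a i\<bar> * \<eta> i \<le> \<epsilon> / (2 * (real n + 1))" for i
  proof -
    show "\<eta> i > 0" using \<epsilon> by (simp add: \<eta>_def add_nonneg_pos)
    have "\<bar>a i\<bar> * \<eta> i = \<epsilon> / (2 * (real n + 1)) * (\<bar>a i\<bar> / (\<bar>a i\<bar> + 1))" by (simp add: \<eta>_def)
    also have "\<dots> \<le> \<epsilon> / (2 * (real n + 1)) * 1" using \<epsilon> by (intro mult_left_mono) auto
    finally show "\<bar>a i\<bar> * \<eta> i \<le> \<epsilon> / (2 * (real n + 1))" by simp
  qed
  have "\<forall>\<^sub>F d in sequentially. \<forall>i\<in>{..n}. \<forall>v W. v \<in> V d \<longrightarrow> finite W \<longrightarrow> card W \<le> m \<longrightarrow>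
     ex d (\<lambda>f. \<bar>(\<Sum>u\<in>nb d W v. exp (- (real i * s d k f W u))) / real d - L k i\<bar>) \<le> \<eta> i"
    using exp_avg_limit[OF assms] \<eta>(1) by (intro eventually_ball_finite) auto
  moreover have "\<forall>\<^sub>F d in sequentially. 0 < (d::nat)" by (rule eventually_gt_at_top)
  ultimately show "\<forall>\<^sub>F d in sequentially. \<forall>v W. v \<in> V d \<longrightarrow> finite W \<longrightarrow> card W \<le> m \<longrightarrow>
        ex d (\<lambda>f. \<bar>(\<Sum>u\<in>nb d W v. \<psi> (x d (Suc k) f W u)) / real d - ?\<mu>\<bar>) \<le> \<epsilon>"
  proof eventually_elim
    case (elim d)
    show ?case
    proof (intro allI impI)
      fix v and W :: "'a set" assume v: "v \<in> V d" "finite W" "card W \<le> m"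
      let ?F = "nb d W v"
      let ?avg = "\<lambda>i f. (\<Sum>u\<in>?F. exp (- (real i * s d k f W u))) / real d"
      have point: "\<bar>(\<Sum>u\<in>?F. \<psi> (x d (Suc k) f W u)) / real d - ?\<mu>\<bar> \<le> \<epsilon> / 2 + (\<Sum>i\<le>n. \<bar>a i\<bar> * \<bar>?avg i f - L k i\<bar>)" for f
      proof -
        let ?Q = "\<lambda>u. \<Sum>i\<le>n. a i * exp (- (real i * s d k f W u))"
        have "\<bar>(\<Sum>u\<in>?F. \<psi> (x d (Suc k) f W u)) - (\<Sum>u\<in>?F. ?Q u)\<bar> \<le> (\<Sum>u\<in>?F. \<bar>\<psi> (x d (Suc k) f W u) - ?Q u\<bar>)"
          unfolding sum_subtractf[symmetric] by (rule sum_abs)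
        also have "\<dots> \<le> (\<Sum>u\<in>?F. \<epsilon> / 4)"
          unfolding perc_x_Suc[OF finE] by (intro sum_mono a perc_s_nonneg[OF l])
        also have "\<dots> \<le> real d * (\<epsilon> / 4)" using card_free_nbrs(1)[OF reg v(1,2)] \<epsilon> by (simp add: mult_right_mono)
        finally have "\<bar>(\<Sum>u\<in>?F. \<psi> (x d (Suc k) f W u)) - (\<Sum>u\<in>?F. ?Q u)\<bar> / real d \<le> \<epsilon> / 4"
          using elim(2) by (simp add: divide_le_eq mult.commute)
        then have 1: "\<bar>(\<Sum>u\<in>?F. \<psi> (x d (Suc k) f W u)) / real d - (\<Sum>u\<in>?F. ?Q u) / real d\<bar> \<le> \<epsilon> / 4"
          by (simp add: diff_divide_distrib[symmetric])
        have "(\<Sum>u\<in>?F. ?Q u) / real d = (\<Sum>i\<le>n. a i * ?avg i f)"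
          by (subst sum.swap) (simp add: sum_distrib_left sum_divide_distrib)
        then have "(\<Sum>u\<in>?F. ?Q u) / real d - (\<Sum>i\<le>n. a i * L k i) = (\<Sum>i\<le>n. a i * (?avg i f - L k i))"
          by (simp add: sum_subtractf right_diff_distrib)
        then have "\<bar>(\<Sum>u\<in>?F. ?Q u) / real d - (\<Sum>i\<le>n. a i * L k i)\<bar> \<le> (\<Sum>i\<le>n. \<bar>a i\<bar> * \<bar>?avg i f - L k i\<bar>)"
          using sum_abs[of "\<lambda>i. a i * (?avg i f - L k i)" "{..n}"] by (simp add: abs_mult)
        then show ?thesis using 1 tree by linarith
      qed
      have "ex d (\<lambda>f. \<bar>(\<Sum>u\<in>?F. \<psi> (x d (Suc k) f W u)) / real d - ?\<mu>\<bar>) \<le> ex d (\<lambda>f. \<epsilon> / 2 + (\<Sum>i\<le>n. \<bar>a i\<bar> * \<bar>?avg i f - L k i\<bar>))"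
        by (intro integral_mono int point)
      also have "\<dots> = \<epsilon> / 2 + (\<Sum>i\<le>n. \<bar>a i\<bar> * ex d (\<lambda>f. \<bar>?avg i f - L k i\<bar>))" using int by simp
      also have "\<dots> \<le> \<epsilon> / 2 + (\<Sum>i\<le>n. \<epsilon> / (2 * (real n + 1)))"
      proof (intro add_left_mono sum_mono)
        fix i assume "i \<in> {..n}"
        then have "\<bar>a i\<bar> * ex d (\<lambda>f. \<bar>?avg i f - L k i\<bar>) \<le> \<bar>a i\<bar> * \<eta> i" using elim(1) v by (intro mult_left_mono) auto
        then show "\<bar>a i\<bar> * ex d (\<lambda>f. \<bar>?avg i f - L k i\<bar>) \<le> \<epsilon> / (2 * (real n + 1))" using \<eta>(2)[of i] by linarith
      qed
      also have "\<dots> = \<epsilon>" by (simp add: field_simps)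
      finally show "ex d (\<lambda>f. \<bar>(\<Sum>u\<in>?F. \<psi> (x d (Suc k) f W u)) / real d - ?\<mu>\<bar>) \<le> \<epsilon>" .
    qed
  qed
qed

lemma nbr_avg_limit: "nbr_avg_limit k"
  by (induction k) (auto intro: nbr_avg_limit_0 nbr_avg_limit_Suc)

text \<open>At a single root the message stays random, so only its expectation converges; for that,
  \<open>laplace_single\<close> without any averaging over neighbours is enough.\<close>

lemma perc_x_limit:
  assumes \<epsilon>: "\<epsilon> > 0"
  shows "\<forall>\<^sub>F d in sequentially. \<forall>v\<in>V d. \<bar>ex d (\<lambda>f. x d k f {} v) - measure_pmf.expectation (gw_tree c k) (tree_x l k)\<bar> \<le> \<epsilon>"
proof (cases k)
  case 0
  then show ?thesis using \<epsilon> by (simp add: perc_x_0)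
next
  case (Suc k')
  have "\<epsilon> / 4 > 0" using \<epsilon> by simp
  from message_approx[OF continuous_on_id l this] obtain n a where
    a: "\<And>r. r \<ge> 0 \<Longrightarrow> \<bar>1 / (1 + l * r) - (\<Sum>i\<le>n. a i * exp (- (real i * r)))\<bar> \<le> \<epsilon> / 4" by blast
  have tree: "\<bar>measure_pmf.expectation (gw_tree c (Suc k')) (tree_x l (Suc k')) - (\<Sum>i\<le>n. a i * L k' i)\<bar> \<le> \<epsilon> / 4"
    by (rule tree_approx[where \<psi> = "\<lambda>y. y" and n = n and a = a and B = 1]) (use a in auto)
  define \<eta> where "\<eta> i = \<epsilon> / (2 * (real n + 1) * (\<bar>a i\<bar> + 1))" for i
  have \<eta>: "\<eta> i > 0" "\<bar>a i\<bar> * \<eta> i \<le> \<epsilon> / (2 * (real n + 1))" for i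
  proof -
    show "\<eta> i > 0" using \<epsilon> by (simp add: \<eta>_def add_nonneg_pos)
    have "\<bar>a i\<bar> * \<eta> i = \<epsilon> / (2 * (real n + 1)) * (\<bar>a i\<bar> / (\<bar>a i\<bar> + 1))" by (simp add: \<eta>_def)
    also have "\<dots> \<le> \<epsilon> / (2 * (real n + 1)) * 1" using \<epsilon> by (intro mult_left_mono) auto
    finally show "\<bar>a i\<bar> * \<eta> i \<le> \<epsilon> / (2 * (real n + 1))" by simp
  qed
  have "\<forall>\<^sub>F d in sequentially. \<forall>i\<in>{..n}. \<forall>u W. u \<in> V d \<longrightarrow> finite W \<longrightarrow> card W \<le> 0 \<longrightarrow>
     \<bar>ex d (\<lambda>f. exp (- (real i * s d k' f W u))) - L k' i\<bar> \<le> \<eta> i"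
    by (intro eventually_ball_finite ballI laplace_single nbr_avg_limit \<eta>(1)) simp
  then show ?thesis
  proof eventually_elim
    case (elim d)
    show ?case
    proof
      fix v assume v: "v \<in> V d"
      let ?Q = "\<lambda>f. \<Sum>i\<le>n. a i * exp (- (real i * s d k' f {} v))"
      have "\<bar>ex d (\<lambda>f. x d (Suc k') f {} v) - ex d ?Q\<bar> = \<bar>ex d (\<lambda>f. x d (Suc k') f {} v - ?Q f)\<bar>" using int by simp
      also have "\<dots> \<le> ex d (\<lambda>f. \<bar>x d (Suc k') f {} v - ?Q f\<bar>)" by (rule integral_abs_bound)
      also have "\<dots> \<le> ex d (\<lambda>f. \<epsilon> / 4)"
        unfolding perc_x_Suc[OF finE] by (intro integral_mono int a perc_s_nonneg[OF l])
      finally have 1: "\<bar>ex d (\<lambda>f. x d (Suc k') f {} v) - ex d ?Q\<bar> \<le> \<epsilon> / 4" by simp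
      have "ex d ?Q - (\<Sum>i\<le>n. a i * L k' i) = (\<Sum>i\<le>n. a i * (ex d (\<lambda>f. exp (- (real i * s d k' f {} v))) - L k' i))"
        using int by (simp add: sum_subtractf right_diff_distrib)
      then have "\<bar>ex d ?Q - (\<Sum>i\<le>n. a i * L k' i)\<bar> \<le> (\<Sum>i\<le>n. \<bar>a i\<bar> * \<bar>ex d (\<lambda>f. exp (- (real i * s d k' f {} v))) - L k' i\<bar>)"
        using sum_abs[of "\<lambda>i. a i * (ex d (\<lambda>f. exp (- (real i * s d k' f {} v))) - L k' i)" "{..n}"] by (simp add: abs_mult)
      also have "\<dots> \<le> (\<Sum>i\<le>n. \<epsilon> / (2 * (real n + 1)))"
      proof (rule sum_mono)
        fix i assume "i \<in> {..n}"
        then have "\<bar>a i\<bar> * \<bar>ex d (\<lambda>f. exp (- (real i * s d k' f {} v))) - L k' i\<bar> \<le> \<bar>a i\<bar> * \<eta> i" using elim v by (intro mult_left_mono) auto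
        then show "\<bar>a i\<bar> * \<bar>ex d (\<lambda>f. exp (- (real i * s d k' f {} v))) - L k' i\<bar> \<le> \<epsilon> / (2 * (real n + 1))" using \<eta>(2)[of i] by linarith
      qed
      also have "\<dots> = \<epsilon> / 2" by (simp add: field_simps)
      finally show "\<bar>ex d (\<lambda>f. x d k f {} v) - measure_pmf.expectation (gw_tree c k) (tree_x l k)\<bar> \<le> \<epsilon>"
        unfolding Suc using 1 tree by linarith
    qed
  qed
qed

end

section \<open>The matching number\<close>

lemma regular_graph_card_edges:
  assumes "regular_graph d V E"
  shows "card E \<le> card V * d"
proof -
  have fin: "finite V" "finite E" using regular_graph_finite[OF assms] by auto
  have "E \<subseteq> (\<Union>v\<in>V. {e \<in> E. v \<in> e})"
  proof
    fix e assume e: "e \<in> E"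
    then have "e \<subseteq> V" "card e = 2" using assms by (auto simp: regular_graph_def simple_graph_def)
    then obtain v where "v \<in> e" "v \<in> V" by (metis card_2_iff insertI1 subsetD)
    then show "e \<in> (\<Union>v\<in>V. {e \<in> E. v \<in> e})" using e by auto
  qed
  then have "card E \<le> card (\<Union>v\<in>V. {e \<in> E. v \<in> e})" using fin by (intro card_mono) auto
  also have "\<dots> \<le> (\<Sum>v\<in>V. card {e \<in> E. v \<in> e})" using fin by (intro card_UN_le) auto
  also have "\<dots> = (\<Sum>v\<in>V. d)" using assms by (intro sum.cong) (auto simp: regular_graph_def degree_def)
  finally show ?thesis by simp
qed

text \<open>Forces the number of vertices to infinity with \<open>d\<close>, which makes the
  Chebyshev bound vanish.\<close>

lemma regular_graph_card_vertices:
  assumes "regular_graph d V E" "V \<noteq> {}"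
  shows "d \<le> card V"
proof -
  obtain v where v: "v \<in> V" using assms by auto
  have "d \<le> card (free_nbrs E {} v)" using card_free_nbrs(2)[OF assms(1) v, of "{}"] by simp
  also have "\<dots> \<le> card V" using free_nbrs_in_V[OF assms(1)] regular_graph_finite(1)[OF assms(1)] by (intro card_mono) auto
  finally show ?thesis .
qed

lemma expected_edges:
  assumes "finite E" "0 \<le> p" "p \<le> 1"
  shows "measure_pmf.expectation (edge_pmf E p) (\<lambda>f. real (card {e \<in> E. f e})) = p * real (card E)"
proof -
  have "real (card {e \<in> E. f e}) = (\<Sum>e\<in>E. of_bool (f e))" for f
    using assms(1) by (simp add: Int_def conj_commute)
  then have "measure_pmf.expectation (edge_pmf E p) (\<lambda>f. real (card {e \<in> E. f e})) = (\<Sum>e\<in>E. measure_pmf.expectation (edge_pmf E p) (\<lambda>f. of_bool (f e)))"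
    using assms(1) by (simp only: Bochner_Integration.integral_sum integrable_edge_pmf)
  also have "\<dots> = (\<Sum>e\<in>E. p)"
    using expectation_edge_indicator[OF assms(1) _ assms(2,3), where X = "\<lambda>_. 1"] by (intro sum.cong) auto
  finally show ?thesis by simp
qed

text \<open>The expected number of retained edges is at most \<open>c * card V\<close>, so the
  entropy error per vertex is \<open>2 * c * ln 2 / ln l\<close> uniformly in
  \<open>d\<close>.\<close>

lemma expected_matching_number_bounds:
  fixes V :: "'a set"
  assumes reg: "regular_graph d V E" and "V \<noteq> {}" and l: "l > 1" and c: "c > 0" and d: "c \<le> real d" "d > 0"
    and up: "even k" "\<And>v. v \<in> V \<Longrightarrow> measure_pmf.expectation (edge_pmf E (c / d)) (\<lambda>f. perc_x l E k f {} v) \<le> \<beta>"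
    and lo: "odd k'" "\<And>v. v \<in> V \<Longrightarrow> \<alpha> \<le> measure_pmf.expectation (edge_pmf E (c / d)) (\<lambda>f. perc_x l E k' f {} v)"
  defines "m \<equiv> measure_pmf.expectation (edge_pmf E (c / d)) (\<lambda>f. real (matching_number {e \<in> E. f e})) / real (card V)"
  shows "1 - 2 * m \<le> \<beta>" "\<alpha> \<le> 1 - 2 * m + 2 * c * ln 2 / ln l"
proof -
  let ?E = "measure_pmf.expectation (edge_pmf E (c / d))"
  let ?H = "\<lambda>f. {e \<in> E. f e}"
  let ?r = "\<lambda>f v. uncovered_prob l (?H f) {} v"
  have l0: "l > 0" using l by simp
  have p: "0 \<le> c / d" "c / d \<le> 1" using c d by auto
  have E: "two_uniform E" "finite E" "finite V" using regular_graph_two_uniform[OF reg] regular_graph_finite[OF reg] by auto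
  have EV: "\<Union>E \<subseteq> V" using reg by (auto simp: regular_graph_def simple_graph_def)
  have n: "real (card V) > 0" using E(3) assms(2) by (simp add: card_gt_0_iff)
  have H: "two_uniform (?H f)" "\<Union>(?H f) \<subseteq> V" for f using E EV by (auto simp: two_uniform_def)
  have int: "integrable (measure_pmf (edge_pmf E (c / d))) g" for g :: "_ \<Rightarrow> real" using E(2) by simp
  have m: "?E (\<lambda>f. real (matching_number (?H f))) = m * real (card V)" using n by (simp add: m_def)
  have "real (card V) * (1 - 2 * m) = ?E (\<lambda>f. real (card V) - 2 * real (matching_number (?H f)))"
    using int m by (simp add: algebra_simps)
  also have "\<dots> \<le> ?E (\<lambda>f. \<Sum>v\<in>V. ?r f v)"
    by (intro integral_mono int matching_number_uncovered(1)[OF H(1) l E(3) H(2)])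
  also have "\<dots> \<le> ?E (\<lambda>f. \<Sum>v\<in>V. perc_x l E k f {} v)"
    unfolding perc_x_def using uncovered_approx_sandwich[OF H(1) l0, of _ "{}"] up(1) by (intro integral_mono int sum_mono) auto
  also have "\<dots> = (\<Sum>v\<in>V. ?E (\<lambda>f. perc_x l E k f {} v))" using int by simp
  also have "\<dots> \<le> (\<Sum>v\<in>V. \<beta>)" by (intro sum_mono up(2))
  finally show "1 - 2 * m \<le> \<beta>" using n by simp
  have "(\<Sum>v\<in>V. \<alpha>) \<le> (\<Sum>v\<in>V. ?E (\<lambda>f. perc_x l E k' f {} v))" by (intro sum_mono lo(2))
  also have "\<dots> = ?E (\<lambda>f. \<Sum>v\<in>V. perc_x l E k' f {} v)" using int by simp
  also have "\<dots> \<le> ?E (\<lambda>f. \<Sum>v\<in>V. ?r f v)"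
    unfolding perc_x_def using uncovered_approx_sandwich[OF H(1) l0, of _ "{}"] lo(1) by (intro integral_mono int sum_mono) auto
  also have "\<dots> \<le> ?E (\<lambda>f. real (card V) - 2 * real (matching_number (?H f)) + 2 * real (card (?H f)) * ln 2 / ln l)"
    by (intro integral_mono int matching_number_uncovered(2)[OF H(1) l E(3) H(2)])
  also have "\<dots> = ?E (\<lambda>f. real (card V) - 2 * real (matching_number (?H f)) + (2 * ln 2 / ln l) * real (card (?H f)))"
    by (intro Bochner_Integration.integral_cong) auto
  also have "\<dots> = real (card V) - 2 * ?E (\<lambda>f. real (matching_number (?H f))) + (2 * ln 2 / ln l) * ?E (\<lambda>f. real (card (?H f)))"
    using int by simp
  also have "\<dots> \<le> real (card V) - 2 * (m * real (card V)) + (2 * ln 2 / ln l) * (c * real (card V))"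
  proof -
    have "real (card E) \<le> real (card V * d)" using regular_graph_card_edges[OF reg] by (rule of_nat_mono)
    then have "c / d * real (card E) \<le> c / d * real (card V * d)" using p by (intro mult_left_mono) auto
    also have "\<dots> = c * real (card V)" using d by simp
    finally have "?E (\<lambda>f. real (card (?H f))) \<le> c * real (card V)" unfolding expected_edges[OF E(2) p] .
    moreover have "0 \<le> 2 * ln 2 / ln l" using l by simp
    ultimately show ?thesis unfolding m by (intro add_mono mult_left_mono) auto
  qed
  finally have "real (card V) * \<alpha> \<le> real (card V) * (1 - 2 * m + 2 * c * ln 2 / ln l)" by (simp add: algebra_simps)
  then show "\<alpha> \<le> 1 - 2 * m + 2 * c * ln 2 / ln l" using n by (simp only: mult_le_cancel_left_pos)
qed

lemma expected_matching_number_limit: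
  fixes V :: "nat \<Rightarrow> 'a set" and E :: "nat \<Rightarrow> 'a set set"
  assumes c: "c > 0" and reg: "\<And>d. regular_graph d (V d) (E d)" and ne: "\<And>d. V d \<noteq> {}" and \<delta>: "\<delta> > 0"
  shows "\<forall>\<^sub>F d in sequentially.
     \<bar>measure_pmf.expectation (edge_pmf (E d) (c / real d)) (\<lambda>f. real (matching_number {e \<in> E d. f e})) / real (card (V d)) - F_c c\<bar> \<le> \<delta>"
proof -
  define \<Phi> where "\<Phi> = ks_potential c (y_c c)"
  obtain L0 where L0: "L0 > 0" "\<And>l. l \<ge> L0 \<Longrightarrow> \<exists>k. even k \<and> measure_pmf.expectation (gw_tree c k) (tree_x l k) \<le> \<Phi> + \<delta> / 2"
    using tree_x_upper[OF c, of "\<delta> / 2"] \<delta> by (auto simp: \<Phi>_def)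
  obtain kb where kb: "kb > 0" "\<Phi> - \<delta> / 2 \<le> measure_pmf.expectation (gw_tree c (2 * kb)) (tree_b kb)"
    using tree_b_lower[OF c, of "\<delta> / 2"] \<delta> by (auto simp: \<Phi>_def)
  \<comment> \<open>Large enough for the upper iterates, and for the entropy error to be at most
    \<open>\<delta> / 2\<close>; the 1 in the maximum guarantees \<open>l > 1\<close>.\<close>
  define l where "l = max L0 (exp (max 1 (2 * c * ln 2 / (\<delta> / 2))))"
  have lL0: "l \<ge> L0" and ll: "ln l \<ge> max 1 (2 * c * ln 2 / (\<delta> / 2))" and l1: "l > 1"
  proof -
    show "l \<ge> L0" by (simp add: l_def)
    have e: "exp (max 1 (2 * c * ln 2 / (\<delta> / 2))) \<le> l" by (simp add: l_def)
    have "1 < exp (max 1 (2 * c * ln 2 / (\<delta> / 2)))" by (simp add: max_def)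
    then show "l > 1" using e by linarith
    then show "ln l \<ge> max 1 (2 * c * ln 2 / (\<delta> / 2))" using e by (subst ln_ge_iff) auto
  qed
  have l0: "l > 0" using l1 by simp
  have ln_pos: "ln l > 0" using l1 by simp
  have "2 * c * ln 2 / (\<delta> / 2) \<le> ln l" using ll by simp
  then have lsmall: "2 * c * ln 2 / ln l \<le> \<delta> / 2" using ln_pos \<delta> by (simp add: field_simps)
  interpret percolated_sequence c l V E by unfold_locales (use c l0 reg in auto)
  obtain k where k: "even k" "measure_pmf.expectation (gw_tree c k) (tree_x l k) \<le> \<Phi> + \<delta> / 2"
    using L0(2)[OF lL0] by auto
  \<comment> \<open>The odd depth that \<open>tree_b_le_tree_x\<close> pairs with
    \<open>tree_b kb\<close>.\<close>
  define k' where "k' = 2 * (kb - 1) + 1"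
  have kk: "kb = Suc (kb - 1)" using kb by simp
  have k': "odd k'" "\<Phi> - \<delta> / 2 \<le> measure_pmf.expectation (gw_tree c k') (tree_x l k')"
  proof -
    show "odd k'" by (simp add: k'_def)
    have "\<Phi> - \<delta> / 2 \<le> measure_pmf.expectation (gw_tree c (2 * kb)) (tree_b kb)" by (rule kb)
    also have "\<dots> \<le> measure_pmf.expectation (gw_tree c (2 * kb)) (tree_x l k')"
    proof (rule expectation_mono_pmf)
      show "tree_b kb t \<le> tree_x l k' t" for t using tree_b_le_tree_x[OF l0, of "kb - 1" t] kk unfolding k'_def by metis
      show "integrable (measure_pmf (gw_tree c (2 * kb))) (tree_b kb)"
        using tree_b_bounds by (intro integrable_pmf_bounded[of _ _ 1]) auto
      show "integrable (measure_pmf (gw_tree c (2 * kb))) (tree_x l k')"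
        using tree_x_bounds[OF l0] by (intro integrable_pmf_bounded[of _ _ 1]) (auto simp: less_imp_le)
    qed
    also have "\<dots> = measure_pmf.expectation (gw_tree c k') (tree_x l k')"
    proof (rule expectation_gw_tree_trunc[where j = k'])
      show "k' \<le> 2 * kb" using kb(1) by (simp add: k'_def)
    qed (simp_all only: tree_x_trunc order_refl)
    finally show "\<Phi> - \<delta> / 2 \<le> measure_pmf.expectation (gw_tree c k') (tree_x l k')" .
  qed
  have \<delta>2: "\<delta> / 2 > 0" using \<delta> by simp
  from perc_x_limit[OF \<delta>2, of k] perc_x_limit[OF \<delta>2, of k'] eventually_large[OF \<delta>2, of 0]
  show ?thesis
  proof eventually_elim
    case (elim d)
    define m where "m = ex d (\<lambda>f. real (matching_number {e \<in> E d. f e})) / real (card (V d))"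
    have up: "ex d (\<lambda>f. x d k f {} v) \<le> \<Phi> + \<delta>" and lo: "\<Phi> - \<delta> \<le> ex d (\<lambda>f. x d k' f {} v)" if "v \<in> V d" for v
      using elim(1)[rule_format, OF that] elim(2)[rule_format, OF that] k(2) k'(2) by linarith+
    have dd: "c \<le> real d" "d > 0" using elim(3) by auto
    note bounds = expected_matching_number_bounds[OF reg ne l1 c dd k(1) up k'(1) lo]
    have "1 - 2 * m \<le> \<Phi> + \<delta>" "\<Phi> - \<delta> \<le> 1 - 2 * m + 2 * c * ln 2 / ln l"
      unfolding m_def using bounds by blast+
    moreover have "F_c c = (1 - \<Phi>) / 2" unfolding \<Phi>_def by (rule F_c_eq_potential[OF c])
    ultimately show ?case using lsmall \<delta> unfolding m_def[symmetric] by (simp add: abs_le_iff)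
  qed
qed

theorem theorem1p1:
  fixes c :: real and V :: "nat \<Rightarrow> 'a set" and E :: "nat \<Rightarrow> 'a set set"
  assumes "c > 0"
    and "\<And>d. regular_graph d (V d) (E d)"
    and "\<And>d. V d \<noteq> {}"
  shows "\<forall>\<epsilon>>0. (\<lambda>d. measure_pmf.prob (random_subgraph (E d) (c / real d))
             {H. \<bar>real (matching_number H) / real (card (V d)) - F_c c\<bar> > \<epsilon>})
           \<longlonglongrightarrow> 0"
proof (intro allI impI)
  fix \<epsilon> :: real assume \<epsilon>: "\<epsilon> > 0"
  let ?P = "\<lambda>d. measure_pmf.prob (random_subgraph (E d) (c / real d)) {H. \<bar>real (matching_number H) / real (card (V d)) - F_c c\<bar> > \<epsilon>}"
  \<comment> \<open>From here on \<open>c / d\<close> is a genuine probability.\<close>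
  have "\<forall>\<^sub>F d in sequentially. c \<le> real d \<and> 0 < d"
    by (intro eventually_conj eventually_gt_at_top) real_asymp
  moreover have "\<forall>\<^sub>F d in sequentially.
     \<bar>measure_pmf.expectation (edge_pmf (E d) (c / real d)) (\<lambda>f. real (matching_number {e \<in> E d. f e})) / real (card (V d)) - F_c c\<bar> \<le> \<epsilon> / 2"
    using \<epsilon> by (intro expected_matching_number_limit[OF assms]) auto
  ultimately have bound: "\<forall>\<^sub>F d in sequentially. ?P d \<le> 4 * c / \<epsilon>\<^sup>2 / real d"
  proof eventually_elim
    case (elim d)
    let ?M = "edge_pmf (E d) (c / real d)"
    let ?\<nu> = "\<lambda>f. real (matching_number {e \<in> E d. f e})"
    let ?n = "real (card (V d))"
    have fin: "finite (E d)" using regular_graph_finite(2)[OF assms(2)] .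
    have dn: "real d \<le> ?n" using regular_graph_card_vertices[OF assms(2,3)] by simp
    have n: "?n > 0" using dn elim(1) by linarith
    have p: "0 \<le> c / real d" "c / real d \<le> 1" using elim(1) assms(1) by auto
    have "?P d = measure_pmf.prob ?M {f. \<bar>?\<nu> f / ?n - F_c c\<bar> > \<epsilon>}"
      by (simp add: random_subgraph_def measure_map_pmf vimage_def)
    also have "\<dots> \<le> measure_pmf.prob ?M {f. \<epsilon> / 2 * ?n \<le> \<bar>?\<nu> f - measure_pmf.expectation ?M ?\<nu>\<bar>}"
    proof (rule prob_mono_pmf)
      fix f assume f: "\<bar>?\<nu> f / ?n - F_c c\<bar> > \<epsilon>"
      have "\<epsilon> / 2 \<le> \<bar>?\<nu> f / ?n - measure_pmf.expectation ?M ?\<nu> / ?n\<bar>" using f elim(2) by linarith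
      also have "\<dots> = \<bar>?\<nu> f - measure_pmf.expectation ?M ?\<nu>\<bar> / ?n" using n by (simp add: diff_divide_distrib[symmetric])
      finally show "\<epsilon> / 2 * ?n \<le> \<bar>?\<nu> f - measure_pmf.expectation ?M ?\<nu>\<bar>" using n by (simp add: pos_le_divide_eq)
    qed
    \<comment> \<open>The variance is at most \<open>c\<close> times the number of vertices, against
      a squared deviation that is quadratic in it.\<close>
    also have "\<dots> \<le> real (card (E d)) * (c / real d) / (\<epsilon> / 2 * ?n)\<^sup>2"
      using n \<epsilon> by (intro matching_number_concentration[OF fin p]) simp
    also have "\<dots> \<le> (?n * real d) * (c / real d) / (\<epsilon> / 2 * ?n)\<^sup>2"
    proof (intro divide_right_mono mult_right_mono)
      show "real (card (E d)) \<le> ?n * real d"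
        using regular_graph_card_edges[OF assms(2)] by (metis of_nat_le_iff of_nat_mult)
    qed (use p in auto)
    also have "\<dots> = 4 * c / \<epsilon>\<^sup>2 / ?n" using elim(1) n \<epsilon> by (simp add: field_simps power2_eq_square)
    also have "\<dots> \<le> 4 * c / \<epsilon>\<^sup>2 / real d" using dn elim(1) \<epsilon> assms(1) by (intro divide_left_mono) auto
    finally show ?case .
  qed
  show "?P \<longlonglongrightarrow> 0"
  proof (rule tendsto_sandwich[of "\<lambda>_. 0"])
    show "(\<lambda>d. 4 * c / \<epsilon>\<^sup>2 / real d) \<longlonglongrightarrow> 0" by real_asymp
  qed (use bound in auto)
qed

end
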